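(* Let $\beta>0$ and let $\{r_n\}_{n=1}^\infty$ be a sequence of positive real numbers. Then the following hold. (1) If $r_n\sqrt n\to0$, then $\{r_nC^n_\beta\}_{n=1}^\infty$ box-converges to a one-point metric measure space. (2) If $r_n\sqrt n\to\lambda\in(0,\infty)$, then $\{r_nC^n_\beta\}_{n=1}^\infty$ concentrates to the half line $([0,\infty),|\cdot|)$ equipped with the Borel probability measure $$\nu_{\beta,\lambda}(dt)=\frac{2^{1-\frac\beta2}}{\Gamma(\frac\beta2)}\,\frac{\lambda^\beta}{t^{\beta+1}}\,e^{-\frac{\lambda^2}{2t^2}}\,dt .$$ (3) If $r_n\sqrt n\to\infty$, then $\{r_nC^n_\beta\}_{n=1}^\infty$ infinitely dissipates.
   Context: **Cauchy space.** For $\beta>0$, $\nu^n_\beta$ is the Borel probability measure on $\mathbb{R}^n$ given by $$\nu^n_\beta(dx)=\frac{\Gamma(\frac{n+\beta}{2})}{\pi^{n/2}\Gamma(\frac\beta2)}\frac{dx}{(1+\|x\|^2)^{\frac{n+\beta}{2}}},$$ and $C^n_\beta:=(\mathbb{R}^n,\|\cdot\|,\nu^n_\beta)$ with the Euclidean distance. For an mm-space $X=(X,d_X,m_X)$ and $t>0$, $tX:=(X,t\,d_X,m_X)$. **mm-spaces.** An mm-space is a triple $X=(X,d_X,m_X)$ where $(X,d_X)$ is a complete separable metric space and $m_X$ is a Borel probability measure on $X$. A parameter of $X$ is a Borel map $\varphi:[0,1]\to X$ with $\varphi_\#\mathcal{L}^1=m_X$ ($\mathcal{L}^1$ is Lebesgue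 measure on $[0,1]$). **Box-convergence.** $\square(X,Y)$ is the infimum of $\varepsilon\ge0$ for which there exist parameters $\varphi$ of $X$, $\psi$ of $Y$ and a Borel set $J\subset[0,1]$ with $\mathcal{L}^1(J)\ge1-\varepsilon$ and $|d_X(\varphi(s),\varphi(t))-d_Y(\psi(s),\psi(t))|\le\varepsilon$ for all $s,t\in J$. $X_n$ box-converges to $X$ if $\square(X_n,X)\to0$. **Concentration.** Let $\mathcal{L}ip_1(X)$ be the set of real-valued $1$-Lipschitz functions on $X$, and $\varphi^*\mathcal{L}ip_1(X)=\{f\circ\varphi: f\in\mathcal{L}ip_1(X)\}$. The Ky Fan metric on measurable functions on $[0,1]$ is $d_{KF}(g,h)=\inf\{\varepsilon\ge0:\mathcal{L}^1(|g-h|>\varepsilon)\le\varepsilon\}$. The observable distance is $d_{conc}(X,Y)=\inf_{\varphi,\psi}d_H(\varphi^*\mathcal{L}ip_1(X),\psi^*\mathcal{L}ip_1(Y))$, where $\varphi,\psi$ run over parameters of $X,Y$ and $d_H$ is the Hausdorff distance for $d_{KF}$. $X_n$ concentrates to $X$ if $d_{conc}(X_n,X)\to0$. **Infinite dissipation.** For $\kappa_0,\dots,\kappa_N>0$, the separation distance $\operatorname{Sep}(X;\kappa_0,\dots,\kappa_N)$ is the supremum of $\min_{i\ne j}d_X(A_i,A_j)$ over all Borel sets $A_0,\dots,A_N\subset X$ with $m_X(A_i)\ge\kappa_i$ for all $i$, where $d_X(A,B)=\inf_{a\in A,b\in B}d_X(a,b)$ (and it is $0$ if no such sets exist). $\{X_n\}$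 infinitely dissipates if $\lim_{n\to\infty}\operatorname{Sep}(X_n;\kappa_0,\dots,\kappa_N)=\infty$ for every $N\geq 1$ and all $\kappa_0,\dots,\kappa_N>0$ with $\sum_i\kappa_i<1$. (Known equivalent condition: $\lim_n\operatorname{ObsDiam}(X_n;-\kappa)=\infty$ for every $\kappa\in(0,1)$, where $\operatorname{ObsDiam}(X;-\kappa)$ is the supremum over $f\in\mathcal{L}ip_1(X)$ of $\inf\{\operatorname{diam}A: A\subset\mathbb{R}\text{ Borel}, f_\#m_X(A)\ge1-\kappa\}$.) *)

theory Defs
  imports "HOL-Probability.Probability"
begin

text \<open>
  A triple $(X, d_X, m_X)$ is represented by the distance function and the measure; the underlying
  set is \<open>space (mm_meas X)\<close>.  Explicit carriers are used (rather than type classes) because the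
  spaces below form a sequence whose dimension varies with the index.
\<close>

record 'a mm_triple =
  mm_dist :: "'a \<Rightarrow> 'a \<Rightarrow> real"
  mm_meas :: "'a measure"

definition mm_space :: "'a mm_triple \<Rightarrow> bool" where
  "mm_space X \<longleftrightarrow>
     Metric_space (space (mm_meas X)) (mm_dist X) \<and>
     Metric_space.mcomplete (space (mm_meas X)) (mm_dist X) \<and>
     (\<exists>C. countable C \<and> C \<subseteq> space (mm_meas X) \<and>
        Metric_space.mtopology (space (mm_meas X)) (mm_dist X) closure_of C = space (mm_meas X)) \<and>
     sets (mm_meas X) = sigma_sets (space (mm_meas X))
        {U. openin (Metric_space.mtopology (space (mm_meas X)) (mm_dist X)) U} \<and>
     prob_space (mm_meas X)"

definition mm_scale :: "real \<Rightarrow> 'a mm_triple \<Rightarrow> 'a mm_triple" where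
  "mm_scale t X = \<lparr>mm_dist = (\<lambda>x y. t * mm_dist X x y), mm_meas = mm_meas X\<rparr>"

definition unit_leb :: "real measure" where
  "unit_leb = restrict_space lborel {0..1}"

definition parameters :: "'a mm_triple \<Rightarrow> (real \<Rightarrow> 'a) set" where
  "parameters X = {\<phi> \<in> measurable unit_leb (mm_meas X). distr unit_leb (mm_meas X) \<phi> = mm_meas X}"

text \<open>
  All infima and suprema below are taken in \<^typ>\<open>ennreal\<close>, so that the infimum of the empty
  set is \<open>\<infinity>\<close> and the supremum of the empty set is \<open>0\<close>.
\<close>

definition box_dist :: "'a mm_triple \<Rightarrow> 'b mm_triple \<Rightarrow> ennreal" where
  "box_dist X Y = (INF \<epsilon> \<in> {\<epsilon>::real. 0 \<le> \<epsilon> \<and>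
      (\<exists>\<phi> \<in> parameters X. \<exists>\<psi> \<in> parameters Y. \<exists>J \<in> sets unit_leb.
         measure unit_leb J \<ge> 1 - \<epsilon> \<and>
         (\<forall>s\<in>J. \<forall>t\<in>J. \<bar>mm_dist X (\<phi> s) (\<phi> t) - mm_dist Y (\<psi> s) (\<psi> t)\<bar> \<le> \<epsilon>))}. ennreal \<epsilon>)"

definition box_converges :: "(nat \<Rightarrow> 'a mm_triple) \<Rightarrow> 'b mm_triple \<Rightarrow> bool" where
  "box_converges X Y \<longleftrightarrow> (\<lambda>n. box_dist (X n) Y) \<longlonglongrightarrow> 0"

definition lip1 :: "'a mm_triple \<Rightarrow> ('a \<Rightarrow> real) set" where
  "lip1 X = {f. \<forall>x \<in> space (mm_meas X). \<forall>y \<in> space (mm_meas X). \<bar>f x - f y\<bar> \<le> mm_dist X x y}"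

definition lip1_pullback :: "(real \<Rightarrow> 'a) \<Rightarrow> 'a mm_triple \<Rightarrow> (real \<Rightarrow> real) set" where
  "lip1_pullback \<phi> X = (\<lambda>f. f \<circ> \<phi>) ` lip1 X"

definition ky_fan :: "(real \<Rightarrow> real) \<Rightarrow> (real \<Rightarrow> real) \<Rightarrow> ennreal" where
  "ky_fan g h = (INF \<epsilon> \<in> {\<epsilon>::real. 0 \<le> \<epsilon> \<and>
      measure unit_leb {s \<in> {0..1}. \<bar>g s - h s\<bar> > \<epsilon>} \<le> \<epsilon>}. ennreal \<epsilon>)"

definition hausdorff_dist :: "('a \<Rightarrow> 'a \<Rightarrow> ennreal) \<Rightarrow> 'a set \<Rightarrow> 'a set \<Rightarrow> ennreal" where
  "hausdorff_dist d A B = max (SUP a\<in>A. INF b\<in>B. d a b) (SUP b\<in>B. INF a\<in>A. d a b)"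

definition conc_dist :: "'a mm_triple \<Rightarrow> 'b mm_triple \<Rightarrow> ennreal" where
  "conc_dist X Y = (INF \<phi> \<in> parameters X. INF \<psi> \<in> parameters Y.
      hausdorff_dist ky_fan (lip1_pullback \<phi> X) (lip1_pullback \<psi> Y))"

definition concentrates :: "(nat \<Rightarrow> 'a mm_triple) \<Rightarrow> 'b mm_triple \<Rightarrow> bool" where
  "concentrates X Y \<longleftrightarrow> (\<lambda>n. conc_dist (X n) Y) \<longlonglongrightarrow> 0"

definition set_dist :: "'a mm_triple \<Rightarrow> 'a set \<Rightarrow> 'a set \<Rightarrow> ennreal" where
  "set_dist X A B = (INF a\<in>A. INF b\<in>B. ennreal (mm_dist X a b))"

definition separation :: "'a mm_triple \<Rightarrow> nat \<Rightarrow> (nat \<Rightarrow> real) \<Rightarrow> ennreal" where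
  "separation X N \<kappa> =
     (SUP A \<in> {A. \<forall>i\<le>N. A i \<in> sets (mm_meas X) \<and> measure (mm_meas X) (A i) \<ge> \<kappa> i}.
        INF (i, j) \<in> {(i, j). i \<le> N \<and> j \<le> N \<and> i \<noteq> j}. set_dist X (A i) (A j))"

definition infinitely_dissipates :: "(nat \<Rightarrow> 'a mm_triple) \<Rightarrow> bool" where
  "infinitely_dissipates X \<longleftrightarrow>
     (\<forall>N\<ge>1. \<forall>\<kappa>. (\<forall>i\<le>N. \<kappa> i > 0) \<and> (\<Sum>i\<le>N. \<kappa> i) < 1 \<longrightarrow>
        (\<lambda>n. separation (X n) N \<kappa>) \<longlonglongrightarrow> \<infinity>)"

text \<open>
  $\mathbb{R}^n$ is the set of functions on \<open>{..<n}\<close> (extended by \<open>undefined\<close>), with Lebesgue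
  measure \<open>PiM {..<n} (\<lambda>_. lborel)\<close> and Euclidean norm \<open>\<lambda>x. L2_set x {..<n}\<close>.
\<close>

definition cauchy_measure :: "real \<Rightarrow> nat \<Rightarrow> (nat \<Rightarrow> real) measure" where
  "cauchy_measure \<beta> n = density (Pi\<^sub>M {..<n} (\<lambda>_. lborel))
     (\<lambda>x. ennreal (Gamma ((real n + \<beta>) / 2) / (pi powr (real n / 2) * Gamma (\<beta> / 2)) *
        (1 / (1 + (L2_set x {..<n})\<^sup>2) powr ((real n + \<beta>) / 2))))"

definition cauchy_space :: "real \<Rightarrow> nat \<Rightarrow> (nat \<Rightarrow> real) mm_triple" where
  "cauchy_space \<beta> n =
     \<lparr>mm_dist = (\<lambda>x y. L2_set (\<lambda>i. x i - y i) {..<n}), mm_meas = cauchy_measure \<beta> n\<rparr>"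

definition half_line_measure :: "real \<Rightarrow> real \<Rightarrow> real measure" where
  "half_line_measure \<beta> l = density (restrict_space lborel {0..})
     (\<lambda>t. ennreal (2 powr (1 - \<beta> / 2) / Gamma (\<beta> / 2) * (l powr \<beta> / t powr (\<beta> + 1)) *
        exp (- (l\<^sup>2 / (2 * t\<^sup>2)))))"

definition half_line_space :: "real \<Rightarrow> real \<Rightarrow> real mm_triple" where
  "half_line_space \<beta> l = \<lparr>mm_dist = (\<lambda>s t. \<bar>s - t\<bar>), mm_meas = half_line_measure \<beta> l\<rparr>"

definition one_point_space :: "'a \<Rightarrow> 'a mm_triple" where
  "one_point_space p = \<lparr>mm_dist = (\<lambda>_ _. 0), mm_meas = return (count_space {p}) p\<rparr>"

text \<open>
  The spaces occurring in the statement are mm-spaces in the sense of \<open>mm_space\<close>; in particular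
  the two densities above integrate to 1 and the product sigma-algebra is the Borel one.
\<close>

lemma mm_spaceI:
  fixes X :: "'a mm_triple"
  assumes 1: "Metric_space (space (mm_meas X)) (mm_dist X)"
    and 2: "Metric_space.mcomplete (space (mm_meas X)) (mm_dist X)"
    and 3: "countable C" "C \<subseteq> space (mm_meas X)"
      "\<And>x e. x \<in> space (mm_meas X) \<Longrightarrow> e > 0 \<Longrightarrow> \<exists>y\<in>C. mm_dist X x y < e"
    and 4: "\<And>U. openin (Metric_space.mtopology (space (mm_meas X)) (mm_dist X)) U \<Longrightarrow> U \<in> sets (mm_meas X)"
    and 5: "sets (mm_meas X) \<subseteq> sigma_sets (space (mm_meas X))
        {U. openin (Metric_space.mtopology (space (mm_meas X)) (mm_dist X)) U}"
    and 6: "emeasure (mm_meas X) (space (mm_meas X)) = 1"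
  shows "mm_space X"
proof -
  interpret Metric_space "space (mm_meas X)" "mm_dist X" by fact
  have "mtopology closure_of C = space (mm_meas X)"
    unfolding metric_closure_of using 3 by (auto simp: in_mball subset_iff)
  moreover have "sigma_sets (space (mm_meas X)) {U. openin mtopology U} \<subseteq> sets (mm_meas X)"
    using 4 by (intro sets.sigma_sets_subset) auto
  ultimately show ?thesis
    unfolding mm_space_def using 1 2 3 5 6 by (auto intro!: prob_spaceI exI[of _ C])
qed

lemma mm_space_one_point: "mm_space (one_point_space p)"
proof -
  let ?X = "one_point_space p"
  have sp: "space (mm_meas ?X) = {p}" and d: "mm_dist ?X = (\<lambda>_ _. 0)"
    by (auto simp: one_point_space_def space_return)
  have st: "sets (mm_meas ?X) = Pow {p}"
    by (simp add: one_point_space_def)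
  let ?T = "Metric_space.mtopology {p} (\<lambda>_ _. 0::real)"
  have ms: "Metric_space {p} (\<lambda>_ _. 0::real)"
    by unfold_locales auto
  have op: "openin ?T {p}" 
    by (metis openin_topspace Metric_space.topspace_mtopology[OF ms])
  show ?thesis
  proof (rule mm_spaceI[of _ "{p}"]; (unfold sp d st)?)
    show "Metric_space {p} (\<lambda>_ _. 0::real)" by (rule ms)
    show "Metric_space.mcomplete {p} (\<lambda>_ _. 0::real)"
      unfolding Metric_space.mcomplete_def[OF ms] Metric_space.MCauchy_def[OF ms] Metric_space.limitin_metric[OF ms]
      by (intro allI impI exI[of _ p]) (auto simp: image_subset_iff)
    show "Pow {p} \<subseteq> sigma_sets {p} {U. openin ?T U}"
    proof
      fix A assume "A \<in> Pow {p}"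
      then consider "A = {}" | "A = {p}" by blast
      then show "A \<in> sigma_sets {p} {U. openin ?T U}"
        by cases (use op in \<open>auto intro: sigma_sets.Empty sigma_sets.Basic\<close>)
    qed
    show "U \<in> Pow {p}" if "openin ?T U" for U
      using openin_subset[OF that] by (simp add: Metric_space.topspace_mtopology[OF ms])
    show "emeasure (mm_meas ?X) {p} = 1"
      by (simp add: one_point_space_def)
  qed auto
qed

lemma mm_space_scale:
  assumes "mm_space X" "t > 0"
  shows "mm_space (mm_scale t X)"
proof -
  let ?M = "space (mm_meas X)" and ?d = "mm_dist X" and ?e = "\<lambda>x y. t * mm_dist X x y"
  interpret X: Metric_space ?M ?d using assms by (simp add: mm_space_def)
  interpret Y: Metric_space ?M ?e
  proof
    fix x y z
    show "0 \<le> ?e x y" using assms by simp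
    show "?e x y = ?e y x" by (simp add: X.commute)
    show "?e x y = 0 \<longleftrightarrow> x = y" if "x \<in> ?M" "y \<in> ?M" using that assms by simp
    show "?e x z \<le> ?e x y + ?e y z" if "x \<in> ?M" "y \<in> ?M" "z \<in> ?M"
      using X.triangle[OF that] assms by (simp flip: distrib_left)
  qed
  have ball: "Y.mball x r = X.mball x (r / t)" for x r
    using assms by (auto simp: Y.mball_def X.mball_def field_simps)
  have ex: "(\<exists>r>0. Y.mball x r \<subseteq> U) \<longleftrightarrow> (\<exists>r>0. X.mball x r \<subseteq> U)" for x U
  proof
    assume "\<exists>r>0. Y.mball x r \<subseteq> U"
    then obtain r where "r > 0" "X.mball x (r / t) \<subseteq> U" unfolding ball by blast
    then show "\<exists>r>0. X.mball x r \<subseteq> U" using assms by (intro exI[of _ "r / t"]) auto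
  next
    assume "\<exists>r>0. X.mball x r \<subseteq> U"
    then obtain r where "r > 0" "X.mball x r \<subseteq> U" by blast
    then show "\<exists>r>0. Y.mball x r \<subseteq> U"
      unfolding ball using assms by (intro exI[of _ "r * t"]) auto
  qed
  have "openin Y.mtopology U = openin X.mtopology U" for U
    unfolding Y.openin_mtopology X.openin_mtopology ex ..
  then have top: "Y.mtopology = X.mtopology" by (simp add: topology_eq)
  have cau: "X.MCauchy s" if "Y.MCauchy s" for s
    unfolding X.MCauchy_def
  proof safe
    fix e :: real assume "e > 0"
    then have "t * e > 0" using assms by simp
    with that obtain N where "\<And>n n'. N \<le> n \<Longrightarrow> N \<le> n' \<Longrightarrow> t * ?d (s n) (s n') < t * e"
      unfolding Y.MCauchy_def by blast
    then show "\<exists>N. \<forall>n n'. N \<le> n \<longrightarrow> N \<le> n' \<longrightarrow> ?d (s n) (s n') < e"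
      using assms by auto
  qed (use that in \<open>auto simp: Y.MCauchy_def\<close>)
  have "Y.mcomplete"
    using assms cau unfolding Y.mcomplete_def top mm_space_def X.mcomplete_def by blast
  then show ?thesis
    using assms Y.Metric_space_axioms
    by (simp add: mm_space_def mm_scale_def top)
qed

lemma mm_space_half_line_aux:
  assumes "sets M = sets (restrict_space borel {0..})" "emeasure M {0..} = 1"
  shows "mm_space \<lparr>mm_dist = (\<lambda>s t. \<bar>s - t\<bar>), mm_meas = M\<rparr>"
proof -
  have sp: "space M = {0::real..}"
    using sets_eq_imp_space_eq[OF assms(1)] by (simp add: space_restrict_space)
  interpret S: Submetric UNIV dist "{0::real..}"
    by (simp add: Met_TC.Metric_space_axioms Submetric.intro Submetric_axioms.intro)
  have d: "(\<lambda>s t. \<bar>s - t\<bar>) = (dist :: real \<Rightarrow> _)" by (simp add: dist_real_def fun_eq_iff)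
  have top: "S.sub.mtopology = top_of_set {0..}"
    using S.mtopology_submetric by simp
  have "sets M = sigma_sets {0..} {U. openin (top_of_set {0..}) U}"
  proof -
    have "sets (restrict_space (borel :: real measure) {0..}) = (\<inter>) {0..} ` sigma_sets UNIV {S. open S}"
      by (simp add: sets_restrict_space borel_def)
    also have "\<dots> = sigma_sets {0..} ((\<inter>) {0..} ` {S. open S})"
      by (rule sigma_sets_Int) (simp_all flip: sets_borel)
    also have "(\<inter>) {0..} ` {S. open S} = {U. openin (top_of_set {0::real..}) U}"
      by (auto simp: openin_open)
    finally show ?thesis using assms by simp
  qed
  note st = this
  show ?thesis
  proof (rule mm_spaceI[of _ "\<rat> \<inter> {0..}"]; (unfold mm_triple.simps sp d top)?)
    show "Metric_space {0::real..} dist" by (rule S.sub.Metric_space_axioms)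
    show "S.sub.mcomplete"
      by (metis S.closedin_eq_mcomplete mcomplete_iff_complete complete_UNIV mtopology_is_euclidean closed_closedin closed_atLeast)
    show "countable (\<rat> \<inter> {0::real..})" by (simp add: countable_rat)
    show "\<exists>y\<in>\<rat> \<inter> {0..}. dist x y < e" if "x \<in> {0..}" "e > 0" for x e :: real
    proof -
      obtain q where "q \<in> \<rat>" "x < q" "q < x + e"
        using Rats_dense_in_real[of x "x + e"] \<open>e > 0\<close> by auto
      then show ?thesis using that by (intro bexI[of _ q]) (auto simp: dist_real_def)
    qed
    show "U \<in> sets M" if "openin (top_of_set {0..}) U" for U
      unfolding st using that by (intro sigma_sets.Basic) simp
    show "sets M \<subseteq> sigma_sets {0..} {U. openin (top_of_set {0..}) U}" by (simp add: st)
    show "emeasure M {0..} = 1" by (rule assms)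
  qed auto
qed

lemma emeasure_half_line_measure:
  assumes "\<beta> > 0" "l > 0"
  shows "emeasure (half_line_measure \<beta> l) {0..} = 1"
proof -
  define f where "f = (\<lambda>s::real. s powr (\<beta> / 2 - 1) / exp s)"
  define g where "g = (\<lambda>t::real. l\<^sup>2 / (2 * t\<^sup>2))"
  define g' where "g' = (\<lambda>t::real. - (l\<^sup>2 / t ^ 3))"
  define h where "h = (\<lambda>t. 2 powr (1 - \<beta> / 2) / Gamma (\<beta> / 2) * (l powr \<beta> / t powr (\<beta> + 1)) *
        exp (- (l\<^sup>2 / (2 * t\<^sup>2))))"
  have G: "Gamma (\<beta> / 2) > 0" using assms by simp
  have der: "(g has_field_derivative g' x) (at x within {0<..})" if "x \<in> {0<..}" for x
    unfolding g_def g'_def using that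
    by (auto intro!: derivative_eq_intros simp: field_simps power2_eq_square power3_eq_cube)
  have inj: "inj_on g {0<..}"
    using assms by (auto simp: inj_on_def g_def field_simps power2_eq_iff_nonneg)
  have img: "g ` {0<..} = {0<..}"
  proof -
    have "y \<in> g ` {0<..}" if "y > 0" for y
      using that assms by (intro image_eqI[of _ _ "l / sqrt (2 * y)"])
        (auto simp: g_def power_divide field_simps)
    then show ?thesis using assms by (auto simp: g_def)
  qed
  have spk: "(k has_integral I) {0<..} \<longleftrightarrow> (k has_integral I) {0..}" for k :: "real \<Rightarrow> real" and I
    by (rule has_integral_spike_set_eq) (auto intro: negligible_subset[of "{0}"])
  have int0: "(f has_integral Gamma (\<beta> / 2)) {0..}"
    unfolding f_def using assms by (intro Gamma_integral_real) auto
  then have int: "(f has_integral Gamma (\<beta> / 2)) {0<..}"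
    by (subst spk)
  then have ai: "f absolutely_integrable_on {0<..}"
    by (intro nonnegative_absolutely_integrable_1) (auto simp: f_def integrable_on_def)
  have "(\<lambda>x. \<bar>g' x\<bar> * f (g x)) absolutely_integrable_on {0<..} \<and>
      integral {0<..} (\<lambda>x. \<bar>g' x\<bar> * f (g x)) = Gamma (\<beta> / 2)"
    using has_absolute_integral_change_of_variables_1'[OF _ der inj, of f "Gamma (\<beta> / 2)"]
      ai int img by (simp add: integral_unique)
  then have "((\<lambda>x. \<bar>g' x\<bar> * f (g x)) has_integral Gamma (\<beta> / 2)) {0<..}"
    by (metis absolutely_integrable_on_def integrable_integral)
  then have "((\<lambda>x. (\<bar>g' x\<bar> * f (g x)) / Gamma (\<beta> / 2)) has_integral 1) {0<..}"
    using G has_integral_divide[of _ "Gamma (\<beta> / 2)" _ "Gamma (\<beta> / 2)"] by force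
  moreover have "(\<bar>g' t\<bar> * f (g t)) / Gamma (\<beta> / 2) = h t" if "t \<in> {0<..}" for t
  proof -
    have t: "t > 0" using that by simp
    have "g t powr (\<beta> / 2 - 1) = (l / t) powr (\<beta> - 2) * 2 powr (1 - \<beta> / 2)"
    proof -
      have "g t = (l / t) powr 2 * 2 powr (-1)"
        using t assms by (simp add: g_def powr_minus field_simps)
      then have "g t powr (\<beta> / 2 - 1) = (l / t) powr (2 * (\<beta> / 2 - 1)) * 2 powr ((-1) * (\<beta> / 2 - 1))"
        using t assms by (simp only: powr_mult powr_powr)
      then show ?thesis by (simp add: algebra_simps)
    qed
    also have "(l / t) powr (\<beta> - 2) = (l powr \<beta> / l\<^sup>2) / (t powr (\<beta> + 1) / t ^ 3)"
    proof -
      have "l powr (\<beta> - 2) = l powr \<beta> / l\<^sup>2" using assms by (simp add: powr_diff)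
      moreover have "t powr (\<beta> - 2) = t powr (\<beta> + 1) / t ^ 3"
        using t powr_diff[of t "\<beta> + 1" 3] by (simp add: powr_numeral)
      ultimately show ?thesis using t assms by (simp add: powr_divide)
    qed
    finally have gp: "g t powr (\<beta> / 2 - 1) = (l powr \<beta> / l\<^sup>2) / (t powr (\<beta> + 1) / t ^ 3) * 2 powr (1 - \<beta> / 2)" .
    have fg: "f (g t) = g t powr (\<beta> / 2 - 1) * exp (- g t)"
      unfolding f_def exp_minus divide_inverse ..
    have "\<bar>g' t\<bar> = l\<^sup>2 / t ^ 3" using t by (simp add: g'_def)
    then have "\<bar>g' t\<bar> * f (g t) = l\<^sup>2 / t ^ 3 * ((l powr \<beta> / l\<^sup>2) / (t powr (\<beta> + 1) / t ^ 3) * 2 powr (1 - \<beta> / 2)) * exp (- g t)"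
      unfolding fg gp by (simp only: mult.assoc)
    also have "\<dots> = 2 powr (1 - \<beta> / 2) * (l powr \<beta> / t powr (\<beta> + 1)) * exp (- g t)"
    proof -
      have *: "A / B * ((C / A) / (D / B) * E) = E * (C / D)" if "A \<noteq> 0" "B \<noteq> 0" for A B C D E :: real
        using that by simp
      show ?thesis using t assms by (subst *) auto
    qed
    finally show ?thesis unfolding h_def g_def by (simp only: divide_inverse mult_ac)
  qed
  ultimately have "(h has_integral 1) {0<..}"
    by (rule has_integral_eq[rotated])
  then have hint: "(h has_integral 1) {0..}"
    by (subst (asm) spk)
  have hn: "h t \<ge> 0" for t using G by (auto simp: h_def)
  have hm [measurable]: "h \<in> borel_measurable borel" unfolding h_def by measurable
  have hd: "half_line_measure \<beta> l = density (restrict_space lborel {0..}) (\<lambda>t. ennreal (h t))"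
    unfolding half_line_measure_def h_def ..
  have "emeasure (half_line_measure \<beta> l) {0..} = (\<integral>\<^sup>+ t. ennreal (h t) * indicator {0..} t \<partial>lborel)"
    unfolding hd
    by (subst emeasure_density)
       (auto simp: nn_integral_restrict_space sets_restrict_space_iff measurable_restrict_space1
          intro!: nn_integral_cong split: split_indicator)
  also have "\<dots> = (\<integral>\<^sup>+ t. ennreal (indicator {0..} t * h t) \<partial>lborel)"
    by (intro nn_integral_cong) (auto split: split_indicator)
  also have "\<dots> = 1"
    using nn_integral_has_integral_lebesgue[OF _ hint] hn by simp
  finally show ?thesis .
qed

lemma mm_space_half_line:
  assumes "\<beta> > 0" "l > 0"
  shows "mm_space (half_line_space \<beta> l)"
  unfolding half_line_space_def
proof (rule mm_space_half_line_aux)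
  show "sets (half_line_measure \<beta> l) = sets (restrict_space borel {0..})"
    by (simp add: half_line_measure_def sets_restrict_space)
qed (rule emeasure_half_line_measure[OF assms])

lemma emeasure_cauchy_measure:
  assumes "\<beta> > 0"
  shows "emeasure (cauchy_measure \<beta> n) (space (cauchy_measure \<beta> n)) = 1"
proof -
  interpret product_sigma_finite "\<lambda>_::nat. lborel :: real measure" by standard
  let ?P = "Pi\<^sub>M {..<n} (\<lambda>_. lborel :: real measure)"
  interpret P: sigma_finite_measure ?P by (rule sigma_finite) simp
  interpret pair_sigma_finite ?P lborel ..
  define s where "s = (real n + \<beta>) / 2"
  have s: "s > 0" using assms by (simp add: s_def add_nonneg_pos)
  let ?w = "\<lambda>x. 1 + (L2_set x {..<n})\<^sup>2"
  have w: "?w x > 0" for x by (simp add: add_pos_nonneg)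
  have wm [measurable]: "(\<lambda>x. ?w x) \<in> borel_measurable ?P"
    unfolding L2_set_def by measurable
  have gamma: "ennreal (Gamma s * (1 / a powr s)) =
      (\<integral>\<^sup>+ t. ennreal (indicator {0<..} t * t powr (s - 1) * exp (- (a * t))) \<partial>lborel)" if a: "a > 0" for a
  proof -
    have "ennreal (Gamma s) = (\<integral>\<^sup>+ t. ennreal (indicator {0..} t * t powr (s - 1) / exp t) \<partial>lborel)"
      using s by (rule Gamma_conv_nn_integral_real)
    also have "\<dots> = ennreal a * (\<integral>\<^sup>+ t. ennreal (indicator {0..} (a * t) * (a * t) powr (s - 1) / exp (a * t)) \<partial>lborel)"
      using a by (subst nn_integral_real_affine[where c = a and t = 0]) auto
    also have "\<dots> = (\<integral>\<^sup>+ t. ennreal (a powr s) * ennreal (indicator {0<..} t * t powr (s - 1) * exp (- (a * t))) \<partial>lborel)"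
    proof (subst nn_integral_cmult[symmetric], goal_cases)
      case 2
      show ?case
      proof (rule nn_integral_cong)
        fix t :: real
        have "a * (indicator {0..} (a * t) * (a * t) powr (s - 1) / exp (a * t)) =
          a powr s * (indicator {0<..} t * t powr (s - 1) * exp (- (a * t)))"
          using a powr_add[of a 1 "s - 1"]
          by (cases "t = 0") (auto simp: indicator_def zero_le_mult_iff powr_mult exp_minus field_simps)
        then show "ennreal a * ennreal (indicator {0..} (a * t) * (a * t) powr (s - 1) / exp (a * t)) =
          ennreal (a powr s) * ennreal (indicator {0<..} t * t powr (s - 1) * exp (- (a * t)))"
          using a by (simp flip: ennreal_mult')
      qed
    qed auto
    also have "\<dots> = ennreal (a powr s) * (\<integral>\<^sup>+ t. ennreal (indicator {0<..} t * t powr (s - 1) * exp (- (a * t))) \<partial>lborel)"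
      by (subst nn_integral_cmult) auto
    finally have "ennreal (1 / a powr s) * ennreal (Gamma s) = ennreal (1 / a powr s) * ennreal (a powr s) *
      (\<integral>\<^sup>+ t. ennreal (indicator {0<..} t * t powr (s - 1) * exp (- (a * t))) \<partial>lborel)"
      by (simp add: mult.assoc)
    then show ?thesis using a s by (simp flip: ennreal_mult' add: mult.commute)
  qed
  have gauss: "(\<integral>\<^sup>+ x. ennreal (exp (- (t * x\<^sup>2))) \<partial>lborel) = ennreal (sqrt (pi / t))" if t: "t > 0" for t
  proof -
    define \<sigma> where "\<sigma> = sqrt (1 / (2 * t))"
    have \<sigma>: "\<sigma> > 0" "\<sigma>\<^sup>2 = 1 / (2 * t)" using t by (auto simp: \<sigma>_def)
    have "exp (- (t * x\<^sup>2)) = sqrt (pi / t) * normal_density 0 \<sigma> x" for x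
      using t by (simp add: normal_density_def \<sigma> field_simps real_sqrt_divide)
    then have "(\<integral>\<^sup>+ x. ennreal (exp (- (t * x\<^sup>2))) \<partial>lborel) =
        (\<integral>\<^sup>+ x. ennreal (sqrt (pi / t)) * ennreal (normal_density 0 \<sigma> x) \<partial>lborel)"
      using t by (simp add: ennreal_mult')
    also have "\<dots> = ennreal (sqrt (pi / t)) * (\<integral>\<^sup>+ x. ennreal (normal_density 0 \<sigma> x) \<partial>lborel)"
      by (rule nn_integral_cmult) auto
    also have "(\<integral>\<^sup>+ x. ennreal (normal_density 0 \<sigma> x) \<partial>lborel) = 1"
      using \<sigma> by (simp add: nn_integral_eq_integral)
    finally show ?thesis by simp
  qed
  have gaussn: "(\<integral>\<^sup>+ x. ennreal (exp (- (t * (L2_set x {..<n})\<^sup>2))) \<partial>?P) = ennreal ((pi / t) powr (real n / 2))"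
    if t: "t > 0" for t
  proof -
    have "(\<integral>\<^sup>+ x. ennreal (exp (- (t * (L2_set x {..<n})\<^sup>2))) \<partial>?P) =
        (\<integral>\<^sup>+ x. (\<Prod>i<n. ennreal (exp (- (t * (x i)\<^sup>2)))) \<partial>?P)"
      by (intro nn_integral_cong)
         (simp add: L2_set_def sum_nonneg sum_distrib_left prod_ennreal exp_sum flip: sum_negf)
    also have "\<dots> = (\<Prod>i<n. \<integral>\<^sup>+ x. ennreal (exp (- (t * x\<^sup>2))) \<partial>lborel)"
      by (rule product_nn_integral_prod) auto
    also have "\<dots> = ennreal (sqrt (pi / t) ^ n)"
      using t by (simp add: gauss ennreal_power)
    also have "sqrt (pi / t) ^ n = (pi / t) powr (real n / 2)"
      using t by (simp add: powr_half_sqrt[symmetric] powr_powr flip: powr_realpow)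
    finally show ?thesis .
  qed
  have key: "(\<integral>\<^sup>+ x. ennreal (Gamma s * (1 / ?w x powr s)) \<partial>?P) = ennreal (pi powr (real n / 2) * Gamma (\<beta> / 2))"
  proof -
    have "(\<integral>\<^sup>+ x. ennreal (Gamma s * (1 / ?w x powr s)) \<partial>?P) =
      (\<integral>\<^sup>+ x. \<integral>\<^sup>+ t. ennreal (indicator {0<..} t * t powr (s - 1) * exp (- (?w x * t))) \<partial>lborel \<partial>?P)"
      by (intro nn_integral_cong gamma w)
    also have "\<dots> = (\<integral>\<^sup>+ t. \<integral>\<^sup>+ x. ennreal (indicator {0<..} t * t powr (s - 1) * exp (- (?w x * t))) \<partial>?P \<partial>lborel)"
      by (rule Fubini'[symmetric]) (unfold L2_set_def, measurable)
    also have "\<dots> = (\<integral>\<^sup>+ t. ennreal (pi powr (real n / 2)) * ennreal (indicator {0..} t * t powr (\<beta> / 2 - 1) / exp t) \<partial>lborel)"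
    proof (rule nn_integral_cong)
      fix t :: real
      show "(\<integral>\<^sup>+ x. ennreal (indicator {0<..} t * t powr (s - 1) * exp (- (?w x * t))) \<partial>?P) =
        ennreal (pi powr (real n / 2)) * ennreal (indicator {0..} t * t powr (\<beta> / 2 - 1) / exp t)"
      proof (cases "t > 0")
        case True
        have "(\<integral>\<^sup>+ x. ennreal (indicator {0<..} t * t powr (s - 1) * exp (- (?w x * t))) \<partial>?P) =
          (\<integral>\<^sup>+ x. ennreal (t powr (s - 1) * exp (- t)) * ennreal (exp (- (t * (L2_set x {..<n})\<^sup>2))) \<partial>?P)"
          using True by (intro nn_integral_cong)
            (simp flip: ennreal_mult' exp_add add: algebra_simps)
        also have "\<dots> = ennreal (t powr (s - 1) * exp (- t)) * ennreal ((pi / t) powr (real n / 2))"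
          unfolding gaussn[OF True, symmetric] by (rule nn_integral_cmult) (unfold L2_set_def, measurable)
        also have "\<dots> = ennreal (t powr (s - 1) * exp (- t) * (pi / t) powr (real n / 2))"
          by (simp flip: ennreal_mult')
        also have "t powr (s - 1) * exp (- t) * (pi / t) powr (real n / 2) =
            pi powr (real n / 2) * (t powr (\<beta> / 2 - 1) / exp t)"
        proof -
          have "t powr (s - 1) = t powr (\<beta> / 2 - 1) * t powr (real n / 2)"
            by (simp add: s_def add_divide_distrib algebra_simps flip: powr_add)
          then show ?thesis using True by (simp add: powr_divide exp_minus field_simps)
        qed
        finally show ?thesis
          using True ennreal_mult'[of "pi powr (real n / 2)" "t powr (\<beta> / 2 - 1) / exp t"] by simp
      qed (auto simp: indicator_def)
    qed
    also have "\<dots> = ennreal (pi powr (real n / 2)) * (\<integral>\<^sup>+ t. ennreal (indicator {0..} t * t powr (\<beta> / 2 - 1) / exp t) \<partial>lborel)"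
      by (rule nn_integral_cmult) auto
    also have "\<dots> = ennreal (pi powr (real n / 2)) * ennreal (Gamma (\<beta> / 2))"
      using assms by (subst Gamma_conv_nn_integral_real) auto
    finally show ?thesis using assms by (simp add: ennreal_mult')
  qed
  let ?c = "1 / (pi powr (real n / 2) * Gamma (\<beta> / 2))"
  have c: "pi powr (real n / 2) * Gamma (\<beta> / 2) > 0" using assms by simp
  have "emeasure (cauchy_measure \<beta> n) (space (cauchy_measure \<beta> n)) =
    (\<integral>\<^sup>+ x. ennreal (Gamma s / (pi powr (real n / 2) * Gamma (\<beta> / 2)) * (1 / ?w x powr s)) \<partial>?P)"
    unfolding cauchy_measure_def s_def[symmetric] space_density
    by (subst emeasure_density) (auto intro!: nn_integral_cong)
  also have "\<dots> = (\<integral>\<^sup>+ x. ennreal ?c * ennreal (Gamma s * (1 / ?w x powr s)) \<partial>?P)"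
    using c by (intro nn_integral_cong) (simp flip: ennreal_mult')
  also have "\<dots> = ennreal ?c * ennreal (pi powr (real n / 2) * Gamma (\<beta> / 2))"
    unfolding key[symmetric] by (rule nn_integral_cmult) measurable
  also have "\<dots> = ennreal (?c * (pi powr (real n / 2) * Gamma (\<beta> / 2)))"
    using c by (intro ennreal_mult'[symmetric]) simp
  also have "\<dots> = 1" using c by (metis ennreal_1 less_irrefl nonzero_eq_divide_eq)
  finally show ?thesis .
qed

lemma mm_space_cauchy:
  assumes "\<beta> > 0"
  shows "mm_space (cauchy_space \<beta> n)"
proof -
  let ?M = "PiE {..<n} (\<lambda>_. UNIV :: real set)"
  let ?d = "\<lambda>x y. L2_set (\<lambda>i. x i - y i :: real) {..<n}"
  let ?P = "Pi\<^sub>M {..<n} (\<lambda>_. lborel :: real measure)"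
  have sp: "space (mm_meas (cauchy_space \<beta> n)) = ?M" and d: "mm_dist (cauchy_space \<beta> n) = ?d"
    and st: "sets (mm_meas (cauchy_space \<beta> n)) = sets ?P"
    by (simp_all add: cauchy_space_def cauchy_measure_def space_PiM)
  interpret Metric_space ?M ?d
  proof
    fix x y z :: "nat \<Rightarrow> real"
    show "?d x y \<ge> 0" by simp
    show "?d x y = ?d y x" by (simp add: L2_set_def power2_commute)
    show "?d x y = 0 \<longleftrightarrow> x = y" if "x \<in> ?M" "y \<in> ?M"
      using PiE_ext[OF that] by (auto simp: L2_set_eq_0_iff)
    have "?d x z = L2_set (\<lambda>i. (x i - y i) + (y i - z i)) {..<n}" by simp
    also have "\<dots> \<le> ?d x y + ?d y z" by (rule L2_set_triangle_ineq)
    finally show "?d x z \<le> ?d x y + ?d y z" .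
  qed
  have le: "\<bar>x i - y i\<bar> \<le> ?d x y" if "i < n" for x y i
    using member_le_L2_set[of "{..<n}" i "\<lambda>i. \<bar>x i - y i\<bar>"] that by (simp add: L2_set_def)
  have small: "?d x y < e" if "e > 0" "\<And>i. i < n \<Longrightarrow> \<bar>x i - y i\<bar> < e / (real n + 1)" for x y e
  proof -
    have "?d x y \<le> (\<Sum>i<n. \<bar>x i - y i\<bar>)" by (rule L2_set_le_sum_abs)
    also have "\<dots> \<le> (\<Sum>i<n. e / (real n + 1))" using that by (intro sum_mono less_imp_le) auto
    also have "\<dots> < e" using that by (simp add: field_simps)
    finally show ?thesis .
  qed
  have comp: mcomplete
    unfolding mcomplete_def
  proof safe
    fix s assume s: "MCauchy s"
    have "\<exists>l. (\<lambda>k. s k i) \<longlonglongrightarrow> l" if "i < n" for i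
    proof -
      have "Cauchy (\<lambda>k. s k i)"
        unfolding Cauchy_def dist_real_def
        using s le[OF that] unfolding MCauchy_def by (meson le_less_trans)
      then show ?thesis by (simp add: Cauchy_convergent_iff convergent_def)
    qed
    then obtain L where L: "\<And>i. i < n \<Longrightarrow> (\<lambda>k. s k i) \<longlonglongrightarrow> L i" by metis
    let ?L = "restrict L {..<n}"
    have "\<forall>\<^sub>F k in sequentially. ?d (s k) ?L < e" if "e > 0" for e
    proof -
      have e: "e / (real n + 1) > 0" using that by simp
      have "\<forall>\<^sub>F k in sequentially. \<forall>i\<in>{..<n}. \<bar>s k i - L i\<bar> < e / (real n + 1)"
        using tendstoD[OF L e] by (intro eventually_ball_finite ballI) (auto simp: dist_real_def)
      then show ?thesis
        by eventually_elim (use that in \<open>auto intro!: small\<close>)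
    qed
    then have "limitin mtopology s ?L sequentially"
      using s unfolding limitin_metric MCauchy_def
      by (auto simp: image_subset_iff eventually_conj_iff simp del: restrict_apply)
    then show "\<exists>x. limitin mtopology s x sequentially" by (rule exI[of _ ?L])
  qed
  have meas: "U \<in> sets ?P" if U: "openin mtopology U" for U
  proof -
    let ?R = "\<lambda>x::nat \<Rightarrow> real. restrict x {..<n}"
    let ?V = "{x. ?R x \<in> U}"
    have "open ?V"
      unfolding open_fun_def openin_product_topology_alt
    proof safe
      fix x assume x: "?R x \<in> U"
      then obtain r where r: "r > 0" "mball (?R x) r \<subseteq> U"
        using U unfolding openin_mtopology by blast
      let ?X = "\<lambda>i. if i < n then ball (x i) (r / (real n + 1)) else UNIV"
      have "Pi\<^sub>E UNIV ?X \<subseteq> ?V"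
      proof
        fix y assume y: "y \<in> Pi\<^sub>E UNIV ?X"
        have "?d (?R x) (?R y) < r"
          using y r by (intro small) (auto simp: PiE_iff dist_real_def split: if_splits)
        then show "y \<in> ?V" using r by (auto simp: in_mball subset_iff)
      qed
      moreover have "finite {i. ?X i \<noteq> UNIV}"
        by (rule finite_subset[of _ "{..<n}"]) auto
      moreover have "x \<in> Pi\<^sub>E UNIV ?X" using r by auto
      ultimately show "\<exists>Ua. finite {i \<in> UNIV. Ua i \<noteq> topspace euclidean} \<and>
          (\<forall>i\<in>UNIV. openin euclidean (Ua i)) \<and> x \<in> Pi\<^sub>E UNIV Ua \<and> Pi\<^sub>E UNIV Ua \<subseteq> ?V"
        by (intro exI[of _ ?X]) auto
    qed
    then have V: "?V \<in> sets (Pi\<^sub>M UNIV (\<lambda>_::nat. borel :: real measure))"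
      unfolding sets_PiM_equal_borel by simp
    let ?E = "\<lambda>(x::nat\<Rightarrow>real) i. if i < n then x i else 0"
    have "(\<lambda>x. x i) \<in> borel_measurable ?P" if "i < n" for i
      using that measurable_component_singleton[of i "{..<n}" "\<lambda>_. lborel"] by simp
    then have "(\<lambda>x. ?E x i) \<in> borel_measurable ?P" for i
      by (cases "i < n") simp_all
    then have E: "?E \<in> measurable ?P (Pi\<^sub>M UNIV (\<lambda>_. borel))"
      by (intro measurable_PiM_single') (auto simp: space_PiM)
    have "?E -` ?V \<inter> space ?P \<in> sets ?P" using E V by (rule measurable_sets)
    also have "?E -` ?V \<inter> space ?P = U"
    proof -
      have "?R (?E x) = x" if "x \<in> ?M" for x
        using that by (auto simp: fun_eq_iff PiE_iff extensional_def)
      then show ?thesis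
        using openin_subset[OF U] by (auto simp: space_PiM subset_iff)
    qed
    finally show ?thesis .
  qed
  have gen: "sets ?P \<subseteq> sigma_sets ?M {U. openin mtopology U}"
  proof -
    let ?S = "sigma ?M {U. openin mtopology U}"
    have sub: "{U. openin mtopology U} \<subseteq> Pow ?M" using openin_subset by fastforce
    have "(\<lambda>x. x i) \<in> borel_measurable ?S" if i: "i < n" for i
    proof (rule borel_measurableI)
      fix A :: "real set" assume A: "open A"
      have "openin mtopology ((\<lambda>x. x i) -` A \<inter> ?M)"
        unfolding openin_mtopology
      proof safe
        fix x assume "x i \<in> A"
        then obtain e where e: "e > 0" "ball (x i) e \<subseteq> A" using A openE by blast
        have "mball x e \<subseteq> (\<lambda>x. x i) -` A \<inter> ?M"
        proof
          fix y assume y: "y \<in> mball x e"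
          then have "\<bar>x i - y i\<bar> < e" using le[OF i, of x y] unfolding in_mball by linarith
          then have "y i \<in> A" using e(2) by (auto simp: dist_real_def)
          then show "y \<in> (\<lambda>x. x i) -` A \<inter> ?M" using y by (simp only: in_mball vimage_eq Int_iff)
        qed
        then show "\<exists>r>0. mball x r \<subseteq> (\<lambda>x. x i) -` A \<inter> ?M" using e by blast
      qed
      then show "(\<lambda>x. x i) -` A \<inter> space ?S \<in> sets ?S"
        unfolding sets_measure_of[OF sub] space_measure_of[OF sub] by (intro sigma_sets.Basic CollectI)
    qed
    then have "(\<lambda>x. x) \<in> measurable ?S ?P"
      by (intro measurable_PiM_single') (auto simp only: space_measure_of[OF sub] space_lborel space_borel UNIV_I measurable_lborel1 lessThan_iff)
    note id = this
    have "A \<in> sets ?S" if A: "A \<in> sets ?P" for A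
    proof -
      have "(\<lambda>x. x) -` A \<inter> ?M \<in> sets ?S"
        using measurable_sets[OF id A] unfolding space_measure_of[OF sub] .
      moreover have "A \<subseteq> ?M" using sets.sets_into_space[OF A] by (simp add: space_PiM)
      ultimately show ?thesis by (simp only: vimage_ident Int_absorb2)
    qed
    then show ?thesis unfolding sets_measure_of[OF sub] ..
  qed
  show ?thesis
  proof (rule mm_spaceI[of _ "PiE {..<n} (\<lambda>_. \<rat>)"]; (unfold sp d st)?)
    show "countable (PiE {..<n} (\<lambda>_. \<rat> :: real set))"
      by (intro countable_PiE) (auto simp: countable_rat)
    show "\<exists>y\<in>PiE {..<n} (\<lambda>_. \<rat>). ?d x y < e" if "x \<in> ?M" "e > 0" for x e
    proof -
      have "\<exists>q\<in>\<rat>. \<bar>x i - q\<bar> < e / (real n + 1)" for i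
      proof -
        have "e / (real n + 1) > 0" using that(2) by (simp add: add_nonneg_pos)
        obtain q where "q \<in> \<rat>" "x i < q" "q < x i + e / (real n + 1)"
          using Rats_dense_in_real[of "x i" "x i + e / (real n + 1)"] \<open>e / (real n + 1) > 0\<close> by auto
        then show ?thesis by (intro bexI[of _ q]) auto
      qed
      then obtain q where q: "\<And>i. q i \<in> \<rat>" "\<And>i. \<bar>x i - q i\<bar> < e / (real n + 1)" by metis
      then show ?thesis
        using that by (intro bexI[of _ "restrict q {..<n}"] small) auto
    qed
    show "emeasure (mm_meas (cauchy_space \<beta> n)) ?M = 1"
      using emeasure_cauchy_measure[OF assms, of n] sp by (simp add: cauchy_space_def)
    show "Metric_space ?M ?d" by (rule Metric_space_axioms)
    show "PiE {..<n} (\<lambda>_. \<rat>) \<subseteq> ?M" by (intro PiE_mono) simp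
    show "U \<in> sets ?P" if "openin mtopology U" for U using that by (rule meas)
  qed (rule comp gen)+
qed

end

theory Submission
  imports Defs
begin

text \<open>
  The Cauchy measure is a Gaussian scale mixture: it is the law of $a Z$ with $Z$ standard Gaussian
  in $\mathbb{R}^n$ and $a$ independent of $Z$ with the law $\nu_{\beta,1}$ on the half line.
  A 1-Lipschitz function of $Z$ has variance bounded independently of $n$, so $\|Z\|$ deviates from
  $\sqrt n$ by $O(1)$, and $r_n \|a Z\|$ is close to $\lambda a$, whose law is $\nu_{\beta,\lambda}$.
  Realising $(Z, a)$ on the unit interval couples the Cauchy space with the half line. For
  $\lambda = 0$ the mass collapses to a small ball. For $\lambda > 0$ a Lipschitz function $F$ is
  close to its Gaussian mean at the scale of $a$, which is a 1-Lipschitz function of $\lambda a$.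
  When $r_n \sqrt n \to \infty$, spherical shells over disjoint intervals of values of $a$ carry the
  prescribed masses and move infinitely far apart.

  The variance bound follows from the one-dimensional Prekopa-Leindler inequality, which gives
  $\int e^F d\gamma \int e^{-F} d\gamma \le e$ for 1-Lipschitz $F$ and tensorises.
\<close>

section \<open>The Prekopa-Leindler inequality on the real line\<close>

text \<open>Two obstacles shape the estimates. The density of the mixing law decays like
  t^(-\<beta>-1), so for \<beta> \<le> 2 it has no second moment and Chebyshev's inequality cannot
  be applied to the mixture as a whole. It is applied for each fixed a \<le> R, and the tail a > R
  is charged separately, with R chosen before n. For the Gaussian part only the order of the
  variance bound matters: a bounded sequence r_n sqrt n forces r_n -> 0, so any constant independent
  of n is wiped out by r_n^2. This is why the crude constants 3, 6 and 12 suffice, and why an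
  exponential estimate that asks for no derivative of F is good enough. In the dissipating case r_n
  sqrt n has no finite limit to compare with, so the deviation estimate is used at the scale 1 /
  sqrt n instead; the factor r_n sqrt n enters only when distances are measured.\<close>

text \<open>\<open>A\<close> may have infinite measure, so it is cut down to a bounded piece of
  measure still above \<open>c\<close>. There the excess over \<open>c\<close> is positive and
  finite, and a closed approximation within that error is compact.\<close>

lemma lborel_inner_compact:
  fixes A :: "real set"
  assumes A: "A \<in> sets borel" and c: "c < emeasure lborel A"
  obtains K where "compact K" "K \<subseteq> A" "c < emeasure lborel K"
proof -
  have "incseq (\<lambda>n. A \<inter> {- real n..real n})"
    by (auto simp: incseq_def)
  then have "(SUP n. emeasure lborel (A \<inter> {- real n..real n})) = emeasure lborel (\<Union>n. A \<inter> {- real n..real n})"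
    using A by (intro SUP_emeasure_incseq) auto
  also have "(\<Union>n. A \<inter> {- real n..real n}) = A"
  proof -
    have "\<exists>n. - real n \<le> x \<and> x \<le> real n" for x :: real
    proof -
      obtain n where "\<bar>x\<bar> \<le> real n" using real_arch_simple by blast
      then have "- real n \<le> x \<and> x \<le> real n" by arith
      then show ?thesis ..
    qed
    then show ?thesis by auto
  qed
  finally have "c < (SUP n. emeasure lborel (A \<inter> {- real n..real n}))"
    using c by simp
  then obtain n where n: "c < emeasure lborel (A \<inter> {- real n..real n})"
    unfolding less_SUP_iff by blast
  define B where "B = A \<inter> {- real n..real n}"
  have B: "B \<in> sets borel" using A by (simp add: B_def)
  have "emeasure lborel B \<le> emeasure lborel {- real n..real n}"
    using A by (intro emeasure_mono) (auto simp: B_def)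
  then have fin: "emeasure lborel B < \<infinity>" by (auto simp: less_top[symmetric] top_unique)
  define e where "e = emeasure lborel B - c"
  have e: "e > 0" "e < \<infinity>"
    using n fin by (auto simp: e_def B_def[symmetric] diff_gr0_ennreal less_top[symmetric] ennreal_minus_eq_top)
  then obtain r where r: "e = ennreal r" "r > 0"
    by (cases e) auto
  have "B \<in> sets lebesgue" using B by simp
  from sets_lebesgue_inner_closed[OF this r(2)]
  obtain T where T: "closed T" "T \<subseteq> B" "emeasure lebesgue (B - T) < ennreal r" .
  have TB: "T \<in> sets borel" using T by simp
  have eT: "emeasure lborel (B - T) < e"
    using T(3) r B TB by simp
  have "c + e = emeasure lborel B" 
    using n unfolding e_def B_def[symmetric] by (intro add_diff_inverse_ennreal) simp
  also have "\<dots> = emeasure lborel T + emeasure lborel (B - T)"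
    using T(2) B TB by (subst plus_emeasure) (auto intro: arg_cong[where f="emeasure lborel"])
  finally have "c + e = emeasure lborel T + emeasure lborel (B - T)" .
  moreover have "c + emeasure lborel (B - T) < c + e"
    using eT n by (auto simp: ennreal_add_left_cancel_less)
  ultimately have less: "c + emeasure lborel (B - T) < emeasure lborel T + emeasure lborel (B - T)"
    by simp
  have "c < emeasure lborel T"
  proof (rule ccontr)
    assume "\<not> c < emeasure lborel T"
    then have "emeasure lborel T + emeasure lborel (B - T) \<le> c + emeasure lborel (B - T)"
      by (intro add_right_mono) simp
    with less show False by (meson leD)
  qed
  moreover have "compact T"
  proof -
    have "bounded T" using T(2) bounded_subset[of "{- real n..real n}" T] by (auto simp: B_def)
    then show ?thesis using T(1) compact_eq_bounded_closed by blast
  qed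
  ultimately show thesis using that[of T] T(2) by (auto simp: B_def)
qed

lemma emeasure_lborel_affine_vimage:
  fixes A :: "real set" and t c :: real
  assumes "A \<in> sets borel" "c \<noteq> 0"
  shows "emeasure lborel A = ennreal \<bar>c\<bar> * emeasure lborel {x. t + c * x \<in> A}"
proof -
  have 1: "{x. t + c * x \<in> A} \<in> sets borel"
    using assms(1) by measurable
  have "emeasure lborel A = (\<integral>\<^sup>+ x. indicator A x \<partial>lborel)" using assms by simp
  also have "\<dots> = ennreal \<bar>c\<bar> * (\<integral>\<^sup>+ x. indicator A (t + c * x) \<partial>lborel)"
    using assms by (intro nn_integral_real_affine) auto
  also have "(\<integral>\<^sup>+ x. indicator A (t + c * x) \<partial>lborel) = (\<integral>\<^sup>+ x. indicator {x. t + c * x \<in> A} x \<partial>lborel)"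
    by (intro nn_integral_cong) (auto split: split_indicator)
  also have "\<dots> = emeasure lborel {x. t + c * x \<in> A}" using 1 by simp
  finally show ?thesis .
qed

lemma brunn_minkowski_real_compact:
  fixes A B C :: "real set"
  assumes AB: "compact A" "compact B" "A \<noteq> {}" "B \<noteq> {}" and C: "C \<in> sets borel"
    and sub: "\<And>x y. x \<in> A \<Longrightarrow> y \<in> B \<Longrightarrow> (x + y) / 2 \<in> C"
  shows "emeasure lborel A + emeasure lborel B \<le> 2 * emeasure lborel C"
proof -
  obtain M where M: "M \<in> A" "\<And>x. x \<in> A \<Longrightarrow> x \<le> M"
    using compact_attains_sup[OF AB(1,3)] by auto
  obtain m where m: "m \<in> B" "\<And>x. x \<in> B \<Longrightarrow> m \<le> x"
    using compact_attains_inf[OF AB(2,4)] by auto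
  \<comment> \<open>the sets \<open>(A + m) / 2\<close> and \<open>(M + B) / 2\<close> lie in \<open>C\<close> and overlap in at most one point\<close>
  define A' where "A' = {z. - m + 2 * z \<in> A}"
  define B' where "B' = {z. - M + 2 * z \<in> B}"
  have bor [measurable]: "A \<in> sets borel" "B \<in> sets borel"
    using AB(1,2) by (auto intro: borel_compact)
  have A': "emeasure lborel A = 2 * emeasure lborel A'" and B': "emeasure lborel B = 2 * emeasure lborel B'"
    using emeasure_lborel_affine_vimage[OF bor(1), of 2 "-m"] emeasure_lborel_affine_vimage[OF bor(2), of 2 "-M"]
    by (simp_all add: A'_def B'_def)
  have A'm [measurable]: "A' \<in> sets borel" "B' \<in> sets borel"
    unfolding A'_def B'_def by measurable
  have "A' \<inter> B' \<subseteq> {(m + M) / 2}"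
  proof
    fix z assume "z \<in> A' \<inter> B'"
    then have "- m + 2 * z \<le> M" "m \<le> - M + 2 * z" using M m by (auto simp: A'_def B'_def)
    then show "z \<in> {(m + M) / 2}" by simp
  qed
  then have "emeasure lborel (A' \<inter> B') \<le> emeasure lborel {(m + M) / 2}"
    by (intro emeasure_mono) auto
  then have z: "emeasure lborel (A' \<inter> B') = 0" by simp
  have "emeasure lborel A' + emeasure lborel B' = emeasure lborel (A' \<union> B') + emeasure lborel (A' \<inter> B')"
    by (intro emeasure_Un_Int) auto
  also have "\<dots> \<le> emeasure lborel C"
  proof -
    have "A' \<union> B' \<subseteq> C"
      using sub[OF _ m(1)] sub[OF M(1)] by (force simp: A'_def B'_def)
    then show ?thesis unfolding z using C by (auto intro!: emeasure_mono)
  qed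
  finally have "2 * (emeasure lborel A' + emeasure lborel B') \<le> 2 * emeasure lborel C"
    by (rule mult_left_mono) simp
  then show ?thesis unfolding A' B' by (simp add: distrib_left)
qed

text \<open>Inner regularity reduces the claim to compact sets, but an infinite measure is only
  approached from below. Strict lower bounds \<open>a\<close> and \<open>b\<close> are therefore
  raised to the two measures one after the other by \<open>dense_le\<close>.\<close>

lemma brunn_minkowski_real:
  fixes A B C :: "real set"
  assumes AB: "A \<in> sets borel" "B \<in> sets borel" "A \<noteq> {}" "B \<noteq> {}" and C: "C \<in> sets borel"
    and sub: "\<And>x y. x \<in> A \<Longrightarrow> y \<in> B \<Longrightarrow> (x + y) / 2 \<in> C"
  shows "emeasure lborel A + emeasure lborel B \<le> 2 * emeasure lborel C"
proof -
  have step: "a + b \<le> 2 * emeasure lborel C" if a: "a < emeasure lborel A" and b: "b < emeasure lborel B" for a b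
  proof -
    obtain K where K: "compact K" "K \<subseteq> A" "a < emeasure lborel K"
      using lborel_inner_compact[OF AB(1) a] .
    obtain L where L: "compact L" "L \<subseteq> B" "b < emeasure lborel L"
      using lborel_inner_compact[OF AB(2) b] .
    have "a + b \<le> emeasure lborel K + emeasure lborel L"
      using K L by (intro add_mono) auto
    also have "\<dots> \<le> 2 * emeasure lborel C"
    proof (rule brunn_minkowski_real_compact[OF K(1) L(1) _ _ C])
      show "K \<noteq> {}" "L \<noteq> {}" using K L by auto
    qed (use sub K L in blast)
    finally show ?thesis .
  qed
  \<comment> \<open>Fixing one point of the other set already puts a half-size translate inside
    \<open>C\<close>. Subtraction in \<open>ennreal\<close> truncates at 0, and these bounds settle
    the degenerate case of \<open>ennreal_le_minus_iff\<close> below.\<close>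
  have mono: "emeasure lborel A \<le> 2 * emeasure lborel C" "emeasure lborel B \<le> 2 * emeasure lborel C"
  proof -
    obtain x y where xy: "x \<in> A" "y \<in> B" using AB by auto
    have "emeasure lborel {z. - y + 2 * z \<in> A} \<le> emeasure lborel C"
      using C sub[OF _ xy(2)] by (intro emeasure_mono) force+
    then show "emeasure lborel A \<le> 2 * emeasure lborel C"
      using emeasure_lborel_affine_vimage[OF AB(1), of 2 "-y"] by (simp add: mult_left_mono)
    have "emeasure lborel {z. - x + 2 * z \<in> B} \<le> emeasure lborel C"
      using C sub[OF xy(1)] by (intro emeasure_mono) force+
    then show "emeasure lborel B \<le> 2 * emeasure lborel C"
      using emeasure_lborel_affine_vimage[OF AB(2), of 2 "-x"] by (simp add: mult_left_mono)
  qed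
  have A_b: "emeasure lborel A + b \<le> 2 * emeasure lborel C" if b: "b < emeasure lborel B" for b
  proof -
    have "emeasure lborel A \<le> 2 * emeasure lborel C - b"
    proof (rule dense_le)
      show "a \<le> 2 * emeasure lborel C - b" if "a < emeasure lborel A" for a
        unfolding ennreal_le_minus_iff using step[OF that b] by (rule disjI1)
    qed
    moreover have "\<not> 2 * emeasure lborel C \<le> b"
      using order.strict_trans2[OF b mono(2)] by (simp only: not_le)
    ultimately show ?thesis unfolding ennreal_le_minus_iff by blast
  qed
  have "emeasure lborel B \<le> 2 * emeasure lborel C - emeasure lborel A"
  proof (rule dense_le)
    show "b \<le> 2 * emeasure lborel C - emeasure lborel A" if "b < emeasure lborel B" for b
      unfolding ennreal_le_minus_iff using A_b[OF that] by (subst (asm) add.commute) (rule disjI1)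
  qed
  then show ?thesis
    unfolding ennreal_le_minus_iff using mono(1) by (metis add.commute add_0_right)
qed

section \<open>From level sets to the functional inequality\<close>

lemma nn_integral_layer_cake:
  fixes f :: "'a \<Rightarrow> real"
  assumes "sigma_finite_measure M" and f [measurable]: "f \<in> borel_measurable M"
  shows "(\<integral>\<^sup>+ x. ennreal (f x) \<partial>M) = (\<integral>\<^sup>+ c. emeasure M {x \<in> space M. f x > c} * indicator {0..} c \<partial>lborel)"
proof -
  interpret sigma_finite_measure M by fact
  interpret pair_sigma_finite M lborel ..
  have "(\<integral>\<^sup>+ x. ennreal (f x) \<partial>M) = (\<integral>\<^sup>+ x. (\<integral>\<^sup>+ c. indicator {0..<f x} c \<partial>lborel) \<partial>M)"
  proof (rule nn_integral_cong)
    \<comment> \<open>For negative \<open>f x\<close> both sides vanish: \<open>ennreal\<close>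
      truncates and the interval is empty.\<close>
    show "ennreal (f x) = (\<integral>\<^sup>+ c. indicator {0..<f x} c \<partial>lborel)" for x
      by (cases "f x \<ge> 0") (auto simp: ennreal_neg)
  qed
  also have "\<dots> = (\<integral>\<^sup>+ x. (\<integral>\<^sup>+ c. (if 0 \<le> c \<and> c < f x then 1 else 0) \<partial>lborel) \<partial>M)"
    by (intro nn_integral_cong) (auto split: split_indicator)
  also have "\<dots> = (\<integral>\<^sup>+ c. (\<integral>\<^sup>+ x. (if 0 \<le> c \<and> c < f x then 1 else 0) \<partial>M) \<partial>lborel)"
    by (rule Fubini'[symmetric]) measurable
  also have "\<dots> = (\<integral>\<^sup>+ c. emeasure M {x \<in> space M. f x > c} * indicator {0..} c \<partial>lborel)"
  proof (rule nn_integral_cong)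
    fix c :: real
    have "(\<integral>\<^sup>+ x. (if 0 \<le> c \<and> c < f x then 1 else 0) \<partial>M) = (\<integral>\<^sup>+ x. indicator {x \<in> space M. f x > c} x * indicator {0..} c \<partial>M)"
      by (intro nn_integral_cong) (auto split: split_indicator)
    also have "\<dots> = emeasure M {x \<in> space M. f x > c} * indicator {0..} c"
      by (subst nn_integral_multc) auto
    finally show "(\<integral>\<^sup>+ x. (if 0 \<le> c \<and> c < f x then 1 else 0) \<partial>M) = emeasure M {x \<in> space M. f x > c} * indicator {0..} c" .
  qed
  finally show ?thesis .
qed

text \<open>With \<open>min\<close> in place of a product the hypothesis passes to superlevel sets:
  midpoints of \<open>{f > c}\<close> and \<open>{g > c}\<close> lie in \<open>{h > c}\<close>. The
  normalisation makes both sets nonempty for c < 1, as Brunn-Minkowski requires, and both empty for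
  c \<ge> 1; integrating over c \<ge> 0 gives the claim.\<close>

lemma prekopa_leindler_normalized:
  fixes f g h :: "real \<Rightarrow> real"
  assumes [measurable]: "f \<in> borel_measurable borel" "g \<in> borel_measurable borel" "h \<in> borel_measurable borel"
    and f: "\<And>x. f x \<le> 1" "\<And>c. c < 1 \<Longrightarrow> \<exists>x. c < f x"
    and g: "\<And>x. g x \<le> 1" "\<And>c. c < 1 \<Longrightarrow> \<exists>x. c < g x"
    and h: "\<And>x y. min (f x) (g y) \<le> h ((x + y) / 2)"
  shows "(\<integral>\<^sup>+ x. ennreal (f x) \<partial>lborel) + (\<integral>\<^sup>+ x. ennreal (g x) \<partial>lborel) \<le> 2 * (\<integral>\<^sup>+ x. ennreal (h x) \<partial>lborel)"
proof -
  have sf: "sigma_finite_measure (lborel :: real measure)" ..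
  let ?L = "\<lambda>f c. emeasure lborel {x \<in> space lborel. c < f x} * indicator {0::real..} c"
  have [measurable]: "?L u \<in> borel_measurable borel" if [measurable]: "u \<in> borel_measurable borel" for u :: "real \<Rightarrow> real"
  proof -
    have "(\<lambda>c. emeasure lborel {x \<in> space lborel. c < u x}) \<in> borel_measurable borel"
      by measurable
    then show ?thesis by simp
  qed
  have "?L f c + ?L g c \<le> 2 * ?L h c" for c
  proof (cases "0 \<le> c \<and> c < 1")
    case True
    have "emeasure lborel {x. c < f x} + emeasure lborel {x. c < g x} \<le> 2 * emeasure lborel {x. c < h x}"
    proof (rule brunn_minkowski_real)
      show "(x + y) / 2 \<in> {x. c < h x}" if "x \<in> {x. c < f x}" "y \<in> {x. c < g x}" for x y
        using that h[of x y] by (auto simp: min_def split: if_splits)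
      show "{x. c < f x} \<in> sets borel" "{x. c < g x} \<in> sets borel" "{x. c < h x} \<in> sets borel"
        by measurable
      show "{x. c < f x} \<noteq> {}" "{x. c < g x} \<noteq> {}"
        using f(2)[of c] g(2)[of c] True by auto
    qed
    then show ?thesis using True by simp
  next
    case False
    then consider "c < 0" | "{x. c < f x} = {}" "{x. c < g x} = {}"
      using f(1) g(1) by (auto simp: not_less) (meson order_trans)+
    then show ?thesis by cases auto
  qed
  then have "(\<integral>\<^sup>+ c. ?L f c + ?L g c \<partial>lborel) \<le> (\<integral>\<^sup>+ c. 2 * ?L h c \<partial>lborel)"
    by (intro nn_integral_mono)
  also have "(\<integral>\<^sup>+ c. ?L f c + ?L g c \<partial>lborel) = (\<integral>\<^sup>+ c. ?L f c \<partial>lborel) + (\<integral>\<^sup>+ c. ?L g c \<partial>lborel)"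
    by (rule nn_integral_add) simp_all
  also have "(\<integral>\<^sup>+ c. 2 * ?L h c \<partial>lborel) = 2 * (\<integral>\<^sup>+ c. ?L h c \<partial>lborel)"
    by (rule nn_integral_cmult) simp
  finally show ?thesis
    by (simp only: nn_integral_layer_cake[OF sf] assms measurable_lborel2)
qed

text \<open>Dividing by the suprema \<open>a\<close> and \<open>b\<close> and by
  \<open>sqrt (a * b)\<close> keeps the hypothesis and normalises \<open>f\<close> and
  \<open>g\<close>. A minimum is at most the geometric mean, so the additive inequality applies; the
  arithmetic-geometric mean inequality turns its sum back into a product.\<close>

lemma prekopa_leindler_bounded:
  fixes f g h :: "real \<Rightarrow> real"
  assumes [measurable]: "f \<in> borel_measurable borel" "g \<in> borel_measurable borel" "h \<in> borel_measurable borel"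
    and f: "\<And>x. 0 \<le> f x" "\<And>x. f x \<le> K" and g: "\<And>x. 0 \<le> g x" "\<And>x. g x \<le> K" and h0: "\<And>x. 0 \<le> h x"
    and h: "\<And>x y. f x * g y \<le> (h ((x + y) / 2))\<^sup>2"
  shows "(\<integral>\<^sup>+ x. ennreal (f x) \<partial>lborel) * (\<integral>\<^sup>+ x. ennreal (g x) \<partial>lborel) \<le> (\<integral>\<^sup>+ x. ennreal (h x) \<partial>lborel)\<^sup>2"
proof -
  define a where "a = (SUP x. f x)"
  define b where "b = (SUP x. g x)"
  have bdd: "bdd_above (range f)" "bdd_above (range g)"
    using f g by (auto intro!: bdd_aboveI[of _ K])
  have fa: "f x \<le> a" and gb: "g x \<le> b" for x
    unfolding a_def b_def using bdd by (auto intro: cSUP_upper)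
  show ?thesis
  proof (cases "a > 0 \<and> b > 0")
    case False
    then have "(\<forall>x. f x = 0) \<or> (\<forall>x. g x = 0)"
      using fa gb f(1) g(1) by (meson antisym_conv not_less order_trans)
    then show ?thesis by auto
  next
    case True
    then have ab: "a > 0" "b > 0" by auto
    define r where "r = sqrt (a * b)"
    have r: "r > 0" "r\<^sup>2 = a * b" using ab by (auto simp: r_def)
    have ex: "\<exists>x. c < f x / a" "\<exists>x. c < g x / b" if "c < 1" for c
    proof -
      have "c * a < a" "c * b < b" using that ab by auto
      then have "\<exists>x. c * a < f x" "\<exists>x. c * b < g x"
        using less_cSUP_iff[of UNIV f "c * a"] less_cSUP_iff[of UNIV g "c * b"] bdd by (auto simp: a_def b_def)
      then show "\<exists>x. c < f x / a" "\<exists>x. c < g x / b"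
        using ab by (auto simp: field_simps)
    qed
    have mn: "min (f x / a) (g y / b) \<le> h ((x + y) / 2) / r" for x y
    proof -
      let ?m = "min (f x / a) (g y / b)"
      have "?m \<ge> 0" using f g ab by simp
      then have "?m\<^sup>2 \<le> (f x / a) * (g y / b)"
        unfolding power2_eq_square using f g ab by (intro mult_mono) auto
      also have "\<dots> \<le> (h ((x + y) / 2))\<^sup>2 / r\<^sup>2"
        unfolding r using h[of x y] ab by (simp add: divide_right_mono)
      finally have "?m\<^sup>2 \<le> (h ((x + y) / 2) / r)\<^sup>2" by (simp add: power_divide)
      then show ?thesis by (rule power2_le_imp_le) (use r h0 in auto)
    qed
    let ?F = "\<integral>\<^sup>+ x. ennreal (f x / a) \<partial>lborel" and ?G = "\<integral>\<^sup>+ x. ennreal (g x / b) \<partial>lborel"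
      and ?H = "\<integral>\<^sup>+ x. ennreal (h x / r) \<partial>lborel"
    have "?F + ?G \<le> 2 * ?H"
      using ex mn fa gb ab by (intro prekopa_leindler_normalized) auto
    then have "?F * ?G \<le> ?H\<^sup>2"
    proof (cases ?F; cases ?G; cases ?H)
      fix F G H :: real
      assume *: "?F = ennreal F" "?G = ennreal G" "?H = ennreal H" "0 \<le> F" "0 \<le> G" "0 \<le> H" "?F + ?G \<le> 2 * ?H"
      have "F + G \<le> 2 * H" using * by (simp flip: ennreal_plus ennreal_mult' ennreal_numeral)
      then have "(F + G)\<^sup>2 \<le> (2 * H)\<^sup>2" using * by (intro power_mono) auto
      moreover have "4 * (F * G) \<le> (F + G)\<^sup>2"
        using sum_squares_bound[of F G] by (simp add: power2_sum)
      ultimately have "4 * (F * G) \<le> (2 * H)\<^sup>2" by (rule order_trans[rotated])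
      then have "F * G \<le> H\<^sup>2" by (simp add: power_mult_distrib)
      then show ?thesis using * by (simp add: ennreal_mult'[symmetric] ennreal_power)
    qed (auto simp: ennreal_mult_top top_unique add_top top_add ennreal_mult_eq_top_iff)
    moreover have "(\<integral>\<^sup>+ x. ennreal (u x) \<partial>lborel) = ennreal s * (\<integral>\<^sup>+ x. ennreal (u x / s) \<partial>lborel)"
      if [measurable]: "u \<in> borel_measurable borel" and "s > 0" for u :: "real \<Rightarrow> real" and s
      using that(2) by (subst nn_integral_cmult[symmetric]) (auto simp flip: ennreal_mult' intro!: nn_integral_cong)
    note cm = this
    ultimately have "ennreal (a * b) * (?F * ?G) \<le> ennreal (r\<^sup>2) * ?H\<^sup>2"
      unfolding r by (intro mult_left_mono) auto
    also have "\<dots> = (ennreal r * ?H)\<^sup>2" using r by (simp add: power_mult_distrib ennreal_power)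
    also have "ennreal (a * b) * (?F * ?G) = (ennreal a * ?F) * (ennreal b * ?G)"
      using ab by (simp add: ennreal_mult mult_ac)
    finally show ?thesis
      using cm[of f a] cm[of g b] cm[of h r] ab r by simp
  qed
qed

lemma nn_integral_SUP_truncate:
  fixes f :: "'a \<Rightarrow> ennreal"
  assumes [measurable]: "f \<in> borel_measurable M"
  shows "(\<integral>\<^sup>+ x. f x \<partial>M) = (SUP k. \<integral>\<^sup>+ x. min (f x) (of_nat k) \<partial>M)"
proof -
  have "f x = (SUP k. min (f x) (of_nat k))" for x
  proof (rule antisym)
    show "f x \<le> (SUP k. min (f x) (of_nat k))"
    proof (rule dense_le)
      fix y assume y: "y < f x"
      then obtain k where "y < of_nat k" using ennreal_Ex_less_of_nat[of y]
        by (metis less_top order_less_le_trans top_greatest infinity_ennreal_def)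
      then have "y \<le> min (f x) (of_nat k)" using y by (auto intro: less_imp_le)
      also have "\<dots> \<le> (SUP k. min (f x) (of_nat k))" by (rule SUP_upper) simp
      finally show "y \<le> (SUP k. min (f x) (of_nat k))" .
    qed
  qed (auto intro: SUP_least)
  then have "(\<integral>\<^sup>+ x. f x \<partial>M) = (\<integral>\<^sup>+ x. (SUP k. min (f x) (of_nat k)) \<partial>M)"
    by (intro nn_integral_cong) simp
  also have "\<dots> = (SUP k. \<integral>\<^sup>+ x. min (f x) (of_nat k) \<partial>M)"
    by (rule nn_integral_monotone_convergence_SUP)
       (auto simp: incseq_def le_fun_def intro: min.coboundedI2 min.coboundedI1)
  finally show ?thesis .
qed

theorem prekopa_leindler:
  fixes f g h :: "real \<Rightarrow> ennreal"
  assumes [measurable]: "f \<in> borel_measurable borel" "g \<in> borel_measurable borel" "h \<in> borel_measurable borel"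
    and h: "\<And>x y. f x * g y \<le> (h ((x + y) / 2))\<^sup>2"
  shows "(\<integral>\<^sup>+ x. f x \<partial>lborel) * (\<integral>\<^sup>+ x. g x \<partial>lborel) \<le> (\<integral>\<^sup>+ x. h x \<partial>lborel)\<^sup>2"
proof -
  let ?t = "\<lambda>k u x. min (u x) (of_nat k) :: ennreal"
  have bound: "(\<integral>\<^sup>+ x. ?t k f x \<partial>lborel) * (\<integral>\<^sup>+ x. ?t j g x \<partial>lborel) \<le> (\<integral>\<^sup>+ x. h x \<partial>lborel)\<^sup>2" for k j
  proof -
    \<comment> \<open>The bounded case wants real values with a finite bound. Cutting
      \<open>h\<close> at the larger level \<open>K\<close> keeps the hypothesis: where
      \<open>h\<close> exceeds \<open>K\<close>, the right-hand side is \<open>K\<^sup>2\<close>, a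
      bound for any product of the two truncations. The levels \<open>k\<close> and \<open>j\<close>
      stay independent because the two suprema are pulled out one at a time.\<close>
    define K where "K = max (real k) (real j)"
    have ek: "ennreal (enn2real (min u (of_nat i))) = min u (of_nat i)" for u :: ennreal and i
      by (intro ennreal_enn2real) (auto simp: min_less_iff_disj of_nat_less_top)
    have eK: "ennreal (enn2real (min u (ennreal K))) = min u (ennreal K)" for u :: ennreal
      by (intro ennreal_enn2real) (auto simp: min_less_iff_disj)
    let ?f = "\<lambda>x. enn2real (?t k f x)" and ?g = "\<lambda>x. enn2real (?t j g x)"
      and ?h = "\<lambda>x. enn2real (min (h x) (ennreal K))"
    have K0: "K \<ge> 0" by (simp add: K_def)
    have le: "?f x \<le> K" "?g x \<le> K" for x
    proof -
      have "ennreal (?f x) \<le> ennreal K" "ennreal (?g x) \<le> ennreal K"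
        unfolding ek by (auto simp: K_def ennreal_of_nat_eq_real_of_nat intro: min.coboundedI2 ennreal_leI)
      then show "?f x \<le> K" "?g x \<le> K" using K0 by auto
    qed
    have "(\<integral>\<^sup>+ x. ennreal (?f x) \<partial>lborel) * (\<integral>\<^sup>+ x. ennreal (?g x) \<partial>lborel) \<le> (\<integral>\<^sup>+ x. ennreal (?h x) \<partial>lborel)\<^sup>2"
    proof (rule prekopa_leindler_bounded[where K = K])
      fix x y
      have "ennreal (?f x * ?g y) \<le> ennreal ((?h ((x + y) / 2))\<^sup>2)"
      proof (cases "h ((x + y) / 2) \<le> ennreal K")
        case True
        have "ennreal (?f x * ?g y) = ?t k f x * ?t j g y"
          by (simp add: ennreal_mult ek)
        also have "\<dots> \<le> f x * g y" by (intro mult_mono) auto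
        also have "\<dots> \<le> (h ((x + y) / 2))\<^sup>2" by (rule h)
        also have "\<dots> = ennreal ((?h ((x + y) / 2))\<^sup>2)"
          using True eK[of "h ((x + y) / 2)"] by (simp add: ennreal_power[symmetric] min_def)
        finally show ?thesis .
      next
        case False
        then have "?h ((x + y) / 2) = K" using K0 by (simp add: min_def)
        then show ?thesis using le[of x] le[of y]
          by (auto simp: power2_eq_square intro!: ennreal_leI mult_mono K0)
      qed
      then show "?f x * ?g y \<le> (?h ((x + y) / 2))\<^sup>2" by simp
    qed (use le in auto)
    also have "(\<integral>\<^sup>+ x. ennreal (?h x) \<partial>lborel) \<le> (\<integral>\<^sup>+ x. h x \<partial>lborel)"
      unfolding eK by (intro nn_integral_mono) auto
    finally show ?thesis unfolding ek by (simp add: power_mono)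
  qed
  have "(\<integral>\<^sup>+ x. f x \<partial>lborel) * (\<integral>\<^sup>+ x. g x \<partial>lborel) =
    (SUP k. (\<integral>\<^sup>+ x. ?t k f x \<partial>lborel) * (\<integral>\<^sup>+ x. g x \<partial>lborel))"
    by (subst nn_integral_SUP_truncate[of f]) (auto simp: SUP_mult_right_ennreal)
  also have "\<dots> \<le> (\<integral>\<^sup>+ x. h x \<partial>lborel)\<^sup>2"
  proof (rule SUP_least)
    fix k
    have "(\<integral>\<^sup>+ x. ?t k f x \<partial>lborel) * (\<integral>\<^sup>+ x. g x \<partial>lborel) =
      (SUP j. (\<integral>\<^sup>+ x. ?t k f x \<partial>lborel) * (\<integral>\<^sup>+ x. ?t j g x \<partial>lborel))"
      by (subst nn_integral_SUP_truncate[of g]) (auto simp: SUP_mult_left_ennreal)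
    also have "\<dots> \<le> (\<integral>\<^sup>+ x. h x \<partial>lborel)\<^sup>2" by (intro SUP_least bound)
    finally show "(\<integral>\<^sup>+ x. ?t k f x \<partial>lborel) * (\<integral>\<^sup>+ x. g x \<partial>lborel) \<le> (\<integral>\<^sup>+ x. h x \<partial>lborel)\<^sup>2" .
  qed
  finally show ?thesis .
qed

section \<open>Gaussian concentration\<close>

abbreviation std_normal :: "real measure" where
  "std_normal \<equiv> density lborel std_normal_density"

text \<open>
  Prekopa-Leindler against a Gaussian weight: two densities multiply to the squared density at the
  midpoint times \<open>exp (- (x - y)\<^sup>2 / 4)\<close>. With a constant on the right-hand side the inequality
  tensorises by fixing one coordinate of \<open>x\<close> and of \<open>y\<close>.
\<close>
lemma std_normal_product_integral_le:
  fixes f g :: "real \<Rightarrow> ennreal"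
  assumes [measurable]: "f \<in> borel_measurable borel" "g \<in> borel_measurable borel"
    and c: "0 \<le> c" and fg: "\<And>x y. f x * g y \<le> ennreal (c * exp ((x - y)\<^sup>2 / 4))"
  shows "(\<integral>\<^sup>+ x. f x \<partial>std_normal) * (\<integral>\<^sup>+ x. g x \<partial>std_normal) \<le> ennreal c"
proof -
  let ?p = "\<lambda>x. ennreal (std_normal_density x)"
  let ?h = "\<lambda>x. ennreal (sqrt c * std_normal_density x)"
  have id: "c * exp ((x - y)\<^sup>2 / 4) * (std_normal_density x * std_normal_density y) =
      (sqrt c * std_normal_density ((x + y) / 2))\<^sup>2" for x y
  proof -
    have "std_normal_density x * std_normal_density y = (1 / sqrt (2 * pi))\<^sup>2 * (exp (- x\<^sup>2 / 2) * exp (- y\<^sup>2 / 2))"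
      by (simp add: std_normal_density_def power2_eq_square)
    moreover have "(std_normal_density ((x + y) / 2))\<^sup>2 = (1 / sqrt (2 * pi))\<^sup>2 * (exp (- ((x + y) / 2)\<^sup>2 / 2))\<^sup>2"
      by (simp add: std_normal_density_def power_mult_distrib power_divide)
    moreover have "exp ((x - y)\<^sup>2 / 4) * (exp (- x\<^sup>2 / 2) * exp (- y\<^sup>2 / 2)) = (exp (- ((x + y) / 2)\<^sup>2 / 2))\<^sup>2"
      unfolding exp_double[symmetric] exp_add[symmetric]
      by (rule arg_cong[where f = exp]) (simp add: power2_eq_square field_simps)
    ultimately show ?thesis using c by (simp add: power_mult_distrib)
  qed
  have "(f x * ?p x) * (g y * ?p y) \<le> (?h ((x + y) / 2))\<^sup>2" for x y
  proof -
    have "(f x * ?p x) * (g y * ?p y) = (f x * g y) * (?p x * ?p y)" by (simp add: mult_ac)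
    also have "\<dots> \<le> ennreal (c * exp ((x - y)\<^sup>2 / 4)) * (?p x * ?p y)"
      by (intro mult_right_mono fg) simp
    also have "\<dots> = ennreal (c * exp ((x - y)\<^sup>2 / 4) * (std_normal_density x * std_normal_density y))"
      using c by (simp add: ennreal_mult)
    also have "\<dots> = (?h ((x + y) / 2))\<^sup>2"
      unfolding id using c by (simp add: ennreal_power)
    finally show ?thesis .
  qed
  then have "(\<integral>\<^sup>+ x. f x * ?p x \<partial>lborel) * (\<integral>\<^sup>+ x. g x * ?p x \<partial>lborel) \<le> (\<integral>\<^sup>+ x. ?h x \<partial>lborel)\<^sup>2"
    by (intro prekopa_leindler) auto
  also have "(\<integral>\<^sup>+ x. ?h x \<partial>lborel) = ennreal (sqrt c)"
  proof -
    have "(\<integral>\<^sup>+ x. ?h x \<partial>lborel) = ennreal (sqrt c) * (\<integral>\<^sup>+ x. ?p x \<partial>lborel)"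
      using c by (subst nn_integral_cmult[symmetric]) (auto simp: ennreal_mult')
    also have "(\<integral>\<^sup>+ x. ?p x \<partial>lborel) = 1"
      by (simp add: nn_integral_eq_integral)
    finally show ?thesis by simp
  qed
  also have "(ennreal (sqrt c))\<^sup>2 = ennreal c" using c by (simp add: ennreal_power)
  finally show ?thesis by (simp add: nn_integral_density mult.commute)
qed

interpretation std_normal: prob_space std_normal
  by (rule prob_space_normal_density) simp

lemma sets_PiM_std_normal: "sets (PiM I (\<lambda>_. std_normal)) = sets (PiM I (\<lambda>_. borel))"
  by (intro sets_PiM_cong) auto

text \<open>Freezing coordinate \<open>i\<close> at \<open>s\<close> and \<open>t\<close> multiplies
  the constant by \<open>exp ((s - t)\<^sup>2 / 4)\<close>, so \<open>c\<close> must be arbitrary in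
  the induction. The section integrals then satisfy exactly the one-dimensional hypothesis.\<close>

lemma PiM_std_normal_product_integral_le:
  fixes f g :: "('i \<Rightarrow> real) \<Rightarrow> ennreal"
  assumes "finite I"
    and "f \<in> borel_measurable (PiM I (\<lambda>_. std_normal))" "g \<in> borel_measurable (PiM I (\<lambda>_. std_normal))"
    and "0 \<le> c"
    and "\<And>x y. x \<in> extensional I \<Longrightarrow> y \<in> extensional I \<Longrightarrow> f x * g y \<le> ennreal (c * exp ((\<Sum>i\<in>I. (x i - y i)\<^sup>2) / 4))"
  shows "(\<integral>\<^sup>+ x. f x \<partial>PiM I (\<lambda>_. std_normal)) * (\<integral>\<^sup>+ x. g x \<partial>PiM I (\<lambda>_. std_normal)) \<le> ennreal c"
  using assms
proof (induction I arbitrary: f g c)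
  case empty
  interpret product_sigma_finite "\<lambda>_::'i. std_normal" ..
  show ?case using empty.prems by (simp add: PiM_empty nn_integral_count_space_finite)
next
  case (insert i I)
  interpret product_sigma_finite "\<lambda>_::'i. std_normal" ..
  interpret I: prob_space "PiM I (\<lambda>_::'i. std_normal)"
    by (intro prob_space_PiM) unfold_locales
  note [measurable] = insert.prems(1,2)
  let ?s = "\<lambda>f y. \<integral>\<^sup>+ x. f (x(i := y)) \<partial>PiM I (\<lambda>_. std_normal)"
  have m: "?s u \<in> borel_measurable borel" if [measurable]: "u \<in> borel_measurable (PiM (insert i I) (\<lambda>_. std_normal))"
    for u :: "('i \<Rightarrow> real) \<Rightarrow> ennreal"
  proof -
    have "?s u \<in> borel_measurable std_normal" by measurable
    then show ?thesis by simp
  qed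
  have sec: "(\<lambda>x. u (x(i := y))) \<in> borel_measurable (PiM I (\<lambda>_. std_normal))"
    if [measurable]: "u \<in> borel_measurable (PiM (insert i I) (\<lambda>_. std_normal))" for u :: "('i \<Rightarrow> real) \<Rightarrow> ennreal" and y
    by measurable
  have "?s f s * ?s g t \<le> ennreal (c * exp ((s - t)\<^sup>2 / 4))" for s t
  proof (rule insert.IH)
    fix x y :: "'i \<Rightarrow> real" assume xy: "x \<in> extensional I" "y \<in> extensional I"
    have "f (x(i := s)) * g (y(i := t)) \<le> ennreal (c * exp ((\<Sum>j\<in>insert i I. ((x(i := s)) j - (y(i := t)) j)\<^sup>2) / 4))"
      using xy by (intro insert.prems(4)) (auto simp: extensional_def)
    also have "(\<Sum>j\<in>insert i I. ((x(i := s)) j - (y(i := t)) j)\<^sup>2) = (s - t)\<^sup>2 + (\<Sum>j\<in>I. (x j - y j)\<^sup>2)"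
      using insert.hyps by (subst sum.insert) (auto intro!: sum.cong)
    finally show "f (x(i := s)) * g (y(i := t)) \<le> ennreal (c * exp ((s - t)\<^sup>2 / 4) * exp ((\<Sum>j\<in>I. (x j - y j)\<^sup>2) / 4))"
      by (simp add: add_divide_distrib exp_add mult_ac del: fun_upd_apply)
  qed (use insert.prems sec in \<open>auto simp del: fun_upd_apply\<close>)
  then have "(\<integral>\<^sup>+ s. ?s f s \<partial>std_normal) * (\<integral>\<^sup>+ s. ?s g s \<partial>std_normal) \<le> ennreal c"
    using insert.prems m by (intro std_normal_product_integral_le) auto
  then show ?case
    using insert.hyps by (simp add: product_nn_integral_insert_rev)
qed

section \<open>Lipschitz functions of a standard Gaussian vector\<close>

abbreviation std_gauss :: "nat \<Rightarrow> (nat \<Rightarrow> real) measure" where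
  "std_gauss n \<equiv> PiM {..<n} (\<lambda>_. std_normal)"

text \<open>Points are the extensional functions, as in \<open>space (std_gauss n)\<close>. The sign
  of \<open>L\<close> is demanded explicitly because for n = 0 the carrier is a single point and the
  inequality alone would admit a negative \<open>L\<close>.\<close>

definition euclid_lipschitz :: "nat \<Rightarrow> real \<Rightarrow> ((nat \<Rightarrow> real) \<Rightarrow> real) \<Rightarrow> bool" where
  "euclid_lipschitz n L F \<longleftrightarrow> 0 \<le> L \<and> (\<forall>x\<in>extensional {..<n}. \<forall>y\<in>extensional {..<n}.
     \<bar>F x - F y\<bar> \<le> L * L2_set (\<lambda>i. x i - y i) {..<n})"

lemma euclid_lipschitzD:
  assumes "euclid_lipschitz n L F" "x \<in> extensional {..<n}" "y \<in> extensional {..<n}"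
  shows "\<bar>F x - F y\<bar> \<le> L * L2_set (\<lambda>i. x i - y i) {..<n}"
  using assms by (auto simp: euclid_lipschitz_def)

lemma prob_space_std_gauss: "prob_space (std_gauss n)"
  by (intro prob_space_PiM) unfold_locales

lemma space_std_gauss: "space (std_gauss n) = extensional {..<n}"
  by (simp add: space_PiM PiE_def)

text \<open>Continuity gives measurability once the product sigma-algebra is known to contain the
  Euclidean open sets. That fact is read off \<open>mm_space_cauchy\<close>; its parameter 1 is an
  arbitrary choice, since metric and sigma-algebra are the same for every \<beta>.\<close>

lemma euclid_lipschitz_measurable:
  assumes F: "euclid_lipschitz n L F"
  shows "F \<in> borel_measurable (PiM {..<n} (\<lambda>_. borel))"
proof -
  let ?X = "cauchy_space 1 n"
  have sp: "space (mm_meas ?X) = extensional {..<n}"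
    by (simp add: cauchy_space_def cauchy_measure_def space_PiM PiE_def)
  have mm: "mm_space ?X" by (rule mm_space_cauchy) simp
  interpret Metric_space "space (mm_meas ?X)" "mm_dist ?X" using mm by (simp add: mm_space_def)
  have "F \<in> borel_measurable (mm_meas ?X)"
  proof (rule borel_measurableI)
    fix S :: "real set" assume S: "open S"
    have "openin mtopology (F -` S \<inter> space (mm_meas ?X))"
      unfolding openin_mtopology
    proof (intro conjI allI impI)
      fix x assume x: "x \<in> F -` S \<inter> space (mm_meas ?X)"
      then obtain e where e: "e > 0" "ball (F x) e \<subseteq> S"
        using S openE by blast
      \<comment> \<open>The radius \<open>e / (L + 1)\<close> also covers L = 0.\<close>
      have L: "L + 1 > 0" using F by (simp add: euclid_lipschitz_def)
      have "mball x (e / (L + 1)) \<subseteq> F -` S \<inter> space (mm_meas ?X)"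
      proof
        fix y assume "y \<in> mball x (e / (L + 1))"
        then have y: "y \<in> extensional {..<n}" "L2_set (\<lambda>i. x i - y i) {..<n} < e / (L + 1)"
          unfolding in_mball unfolding sp by (auto simp: cauchy_space_def)
        have "\<bar>F x - F y\<bar> \<le> L * L2_set (\<lambda>i. x i - y i) {..<n}"
          using x y by (intro euclid_lipschitzD[OF F]) (auto simp: sp)
        also have "\<dots> \<le> L * (e / (L + 1))"
          using y(2) F by (intro mult_left_mono) (auto simp: euclid_lipschitz_def)
        also have "\<dots> < e" using e L by (simp add: field_simps)
        finally have "F y \<in> ball (F x) e" by (simp add: dist_real_def)
        then show "y \<in> F -` S \<inter> space (mm_meas ?X)" using e y by (auto simp: sp)
      qed
      then show "\<exists>r>0. mball x r \<subseteq> F -` S \<inter> space (mm_meas ?X)"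
        using e L by (intro exI[of _ "e / (L + 1)"]) auto
    qed simp
    then show "F -` S \<inter> space (mm_meas ?X) \<in> sets (mm_meas ?X)"
      using mm unfolding mm_space_def by (auto intro: sigma_sets.Basic)
  qed
  moreover have "sets (mm_meas ?X) = sets (PiM {..<n} (\<lambda>_. borel))"
    by (simp add: cauchy_space_def cauchy_measure_def) (intro sets_PiM_cong, auto)
  ultimately show ?thesis by (simp cong: measurable_cong_sets)
qed

lemma euclid_lipschitz_measurable_gauss:
  assumes F: "euclid_lipschitz n L F"
  shows "F \<in> borel_measurable (std_gauss n)"
  using euclid_lipschitz_measurable[OF F] unfolding measurable_cong_sets[OF sets_PiM_std_normal refl] .

lemma euclid_lipschitz_norm: "euclid_lipschitz n 1 (\<lambda>x. L2_set x {..<n})"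
  unfolding euclid_lipschitz_def
proof (intro conjI ballI)
  fix x y :: "nat \<Rightarrow> real"
  have "L2_set (\<lambda>i. (x i - y i) + y i) {..<n} \<le> L2_set (\<lambda>i. x i - y i) {..<n} + L2_set y {..<n}"
    "L2_set (\<lambda>i. (y i - x i) + x i) {..<n} \<le> L2_set (\<lambda>i. y i - x i) {..<n} + L2_set x {..<n}"
    by (rule L2_set_triangle_ineq)+
  moreover have "L2_set (\<lambda>i. y i - x i) {..<n} = L2_set (\<lambda>i. x i - y i) {..<n}"
    by (simp add: L2_set_def power2_commute)
  ultimately show "\<bar>L2_set x {..<n} - L2_set y {..<n}\<bar> \<le> 1 * L2_set (\<lambda>i. x i - y i) {..<n}"
    by simp
qed simp

lemma L2_set_square: "(L2_set x {..<n})\<^sup>2 = (\<Sum>i<n. (x i)\<^sup>2)"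
  by (simp add: L2_set_def sum_nonneg)

text \<open>Two independent copies replace F minus its mean, so no integrability of F is
  presupposed. Prekopa-Leindler bounds the exponential moment of \<open>F x - F y\<close> by e, a
  square is dominated by \<open>exp u + exp (- u)\<close>, and 6 rounds up
  \<open>2 * exp 1\<close>.\<close>

lemma gauss_lipschitz_square_diff_1:
  assumes F: "euclid_lipschitz n 1 F"
  shows "(\<integral>\<^sup>+ x. \<integral>\<^sup>+ y. ennreal ((F x - F y)\<^sup>2) \<partial>std_gauss n \<partial>std_gauss n) \<le> 6"
proof -
  have [measurable]: "F \<in> borel_measurable (std_gauss n)"
    by (rule euclid_lipschitz_measurable_gauss[OF F])
  let ?I = "\<lambda>f. \<integral>\<^sup>+ x. ennreal (f x) \<partial>std_gauss n"
  have main: "?I (\<lambda>x. exp (F x)) * ?I (\<lambda>x. exp (- F x)) \<le> ennreal (exp 1)"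
  proof (rule PiM_std_normal_product_integral_le)
    fix x y :: "nat \<Rightarrow> real" assume xy: "x \<in> extensional {..<n}" "y \<in> extensional {..<n}"
    let ?d = "L2_set (\<lambda>i. x i - y i) {..<n}"
    have "F x - F y \<le> ?d" using euclid_lipschitzD[OF F xy] by simp
    \<comment> \<open>This is \<open>(?d / 2 - 1)\<^sup>2 \<ge> 0\<close>: the linear growth of F is
      absorbed by the quadratic gain of the Gaussian weight at the cost of 1, the source of the
      constant \<open>exp 1\<close>.\<close>
    also have "?d \<le> 1 + ?d\<^sup>2 / 4"
      using zero_le_power2[of "?d / 2 - 1"] by (simp add: power2_diff power_divide)
    finally have "F x - F y \<le> 1 + (\<Sum>i<n. (x i - y i)\<^sup>2) / 4"
      unfolding L2_set_square .
    then have "exp (F x) * exp (- F y) \<le> exp 1 * exp ((\<Sum>i<n. (x i - y i)\<^sup>2) / 4)"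
      unfolding exp_add[symmetric] by simp
    then show "ennreal (exp (F x)) * ennreal (exp (- F y)) \<le> ennreal (exp 1 * exp ((\<Sum>i<n. (x i - y i)\<^sup>2) / 4))"
      by (simp add: ennreal_mult'[symmetric] ennreal_leI)
  qed auto
  have sq: "u\<^sup>2 \<le> exp u + exp (- u)" for u :: real
  proof -
    have *: "u\<^sup>2 \<le> exp u" if "u \<ge> 0" for u :: real
    proof -
      have "u \<le> 1 + u / 2 + (u / 2)\<^sup>2 / 2"
        using zero_le_power2[of "u / 2 - 1"] by (simp add: power2_diff power_divide)
      also have "\<dots> \<le> exp (u / 2)" using that by (intro exp_lower_Taylor_quadratic) simp
      finally have "u\<^sup>2 \<le> (exp (u / 2))\<^sup>2" using that by (rule power_mono)
      then show ?thesis by (simp flip: exp_double)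
    qed
    show ?thesis using *[of u] *[of "- u"] by (cases "u \<ge> 0") (auto intro: add_increasing add_increasing2)
  qed
  have "(\<integral>\<^sup>+ x. \<integral>\<^sup>+ y. ennreal ((F x - F y)\<^sup>2) \<partial>std_gauss n \<partial>std_gauss n) \<le>
    (\<integral>\<^sup>+ x. \<integral>\<^sup>+ y. ennreal (exp (F x)) * ennreal (exp (- F y)) + ennreal (exp (- F x)) * ennreal (exp (F y)) \<partial>std_gauss n \<partial>std_gauss n)"
  proof (intro nn_integral_mono)
    fix x y
    have "(F x - F y)\<^sup>2 \<le> exp (F x) * exp (- F y) + exp (- F x) * exp (F y)"
      using sq[of "F x - F y"] by (simp add: exp_add[symmetric])
    then have "ennreal ((F x - F y)\<^sup>2) \<le> ennreal (exp (F x) * exp (- F y) + exp (- F x) * exp (F y))"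
      by (rule ennreal_leI)
    also have "\<dots> = ennreal (exp (F x) * exp (- F y)) + ennreal (exp (- F x) * exp (F y))"
      by (rule ennreal_plus) auto
    finally show "ennreal ((F x - F y)\<^sup>2) \<le> ennreal (exp (F x)) * ennreal (exp (- F y)) + ennreal (exp (- F x)) * ennreal (exp (F y))"
      by (simp only: ennreal_mult exp_ge_zero)
  qed
  also have "\<dots> = ?I (\<lambda>x. exp (F x)) * ?I (\<lambda>x. exp (- F x)) + ?I (\<lambda>x. exp (- F x)) * ?I (\<lambda>x. exp (F x))"
  proof -
    have "(\<integral>\<^sup>+ y. ennreal (exp (F x)) * ennreal (exp (- F y)) + ennreal (exp (- F x)) * ennreal (exp (F y)) \<partial>std_gauss n)
      = ennreal (exp (F x)) * ?I (\<lambda>x. exp (- F x)) + ennreal (exp (- F x)) * ?I (\<lambda>x. exp (F x))" for x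
      by (subst nn_integral_add) (simp_all add: nn_integral_cmult)
    then have "(\<integral>\<^sup>+ x. \<integral>\<^sup>+ y. ennreal (exp (F x)) * ennreal (exp (- F y)) + ennreal (exp (- F x)) * ennreal (exp (F y)) \<partial>std_gauss n \<partial>std_gauss n)
      = (\<integral>\<^sup>+ x. ennreal (exp (F x)) * ?I (\<lambda>x. exp (- F x)) + ennreal (exp (- F x)) * ?I (\<lambda>x. exp (F x)) \<partial>std_gauss n)"
      by (simp only:)
    also have "\<dots> = ?I (\<lambda>x. exp (F x)) * ?I (\<lambda>x. exp (- F x)) + ?I (\<lambda>x. exp (- F x)) * ?I (\<lambda>x. exp (F x))"
      by (subst nn_integral_add) (simp_all add: nn_integral_multc)
    finally show ?thesis .
  qed
  also have "\<dots> \<le> ennreal (exp 1) + ennreal (exp 1)"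
    using main by (intro add_mono) (auto simp: mult.commute)
  also have "\<dots> = ennreal (2 * exp 1)" by (subst ennreal_plus[symmetric]) auto
  also have "\<dots> \<le> ennreal 6"
    using exp_le by (intro ennreal_leI) simp
  finally show ?thesis by simp
qed

lemma gauss_lipschitz_square_diff:
  assumes F: "euclid_lipschitz n L F"
  shows "(\<integral>\<^sup>+ x. \<integral>\<^sup>+ y. ennreal ((F x - F y)\<^sup>2) \<partial>std_gauss n \<partial>std_gauss n) \<le> ennreal (6 * L\<^sup>2)"
proof (cases "L = 0")
  case True
  have "(\<integral>\<^sup>+ x. \<integral>\<^sup>+ y. ennreal ((F x - F y)\<^sup>2) \<partial>std_gauss n \<partial>std_gauss n) = (\<integral>\<^sup>+ x. \<integral>\<^sup>+ y. 0 \<partial>std_gauss n \<partial>std_gauss n)"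
  proof (intro nn_integral_cong)
    fix x y assume "x \<in> space (std_gauss n)" "y \<in> space (std_gauss n)"
    then have "\<bar>F x - F y\<bar> \<le> 0"
      using euclid_lipschitzD[OF F, of x y] unfolding True space_std_gauss by simp
    then show "ennreal ((F x - F y)\<^sup>2) = 0" by simp
  qed
  then show ?thesis by simp
next
  case False
  moreover have "L \<ge> 0" using F unfolding euclid_lipschitz_def by blast
  ultimately have L: "L > 0" by simp
  have [measurable]: "F \<in> borel_measurable (std_gauss n)"
    by (rule euclid_lipschitz_measurable_gauss[OF F])
  interpret prob_space "std_gauss n" by (rule prob_space_std_gauss)
  have F1: "euclid_lipschitz n 1 (\<lambda>x. F x / L)"
    unfolding euclid_lipschitz_def
  proof (intro conjI ballI)
    fix x y :: "nat \<Rightarrow> real" assume "x \<in> extensional {..<n}" "y \<in> extensional {..<n}"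
    from euclid_lipschitzD[OF F this] show "\<bar>F x / L - F y / L\<bar> \<le> 1 * L2_set (\<lambda>i. x i - y i) {..<n}"
      using L by (simp add: diff_divide_distrib[symmetric] pos_divide_le_eq mult.commute)
  qed simp
  have "ennreal (L\<^sup>2) * (\<integral>\<^sup>+ x. \<integral>\<^sup>+ y. ennreal ((F x / L - F y / L)\<^sup>2) \<partial>std_gauss n \<partial>std_gauss n) \<le> ennreal (L\<^sup>2) * 6"
    by (rule mult_left_mono[OF gauss_lipschitz_square_diff_1[OF F1] zero_le])
  also have "ennreal (L\<^sup>2) * (\<integral>\<^sup>+ x. \<integral>\<^sup>+ y. ennreal ((F x / L - F y / L)\<^sup>2) \<partial>std_gauss n \<partial>std_gauss n) =
    (\<integral>\<^sup>+ x. \<integral>\<^sup>+ y. ennreal (L\<^sup>2) * ennreal ((F x / L - F y / L)\<^sup>2) \<partial>std_gauss n \<partial>std_gauss n)"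
    by (simp add: nn_integral_cmult)
  also have "\<dots> = (\<integral>\<^sup>+ x. \<integral>\<^sup>+ y. ennreal ((F x - F y)\<^sup>2) \<partial>std_gauss n \<partial>std_gauss n)"
  proof (intro nn_integral_cong)
    fix x y
    have "L\<^sup>2 * (F x / L - F y / L)\<^sup>2 = (F x - F y)\<^sup>2"
      using L by (simp add: diff_divide_distrib[symmetric] power_divide)
    then show "ennreal (L\<^sup>2) * ennreal ((F x / L - F y / L)\<^sup>2) = ennreal ((F x - F y)\<^sup>2)"
      by (simp add: ennreal_mult[symmetric])
  qed
  also have "ennreal (L\<^sup>2) * 6 = ennreal (6 * L\<^sup>2)" by (simp add: ennreal_mult' mult.commute)
  finally show ?thesis .
qed

text \<open>The inner integral over an independent copy is Var X + (X x - E X)^2; averaging over x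
  contributes the variance once more.\<close>

lemma (in prob_space) nn_integral_square_diff:
  fixes X :: "'a \<Rightarrow> real"
  assumes X: "X \<in> borel_measurable M" "integrable M (\<lambda>x. (X x)\<^sup>2)"
  shows "(\<integral>\<^sup>+ x. \<integral>\<^sup>+ y. ennreal ((X x - X y)\<^sup>2) \<partial>M \<partial>M) = ennreal (2 * variance X)"
proof -
  have i1: "integrable M X" by (rule square_integrable_imp_integrable) fact+
  have "(\<integral>\<^sup>+ y. ennreal ((X x - X y)\<^sup>2) \<partial>M) = ennreal (variance X + (X x - expectation X)\<^sup>2)" for x
  proof -
    have "has_bochner_integral M (\<lambda>y. (X x)\<^sup>2 - 2 * X x * X y + (X y)\<^sup>2)
        ((X x)\<^sup>2 - 2 * X x * expectation X + expectation (\<lambda>y. (X y)\<^sup>2))"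
      using i1 X by (intro has_bochner_integral_add has_bochner_integral_diff has_bochner_integral_mult_right
        has_bochner_integral_integrable) (auto simp: has_bochner_integral_iff prob_space)
    then have "has_bochner_integral M (\<lambda>y. (X x - X y)\<^sup>2) (variance X + (X x - expectation X)\<^sup>2)"
      unfolding variance_eq[OF i1 X(2)] by (simp add: power2_diff algebra_simps)
    then show ?thesis
      by (subst nn_integral_eq_integral) (auto simp: has_bochner_integral_iff)
  qed
  then have "(\<integral>\<^sup>+ x. \<integral>\<^sup>+ y. ennreal ((X x - X y)\<^sup>2) \<partial>M \<partial>M) = (\<integral>\<^sup>+ x. ennreal (variance X + (X x - expectation X)\<^sup>2) \<partial>M)"
    by simp
  also have "\<dots> = ennreal (2 * variance X)"
  proof -
    have "has_bochner_integral M (\<lambda>x. (X x)\<^sup>2 - 2 * expectation X * X x + (expectation X)\<^sup>2)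
      (expectation (\<lambda>x. (X x)\<^sup>2) - 2 * expectation X * expectation X + (expectation X)\<^sup>2)"
      using i1 X by (intro has_bochner_integral_add has_bochner_integral_diff has_bochner_integral_mult_right
        has_bochner_integral_integrable) (auto simp: has_bochner_integral_iff prob_space)
    then have i: "integrable M (\<lambda>x. (X x - expectation X)\<^sup>2)"
      by (simp add: power2_diff algebra_simps has_bochner_integral_iff)
    then have "integrable M (\<lambda>x. variance X + (X x - expectation X)\<^sup>2)" by simp
    then show ?thesis
      using i variance_positive[of X] by (subst nn_integral_eq_integral) (auto simp: prob_space)
  qed
  finally show ?thesis .
qed

lemma std_normal_square: "(\<integral>\<^sup>+ x. ennreal (x\<^sup>2) \<partial>std_normal) = 1"
proof -
  have "has_bochner_integral lborel (\<lambda>x. std_normal_density x * x\<^sup>2) 1"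
    using std_normal_moment_even[of 1] by (simp add: power2_eq_square)
  then have "(\<integral>\<^sup>+ x. ennreal (std_normal_density x * x\<^sup>2) \<partial>lborel) = 1"
    by (subst nn_integral_eq_integral) (auto simp: has_bochner_integral_iff)
  then show ?thesis
    by (subst nn_integral_density) (auto simp: ennreal_mult')
qed

lemma gauss_norm_square:
  "integrable (std_gauss n) (\<lambda>x. (L2_set x {..<n})\<^sup>2)"
  "(\<integral>x. (L2_set x {..<n})\<^sup>2 \<partial>std_gauss n) = real n"
proof -
  have [measurable]: "(\<lambda>x. L2_set x {..<n}) \<in> borel_measurable (std_gauss n)"
    by (rule euclid_lipschitz_measurable_gauss[OF euclid_lipschitz_norm])
  have "(\<integral>\<^sup>+ x. ennreal ((L2_set x {..<n})\<^sup>2) \<partial>std_gauss n) = (\<integral>\<^sup>+ x. (\<Sum>i<n. ennreal ((x i)\<^sup>2)) \<partial>std_gauss n)"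
    by (simp add: L2_set_square)
  also have "\<dots> = (\<Sum>i<n. \<integral>\<^sup>+ x. ennreal ((x i)\<^sup>2) \<partial>std_gauss n)"
    by (rule nn_integral_sum) measurable
  also have "\<dots> = (\<Sum>i<n. 1)"
  proof (rule sum.cong)
    fix i assume i: "i \<in> {..<n}"
    have "(\<integral>\<^sup>+ x. ennreal ((x i)\<^sup>2) \<partial>std_gauss n) = (\<integral>\<^sup>+ x. ennreal (x\<^sup>2) \<partial>distr (std_gauss n) std_normal (\<lambda>x. x i))"
      using i by (subst nn_integral_distr) auto
    also have "distr (std_gauss n) std_normal (\<lambda>x. x i) = std_normal"
      using i by (intro distr_PiM_component) (auto intro: std_normal.prob_space_axioms)
    finally show "(\<integral>\<^sup>+ x. ennreal ((x i)\<^sup>2) \<partial>std_gauss n) = 1" by (simp add: std_normal_square)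
  qed simp
  finally have *: "(\<integral>\<^sup>+ x. ennreal ((L2_set x {..<n})\<^sup>2) \<partial>std_gauss n) = ennreal (real n)"
    by (simp add: ennreal_of_nat_eq_real_of_nat)
  then show "integrable (std_gauss n) (\<lambda>x. (L2_set x {..<n})\<^sup>2)"
    by (intro integrableI_nonneg) auto
  show "(\<integral>x. (L2_set x {..<n})\<^sup>2 \<partial>std_gauss n) = real n"
    by (subst integral_eq_nn_integral) (auto simp: *)
qed

lemma euclid_lipschitz_square_integrable:
  assumes F: "euclid_lipschitz n L F"
  shows "integrable (std_gauss n) (\<lambda>x. (F x)\<^sup>2)" "integrable (std_gauss n) F"
proof -
  interpret prob_space "std_gauss n" by (rule prob_space_std_gauss)
  have [measurable]: "F \<in> borel_measurable (std_gauss n)"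
    by (rule euclid_lipschitz_measurable_gauss[OF F])
  define z where "z = (\<lambda>i\<in>{..<n}. 0 :: real)"
  have bd: "(F x)\<^sup>2 \<le> 2 * (F z)\<^sup>2 + 2 * L\<^sup>2 * (L2_set x {..<n})\<^sup>2" if "x \<in> extensional {..<n}" for x
  proof -
    have "\<bar>F x - F z\<bar> \<le> L * L2_set (\<lambda>i. x i - z i) {..<n}"
      using that by (intro euclid_lipschitzD[OF F]) (auto simp: z_def)
    also have "L2_set (\<lambda>i. x i - z i) {..<n} = L2_set x {..<n}"
      by (intro L2_set_cong) (auto simp: z_def)
    finally have "\<bar>F x - F z\<bar>\<^sup>2 \<le> (L * L2_set x {..<n})\<^sup>2" by (rule power_mono) simp
    then have "(F x - F z)\<^sup>2 \<le> L\<^sup>2 * (L2_set x {..<n})\<^sup>2" by (simp add: power_mult_distrib)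
    moreover have "(F x)\<^sup>2 \<le> 2 * (F z)\<^sup>2 + 2 * (F x - F z)\<^sup>2"
      using zero_le_power2[of "F x - 2 * F z"] by (simp add: power2_eq_square algebra_simps)
    ultimately show ?thesis by simp
  qed
  show 2: "integrable (std_gauss n) (\<lambda>x. (F x)\<^sup>2)"
  proof (rule Bochner_Integration.integrable_bound)
    show "integrable (std_gauss n) (\<lambda>x. 2 * (F z)\<^sup>2 + 2 * L\<^sup>2 * (L2_set x {..<n})\<^sup>2)"
      using gauss_norm_square(1) by auto
    show "AE x in std_gauss n. norm ((F x)\<^sup>2) \<le> norm (2 * (F z)\<^sup>2 + 2 * L\<^sup>2 * (L2_set x {..<n})\<^sup>2)"
      using bd by (intro AE_I2) (auto simp: space_std_gauss)
  qed simp
  show "integrable (std_gauss n) F" by (rule square_integrable_imp_integrable[OF _ 2]) simp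
qed

text \<open>The optimal constant is 1. The value 3 is what the exponential bound yields, and only
  its independence of \<open>n\<close> matters.\<close>

lemma gauss_poincare_lipschitz:
  assumes F: "euclid_lipschitz n L F"
  shows "prob_space.variance (std_gauss n) F \<le> 3 * L\<^sup>2"
proof -
  interpret prob_space "std_gauss n" by (rule prob_space_std_gauss)
  have "ennreal (2 * variance F) \<le> ennreal (6 * L\<^sup>2)"
    using gauss_lipschitz_square_diff[OF F] euclid_lipschitz_square_integrable[OF F]
      nn_integral_square_diff[OF euclid_lipschitz_measurable_gauss[OF F]] by simp
  then show ?thesis using F by simp
qed

text \<open>With m the mean of the norm, E |Z|^2 = n and the nonnegative variance give m \<le> sqrt
  n. Centring at sqrt n instead of m at most doubles the variance, since the second moment about
  sqrt n is 2 sqrt n (sqrt n - m) \<le> 2 (n - m^2).\<close>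

lemma gauss_norm_concentration:
  "(\<integral>x. L2_set x {..<n} \<partial>std_gauss n) \<le> sqrt (real n)"
  "(\<integral>x. (L2_set x {..<n} - sqrt (real n))\<^sup>2 \<partial>std_gauss n) \<le> 6"
proof -
  interpret prob_space "std_gauss n" by (rule prob_space_std_gauss)
  let ?N = "\<lambda>x::nat \<Rightarrow> real. L2_set x {..<n}"
  define m where "m = (\<integral>x. ?N x \<partial>std_gauss n)"
  note int = euclid_lipschitz_square_integrable[OF euclid_lipschitz_norm[of n]]
  have var: "variance ?N = real n - m\<^sup>2"
    using variance_eq[OF int(2,1)] gauss_norm_square(2) by (simp add: m_def)
  have m0: "m \<ge> 0" unfolding m_def by (intro integral_nonneg_AE) auto
  have "m\<^sup>2 \<le> real n" using variance_positive[of ?N] var by simp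
  then have mn: "m \<le> sqrt (real n)" by (rule real_le_rsqrt)
  then show "(\<integral>x. ?N x \<partial>std_gauss n) \<le> sqrt (real n)" by (simp add: m_def)
  have "(\<integral>x. (?N x - sqrt (real n))\<^sup>2 \<partial>std_gauss n) = (\<integral>x. (?N x)\<^sup>2 - 2 * sqrt (real n) * ?N x + real n \<partial>std_gauss n)"
    by (intro Bochner_Integration.integral_cong) (auto simp: power2_diff)
  also have "\<dots> = real n - 2 * sqrt (real n) * m + real n"
    using int gauss_norm_square(2) by (simp add: m_def prob_space)
  also have "\<dots> = 2 * (sqrt (real n) * (sqrt (real n) - m))" by (simp add: algebra_simps)
  also have "\<dots> \<le> 2 * ((sqrt (real n) + m) * (sqrt (real n) - m))"
    using mn m0 by (intro mult_left_mono mult_right_mono) auto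
  also have "\<dots> = 2 * variance ?N" unfolding var by (simp add: algebra_simps power2_eq_square)
  also have "\<dots> \<le> 6" using gauss_poincare_lipschitz[OF euclid_lipschitz_norm[of n]] by simp
  finally show "(\<integral>x. (?N x - sqrt (real n))\<^sup>2 \<partial>std_gauss n) \<le> 6" .
qed

section \<open>Parameters of Borel probability measures\<close>

text \<open>
  In base 4 with digits 0 and 1 the tail of the expansion stays below one unit, so the digits are
  recovered by taking floors, without the ambiguity of binary expansions.
\<close>
definition bits_to_real :: "(nat \<Rightarrow> bool) \<Rightarrow> real" where
  "bits_to_real b = (\<Sum>k. of_bool (b k) / 4 ^ Suc k)"

lemma bits_to_real_summable: "summable (\<lambda>k. of_bool (b k) / 4 ^ Suc k :: real)"
proof (rule summable_comparison_test')
  show "summable (\<lambda>k. (1 / 4) ^ k :: real)" by (rule summable_geometric) simp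
  show "norm (of_bool (b k) / 4 ^ Suc k :: real) \<le> (1 / 4) ^ k" for k
    by (auto simp: power_divide divide_simps)
qed

lemma bits_to_real_rec: "4 * bits_to_real b = of_bool (b 0) + bits_to_real (\<lambda>k. b (Suc k))"
proof -
  have "bits_to_real b = (\<Sum>k. of_bool (b (Suc k)) / 4 ^ Suc (Suc k)) + of_bool (b 0) / 4"
    unfolding bits_to_real_def using suminf_split_head[OF bits_to_real_summable[of b]] by simp
  also have "(\<Sum>k. of_bool (b (Suc k)) / 4 ^ Suc (Suc k) :: real) = (\<Sum>k. of_bool (b (Suc k)) / 4 ^ Suc k) / 4"
    using suminf_divide[OF bits_to_real_summable[of "\<lambda>k. b (Suc k)"], of 4] by (simp add: mult.commute)
  finally show ?thesis by (simp add: bits_to_real_def)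
qed

lemma bits_to_real_bounds: "0 \<le> bits_to_real b" "bits_to_real b < 1"
proof -
  show "0 \<le> bits_to_real b"
    unfolding bits_to_real_def by (rule suminf_nonneg[OF bits_to_real_summable]) simp
  have geo: "(\<lambda>k. (1 / 4) * (1 / 4) ^ k :: real) sums (1 / 3)"
    using sums_mult[OF geometric_sums[of "1 / 4 :: real"], of "1 / 4"] by simp
  have "bits_to_real b \<le> (\<Sum>k. (1 / 4) * (1 / 4) ^ k)"
    unfolding bits_to_real_def
  proof (rule suminf_le[OF _ bits_to_real_summable])
    show "of_bool (b k) / 4 ^ Suc k \<le> (1 / 4) * (1 / 4 :: real) ^ k" for k
      by (cases "b k") (simp_all add: power_divide)
  qed (use geo in \<open>auto simp: sums_iff\<close>)
  also have "\<dots> = 1 / 3" using geo by (simp add: sums_iff)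
  finally show "bits_to_real b < 1" by simp
qed

text \<open>After scaling, the digits before position \<open>k\<close> contribute a multiple of 4
  and those after it less than 1, so the parity of the floor is digit \<open>k\<close>
  alone.\<close>

lemma odd_floor_bits_to_real: "odd \<lfloor>4 ^ Suc k * bits_to_real b\<rfloor> \<longleftrightarrow> b k"
proof (induction k arbitrary: b)
  case 0
  have "\<lfloor>4 * bits_to_real b\<rfloor> = of_bool (b 0)"
    unfolding bits_to_real_rec[of b] using bits_to_real_bounds[of "\<lambda>k. b (Suc k)"]
    by (intro floor_unique) auto
  then show ?case by simp
next
  case (Suc k)
  have "4 ^ Suc (Suc k) * bits_to_real b = 4 ^ Suc k * (4 * bits_to_real b)" by simp
  also have "\<dots> = of_int (4 ^ Suc k * of_bool (b 0)) + 4 ^ Suc k * bits_to_real (\<lambda>k. b (Suc k))"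
    unfolding bits_to_real_rec[of b] by (simp add: algebra_simps)
  finally have "\<lfloor>4 ^ Suc (Suc k) * bits_to_real b\<rfloor> =
      4 ^ Suc k * of_bool (b 0) + \<lfloor>4 ^ Suc k * bits_to_real (\<lambda>k. b (Suc k))\<rfloor>"
    by (simp only: int_add_floor)
  then show ?case using Suc[of "\<lambda>k. b (Suc k)"] by simp
qed

text \<open>
  A real number is encoded by the bits telling which rationals lie below it, and decoded as the
  supremum of those rationals.
\<close>
lemma countable_family_encoding:
  fixes X :: "nat \<Rightarrow> 'a \<Rightarrow> real"
  assumes [measurable]: "\<And>i. X i \<in> borel_measurable M"
  obtains e v where "e \<in> borel_measurable M" "\<And>i. v i \<in> borel_measurable borel"
    "\<And>i x. v i (e x :: real) = X i x"
proof -
  define q where "q = (\<lambda>m. real_of_rat (nat_to_rat_surj m))"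
  define bit where "bit = (\<lambda>x k. q (snd (prod_decode k)) < X (fst (prod_decode k)) x)"
  define e where "e = (\<lambda>x. bits_to_real (bit x))"
  \<comment> \<open>Decoding has to be measurable on all reals, also off the range of the encoder,
    where this supremum may be infinite. It is therefore taken in \<open>ereal\<close>, with minus
    infinity for a bit that is not set, and made real only afterwards.\<close>
  define w where "w = (\<lambda>i (y::real). SUP m. if odd \<lfloor>4 ^ Suc (prod_encode (i, m)) * y\<rfloor> then ereal (q m) else - \<infinity>)"
  have "e \<in> borel_measurable M"
    unfolding e_def bits_to_real_def bit_def by measurable
  moreover have "(\<lambda>y. real_of_ereal (w i y)) \<in> borel_measurable borel" for i
  proof -
    have [measurable]: "Measurable.pred borel (\<lambda>y. odd \<lfloor>c * y :: real\<rfloor>)" for c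
    proof -
      have "(\<lambda>y. \<lfloor>c * y\<rfloor>) \<in> measurable borel (count_space UNIV)" by measurable
      then show ?thesis by measurable
    qed
    have "w i \<in> borel_measurable borel" unfolding w_def by measurable
    then show ?thesis by measurable
  qed
  moreover have "real_of_ereal (w i (e x)) = X i x" for i x
  proof -
    have "w i (e x) = (SUP m. if q m < X i x then ereal (q m) else - \<infinity>)"
      unfolding w_def e_def odd_floor_bits_to_real by (simp add: bit_def)
    also have "\<dots> = ereal (X i x)"
    proof (rule antisym)
      show "(SUP m. if q m < X i x then ereal (q m) else - \<infinity>) \<le> ereal (X i x)"
        by (rule SUP_least) auto
      show "ereal (X i x) \<le> (SUP m. if q m < X i x then ereal (q m) else - \<infinity>)"
      proof (rule dense_le)
        fix y assume y: "y < ereal (X i x)"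
        then obtain u where u: "y < ereal u" "u < X i x"
          using ereal_dense2[OF y] by auto
        obtain r where r: "u < real_of_rat r" "real_of_rat r < X i x"
          using of_rat_dense[OF u(2)] by blast
        obtain m where "r = nat_to_rat_surj m" using surj_nat_to_rat_surj by (metis surjD)
        then have m: "u < q m" "q m < X i x" using r by (auto simp: q_def)
        have "y \<le> (if q m < X i x then ereal (q m) else - \<infinity>)"
          using m less_imp_le[OF less_trans[OF u(1), of "ereal (q m)"]] by simp
        also have "\<dots> \<le> (SUP m. if q m < X i x then ereal (q m) else - \<infinity>)"
          by (rule SUP_upper) simp
        finally show "y \<le> (SUP m. if q m < X i x then ereal (q m) else - \<infinity>)" .
      qed
    qed
    finally show ?thesis by simp
  qed
  ultimately show thesis by (rule that[of e "\<lambda>i y. real_of_ereal (w i y)"])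
qed

lemma real_distribution_parameter:
  assumes "real_distribution D"
  obtains q where "q \<in> measurable unit_leb borel" "distr unit_leb borel q = D"
proof -
  interpret cdf_distribution D
    unfolding cdf_distribution_def by (rule assms)
  let ?I = "\<lambda>\<omega>. Inf {x. \<omega> \<le> cdf D x}"
  \<comment> \<open>The quantile function, with the arbitrary value 0 at the endpoints: at 0 the
    infimum would run over all reals, and at 1 over a set that may be empty. The two points form a
    null set.\<close>
  define q where "q = (\<lambda>s::real. if s \<in> {0<..<1} then ?I s else 0)"
  have qb: "q \<in> borel_measurable borel"
    unfolding q_def using measurable_CI by (subst measurable_restrict_space_iff[symmetric]) auto
  have Im: "?I \<in> measurable (restrict_space lborel {0<..<1}) borel"
    using measurable_CI by (simp cong: measurable_cong_sets sets_restrict_space_cong)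
  from qb have q: "q \<in> measurable unit_leb borel"
    unfolding unit_leb_def by (intro measurable_restrict_space1) simp
  moreover have "distr unit_leb borel q = D"
  proof -
    have "distr unit_leb borel q = distr (restrict_space lborel {0<..<1}) borel ?I"
    proof (rule measure_eqI)
      fix A :: "real set" assume "A \<in> sets (distr unit_leb borel q)"
      then have A [measurable]: "A \<in> sets borel" by simp
      have qm: "{s. q s \<in> A} \<in> sets borel" using qb A by measurable
      have "emeasure (distr unit_leb borel q) A = emeasure lborel ({s. q s \<in> A} \<inter> {0..1})"
        using q A qm by (subst emeasure_distr)
          (auto simp: unit_leb_def space_restrict_space emeasure_restrict_space vimage_def intro!: arg_cong[where f="emeasure lborel"])
      also have "\<dots> = emeasure lborel ({s. q s \<in> A} \<inter> {0<..<1})"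
      proof (rule emeasure_eq_AE)
        show "AE x in lborel. x \<in> {s. q s \<in> A} \<inter> {0..1} \<longleftrightarrow> x \<in> {s. q s \<in> A} \<inter> {0<..<1}"
          using AE_lborel_singleton[of 0] AE_lborel_singleton[of 1] by eventually_elim auto
      qed (use qm in auto)
      also have "{s. q s \<in> A} \<inter> {0<..<1} = ?I -` A \<inter> {0<..<1}" by (auto simp: q_def)
      also have "emeasure lborel (?I -` A \<inter> {0<..<1}) = emeasure (distr (restrict_space lborel {0<..<1}) borel ?I) A"
        using Im A by (subst emeasure_distr) (auto simp: space_restrict_space emeasure_restrict_space)
      finally show "emeasure (distr unit_leb borel q) A = emeasure (distr (restrict_space lborel {0<..<1}) borel ?I) A" .
    qed simp
    then show ?thesis using distr_I_eq_M by simp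
  qed
  ultimately show thesis by (rule that)
qed

text \<open>The encoded law on the real line has a quantile function. The decoder \<open>d\<close>
  carries it back to \<open>M\<close>, with the right law because \<open>d\<close> undoes
  \<open>e\<close> on the whole space.\<close>

lemma parameter_of_retract:
  fixes e :: "'a \<Rightarrow> real"
  assumes M: "prob_space M" and e: "e \<in> borel_measurable M" and d: "d \<in> measurable borel M"
    and de: "\<And>x. x \<in> space M \<Longrightarrow> d (e x) = x"
  obtains \<phi> where "\<phi> \<in> measurable unit_leb M" "distr unit_leb M \<phi> = M"
proof -
  interpret prob_space M by fact
  have "real_distribution (distr M borel e)"
    using e by (intro real_distribution.intro prob_space_distr) (auto simp: real_distribution_axioms_def)
  then obtain q where q: "q \<in> measurable unit_leb borel" "distr unit_leb borel q = distr M borel e"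
    by (rule real_distribution_parameter)
  have "distr unit_leb M (\<lambda>s. d (q s)) = distr (distr unit_leb borel q) M d"
    using q d by (subst distr_distr) (auto simp: comp_def)
  also have "\<dots> = distr M M (\<lambda>x. d (e x))"
    unfolding q(2) using e d by (subst distr_distr) (auto simp: comp_def)
  also have "\<dots> = distr M M (\<lambda>x. x)"
    using de by (intro distr_cong) auto
  also have "\<dots> = M" by (rule distr_id)
  finally show thesis
    using measurable_compose[OF q(1) d] by (intro that) auto
qed

lemma sets_half_line_measure: "sets (half_line_measure \<beta> l) = sets (restrict_space borel {0..})"
  by (simp add: half_line_measure_def sets_restrict_space)

lemma space_half_line_measure: "space (half_line_measure \<beta> l) = {0..}"
  by (simp add: half_line_measure_def space_restrict_space)

lemma prob_space_half_line:
  assumes "\<beta> > 0" "l > 0"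
  shows "prob_space (half_line_measure \<beta> l)"
  using emeasure_half_line_measure[OF assms] by (intro prob_spaceI) (simp add: space_half_line_measure)

lemma measurable_half_line: "(\<lambda>a. a) \<in> borel_measurable (half_line_measure \<beta> l)"
  unfolding measurable_cong_sets[OF sets_half_line_measure refl]
  by (rule measurable_restrict_space1) simp

lemma gauss_half_line_parameter:
  assumes "\<beta> > 0" "l > 0"
  obtains \<theta> where "\<theta> \<in> measurable unit_leb (std_gauss n \<Otimes>\<^sub>M half_line_measure \<beta> l)"
    "distr unit_leb (std_gauss n \<Otimes>\<^sub>M half_line_measure \<beta> l) \<theta> = std_gauss n \<Otimes>\<^sub>M half_line_measure \<beta> l"
proof -
  let ?H = "half_line_measure \<beta> l" 
  let ?M = "std_gauss n \<Otimes>\<^sub>M ?H"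
  interpret G: prob_space "std_gauss n" by (rule prob_space_std_gauss)
  interpret H: prob_space ?H using assms by (rule prob_space_half_line)
  interpret P: pair_prob_space "std_gauss n" ?H ..
  \<comment> \<open>The indices below \<open>n\<close> carry the Gaussian vector and index
    \<open>n\<close> the mixing variable, repeated for all later indices because the encoding takes
    an infinite sequence.\<close>
  define X where "X = (\<lambda>i (p :: (nat \<Rightarrow> real) \<times> real). if i < n then fst p i else snd p)"
  have X: "X i \<in> borel_measurable ?M" for i
  proof (cases "i < n")
    case True
    then have "(\<lambda>z. z i) \<in> measurable (std_gauss n) std_normal" by simp
    then have "(\<lambda>p. fst p i) \<in> measurable ?M std_normal" by measurable
    then show ?thesis using True by (simp add: X_def)
  next
    case False
    then show ?thesis using measurable_compose[OF measurable_snd measurable_half_line] by (simp add: X_def)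
  qed
  from countable_family_encoding[of X ?M, OF X]
  obtain e and v :: "nat \<Rightarrow> real \<Rightarrow> real" where ev: "e \<in> borel_measurable ?M"
    "\<And>i. v i \<in> borel_measurable borel" "\<And>i x. v i (e x) = X i x"
    by (metis (no_types, lifting))
  \<comment> \<open>The restriction and \<open>max 0\<close> send every real into the carrier, even
    one that encodes no point.\<close>
  define d where "d = (\<lambda>y. (\<lambda>i\<in>{..<n}. v i y, max 0 (v n y)))"
  have "d \<in> measurable borel ?M"
    unfolding d_def
  proof (rule measurable_Pair)
    show "(\<lambda>y. \<lambda>i\<in>{..<n}. v i y) \<in> measurable borel (std_gauss n)"
      using ev(2) by (intro measurable_restrict) simp
    show "(\<lambda>y. max 0 (v n y)) \<in> measurable borel ?H"
      unfolding measurable_cong_sets[OF refl sets_half_line_measure]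
      using ev(2) by (intro measurable_restrict_space2) auto
  qed
  moreover have "d (e x) = x" if xM: "x \<in> space ?M" for x
  proof -
    obtain z a where x: "x = (z, a)" "z \<in> extensional {..<n}" "0 \<le> a"
      using xM unfolding space_pair_measure space_half_line_measure space_std_gauss by auto
    have "(\<lambda>i\<in>{..<n}. X i x) = z"
      using x(2) by (intro ext) (simp add: x(1) X_def restrict_def extensional_def)
    moreover have "max 0 (X n x) = a" using x(3) by (simp add: x(1) X_def)
    ultimately show ?thesis unfolding d_def ev(3) x(1) by simp
  qed
  ultimately obtain \<theta> where "\<theta> \<in> measurable unit_leb ?M" "distr unit_leb ?M \<theta> = ?M"
    using parameter_of_retract[OF P.prob_space_axioms ev(1)] by (metis (no_types, lifting))
  then show thesis by (rule that)
qed

section \<open>The Cauchy measure as a Gaussian scale mixture\<close>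

text \<open>For t > 0 this is the density of l / Y with Y chi-distributed with \<beta> degrees of
  freedom. In the mixture with l = 1 it makes the Cauchy measure a rescaled multivariate t law. As a
  real function it allows identities to be computed outside \<open>ennreal\<close>.\<close>

definition half_line_density :: "real \<Rightarrow> real \<Rightarrow> real \<Rightarrow> real" where
  "half_line_density \<beta> l t = 2 powr (1 - \<beta> / 2) / Gamma (\<beta> / 2) * (l powr \<beta> / t powr (\<beta> + 1)) *
     exp (- (l\<^sup>2 / (2 * t\<^sup>2)))"

lemma half_line_density_measurable [measurable]: "half_line_density \<beta> l \<in> borel_measurable borel"
  unfolding half_line_density_def by measurable

lemma nn_integral_half_line:
  assumes [measurable]: "g \<in> borel_measurable borel"
  shows "(\<integral>\<^sup>+ a. g a \<partial>half_line_measure \<beta> l) =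
    (\<integral>\<^sup>+ a. ennreal (half_line_density \<beta> l a) * g a * indicator {0..} a \<partial>lborel)"
proof -
  have "half_line_measure \<beta> l = density (restrict_space lborel {0..}) (\<lambda>t. ennreal (half_line_density \<beta> l t))"
    unfolding half_line_measure_def half_line_density_def ..
  then show ?thesis
    by (simp add: nn_integral_density nn_integral_restrict_space measurable_restrict_space1)
qed

lemma nn_integral_half_line_density:
  assumes "\<beta> > 0" "l > 0"
  shows "(\<integral>\<^sup>+ a. ennreal (half_line_density \<beta> l a) * indicator {0..} a \<partial>lborel) = 1"
proof -
  have "(\<integral>\<^sup>+ a. ennreal (half_line_density \<beta> l a) * indicator {0..} a \<partial>lborel) = (\<integral>\<^sup>+ a. 1 \<partial>half_line_measure \<beta> l)"
    by (subst nn_integral_half_line) auto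
  also have "\<dots> = 1"
    using emeasure_half_line_measure[OF assms] by (simp add: space_half_line_measure)
  finally show ?thesis .
qed

text \<open>Gives the law of a Z its Lebesgue density, one affine substitution per coordinate.
  \<open>f\<close> is a general function and not a product, so that indicators of arbitrary
  measurable sets are covered.\<close>

lemma PiM_std_normal_scale:
  fixes f :: "('i \<Rightarrow> real) \<Rightarrow> ennreal"
  assumes "finite I" "a > 0" "f \<in> borel_measurable (PiM I (\<lambda>_. lborel))"
  shows "(\<integral>\<^sup>+ z. f (\<lambda>i\<in>I. a * z i) \<partial>PiM I (\<lambda>_. std_normal)) =
    (\<integral>\<^sup>+ x. f x * ennreal (\<Prod>i\<in>I. normal_density 0 a (x i)) \<partial>PiM I (\<lambda>_. lborel))"
  using assms(1,3)
proof (induction I arbitrary: f)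
  case empty
  then show ?case by (simp add: PiM_empty nn_integral_count_space_finite restrict_def)
next
  case (insert i I)
  interpret N: product_sigma_finite "\<lambda>_::'i. std_normal" ..
  interpret L: product_sigma_finite "\<lambda>_::'i. lborel :: real measure" ..
  interpret LI: finite_product_sigma_finite "\<lambda>_::'i. lborel :: real measure" I by standard (rule insert.hyps)
  note [measurable] = insert.prems
  define p where "p = (\<lambda>(J :: 'i set) x. ennreal (\<Prod>i\<in>J. normal_density 0 a (x i :: real)))"
  define G where "G = (\<lambda>t. \<integral>\<^sup>+ x. f (x(i := t)) * p I x \<partial>PiM I (\<lambda>_. lborel))"
  have [measurable]: "p J \<in> borel_measurable (PiM J (\<lambda>_. lborel))" for J :: "'i set"
    unfolding p_def by measurable
  have "G \<in> borel_measurable lborel" unfolding G_def by measurable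
  then have Gm [measurable]: "G \<in> borel_measurable borel" by simp
  have rm: "(\<lambda>z. \<lambda>j\<in>insert i I. a * z j) \<in> measurable (PiM (insert i I) (\<lambda>_. std_normal)) (PiM (insert i I) (\<lambda>_. lborel))"
  proof (rule measurable_restrict)
    fix j assume "j \<in> insert i I"
    then have "(\<lambda>z. z j) \<in> measurable (PiM (insert i I) (\<lambda>_. std_normal)) std_normal" by (rule measurable_component_singleton)
    then show "(\<lambda>z. a * z j) \<in> measurable (PiM (insert i I) (\<lambda>_. std_normal)) lborel" by simp
  qed
  have "(\<integral>\<^sup>+ z. f (\<lambda>j\<in>insert i I. a * z j) \<partial>PiM (insert i I) (\<lambda>_. std_normal)) =
      (\<integral>\<^sup>+ y. \<integral>\<^sup>+ z. f (\<lambda>j\<in>insert i I. a * (z(i := y)) j) \<partial>PiM I (\<lambda>_. std_normal) \<partial>std_normal)"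
    using insert.hyps measurable_compose[OF rm insert.prems] by (rule N.product_nn_integral_insert_rev)
  also have "\<dots> = (\<integral>\<^sup>+ y. \<integral>\<^sup>+ z. f ((\<lambda>j\<in>I. a * z j)(i := a * y)) \<partial>PiM I (\<lambda>_. std_normal) \<partial>std_normal)"
    using insert.hyps by (intro nn_integral_cong arg_cong[where f = f]) (auto simp: restrict_def fun_eq_iff)
  also have "\<dots> = (\<integral>\<^sup>+ y. G (a * y) \<partial>std_normal)"
  proof (rule nn_integral_cong)
    fix y :: real
    have "(\<lambda>x. f (x(i := a * y))) \<in> borel_measurable (PiM I (\<lambda>_. lborel))" by measurable
    from insert.IH[OF this]
    show "(\<integral>\<^sup>+ z. f ((\<lambda>j\<in>I. a * z j)(i := a * y)) \<partial>PiM I (\<lambda>_. std_normal)) = G (a * y)"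
      by (simp only: G_def p_def)
  qed
  also have "\<dots> = (\<integral>\<^sup>+ y. ennreal (std_normal_density y) * G (a * y) \<partial>lborel)"
    by (subst nn_integral_density) auto
  also have "\<dots> = (\<integral>\<^sup>+ t. ennreal (normal_density 0 a t) * G t \<partial>lborel)"
  proof -
    have "(\<integral>\<^sup>+ t. ennreal (normal_density 0 a t) * G t \<partial>lborel) =
      ennreal a * (\<integral>\<^sup>+ y. ennreal (normal_density 0 a (a * y)) * G (a * y) \<partial>lborel)"
      using assms(2) by (subst nn_integral_real_affine[where c = a and t = 0]) auto
    also have "\<dots> = (\<integral>\<^sup>+ y. ennreal a * (ennreal (normal_density 0 a (a * y)) * G (a * y)) \<partial>lborel)"
      by (rule nn_integral_cmult[symmetric]) measurable
    also have "\<dots> = (\<integral>\<^sup>+ y. ennreal (std_normal_density y) * G (a * y) \<partial>lborel)"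
    proof (rule nn_integral_cong)
      fix y :: real
      have "a * normal_density 0 a (a * y) = std_normal_density y"
        using assms(2) by (simp add: normal_density_def real_sqrt_mult power_mult_distrib)
      then show "ennreal a * (ennreal (normal_density 0 a (a * y)) * G (a * y)) = ennreal (std_normal_density y) * G (a * y)"
        using assms(2) by (simp flip: ennreal_mult mult.assoc)
    qed
    finally show ?thesis by simp
  qed
  also have "\<dots> = (\<integral>\<^sup>+ t. \<integral>\<^sup>+ x. f (x(i := t)) * p (insert i I) (x(i := t)) \<partial>PiM I (\<lambda>_. lborel) \<partial>lborel)"
  proof (rule nn_integral_cong)
    fix t :: real
    have "ennreal (normal_density 0 a t) * G t =
        (\<integral>\<^sup>+ x. ennreal (normal_density 0 a t) * (f (x(i := t)) * p I x) \<partial>PiM I (\<lambda>_. lborel))"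
      unfolding G_def by (rule nn_integral_cmult[symmetric]) measurable
    also have "\<dots> = (\<integral>\<^sup>+ x. f (x(i := t)) * p (insert i I) (x(i := t)) \<partial>PiM I (\<lambda>_. lborel))"
    proof (rule nn_integral_cong)
      fix x :: "'i \<Rightarrow> real"
      have "(\<Prod>j\<in>I. normal_density 0 a ((x(i := t)) j)) = (\<Prod>j\<in>I. normal_density 0 a (x j))"
        using insert.hyps by (intro prod.cong) auto
      then have "p (insert i I) (x(i := t)) = ennreal (normal_density 0 a t) * p I x"
        unfolding p_def using insert.hyps by (simp add: ennreal_mult prod_nonneg del: fun_upd_apply) (simp add: ennreal_mult prod_nonneg)
      then show "ennreal (normal_density 0 a t) * (f (x(i := t)) * p I x) = f (x(i := t)) * p (insert i I) (x(i := t))"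
        by (simp add: mult_ac)
    qed
    finally show "ennreal (normal_density 0 a t) * G t =
      (\<integral>\<^sup>+ x. f (x(i := t)) * p (insert i I) (x(i := t)) \<partial>PiM I (\<lambda>_. lborel))" .
  qed
  also have "\<dots> = (\<integral>\<^sup>+ x. f x * p (insert i I) x \<partial>PiM (insert i I) (\<lambda>_. lborel))"
    using insert.hyps by (subst L.product_nn_integral_insert_rev) auto
  finally show ?case unfolding p_def .
qed

text \<open>
  The mixture integral needs no new computation: as a function of \<open>a\<close>, the joint density is the
  Cauchy density at \<open>x\<close> times the half line density with parameters \<open>n + \<beta>\<close> and
  \<open>sqrt (1 + |x|\<^sup>2)\<close>, which has total mass 1.
\<close>
lemma half_line_density_mixture:
  assumes "\<beta> > 0" "a > 0"
  shows "half_line_density \<beta> 1 a * (\<Prod>i<n. normal_density 0 a (x i)) =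
    Gamma ((real n + \<beta>) / 2) / (pi powr (real n / 2) * Gamma (\<beta> / 2)) *
        (1 / (1 + (L2_set x {..<n})\<^sup>2) powr ((real n + \<beta>) / 2)) *
    half_line_density (real n + \<beta>) (sqrt (1 + (L2_set x {..<n})\<^sup>2)) a"
proof -
  define w where "w = 1 + (L2_set x {..<n})\<^sup>2"
  define s where "s = (real n + \<beta>) / 2"
  have w: "w > 0" by (simp add: w_def add_pos_nonneg)
  have s: "s > 0" using assms by (simp add: s_def add_nonneg_pos)
  have "(\<Prod>i<n. normal_density 0 a (x i)) = (\<Prod>i<n. 1 / sqrt (2 * pi * a\<^sup>2) * exp (- ((x i)\<^sup>2 / (2 * a\<^sup>2))))"
    by (simp add: normal_density_def)
  also have "\<dots> = (1 / sqrt (2 * pi * a\<^sup>2)) ^ n * exp (\<Sum>i<n. - ((x i)\<^sup>2 / (2 * a\<^sup>2)))"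
    unfolding prod.distrib by (simp add: exp_sum)
  also have "(\<Sum>i<n. - ((x i)\<^sup>2 / (2 * a\<^sup>2))) = - (L2_set x {..<n})\<^sup>2 / (2 * a\<^sup>2)"
    by (simp add: L2_set_square sum_negf sum_divide_distrib)
  also have "(1 / sqrt (2 * pi * a\<^sup>2)) ^ n = 2 powr (- real n / 2) * pi powr (- real n / 2) * a powr (- real n)"
  proof -
    have "1 / sqrt (2 * pi * a\<^sup>2) = 2 powr (- 1 / 2) * pi powr (- 1 / 2) * a powr (- 1)"
      using assms by (simp add: real_sqrt_mult powr_minus powr_half_sqrt field_simps)
    then have "(1 / sqrt (2 * pi * a\<^sup>2)) ^ n = (2 powr (- 1 / 2) * pi powr (- 1 / 2) * a powr (- 1)) powr real n"
      using assms by (simp add: powr_realpow)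
    then show ?thesis using assms by (simp add: powr_divide powr_mult powr_powr powr_minus_divide)
  qed
  finally have P: "(\<Prod>i<n. normal_density 0 a (x i)) = 2 powr (- real n / 2) * pi powr (- real n / 2) * a powr (- real n) *
    exp (- (L2_set x {..<n})\<^sup>2 / (2 * a\<^sup>2))" .
  have E: "exp (- (1 / (2 * a\<^sup>2))) * exp (- (L2_set x {..<n})\<^sup>2 / (2 * a\<^sup>2)) = exp (- (w / (2 * a\<^sup>2)))"
    by (simp add: w_def add_divide_distrib flip: exp_add)
  have h1: "half_line_density \<beta> 1 a = 2 powr (1 - \<beta> / 2) / Gamma (\<beta> / 2) * a powr (- (\<beta> + 1)) * exp (- (1 / (2 * a\<^sup>2)))"
    unfolding half_line_density_def powr_minus_divide by simp
  have "half_line_density \<beta> 1 a * (\<Prod>i<n. normal_density 0 a (x i)) =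
    (2 powr (1 - \<beta> / 2) * 2 powr (- real n / 2)) * pi powr (- real n / 2) / Gamma (\<beta> / 2) * (a powr (- (\<beta> + 1)) * a powr (- real n)) *
    (exp (- (1 / (2 * a\<^sup>2))) * exp (- (L2_set x {..<n})\<^sup>2 / (2 * a\<^sup>2)))"
    unfolding P h1 by (simp only: divide_inverse mult_ac)
  also have "2 powr (1 - \<beta> / 2) * 2 powr (- real n / 2) = 2 powr (1 - s)"
    unfolding powr_add[symmetric] by (rule arg_cong[where f = "(powr) 2"]) (simp add: s_def field_simps)
  also have "a powr (- (\<beta> + 1)) * a powr (- real n) = 1 / a powr (2 * s + 1)"
  proof -
    have "a powr (- (\<beta> + 1)) * a powr (- real n) = a powr (- (2 * s + 1))"
      unfolding powr_add[symmetric] by (rule arg_cong[where f = "(powr) a"]) (simp add: s_def field_simps)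
    then show ?thesis by (simp only: powr_minus_divide)
  qed
  also note E
  also have "2 powr (1 - s) * pi powr (- real n / 2) / Gamma (\<beta> / 2) * (1 / a powr (2 * s + 1)) * exp (- (w / (2 * a\<^sup>2))) =
    Gamma s / (pi powr (real n / 2) * Gamma (\<beta> / 2)) * (1 / w powr s) * half_line_density (2 * s) (sqrt w) a"
  proof -
    have "sqrt w powr (2 * s) = w powr s" using w by (simp add: powr_half_sqrt[symmetric] powr_powr)
    then have "half_line_density (2 * s) (sqrt w) a = 2 powr (1 - s) / Gamma s * (w powr s / a powr (2 * s + 1)) * exp (- (w / (2 * a\<^sup>2)))"
      using w by (simp add: half_line_density_def)
    moreover have "Gamma s > 0" "w powr s > 0" using s w by auto
    moreover have "pi powr (- real n / 2) = 1 / pi powr (real n / 2)" by (simp add: powr_minus_divide[symmetric])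
    ultimately show ?thesis by simp
  qed
  also have "2 * s = real n + \<beta>" by (simp add: s_def)
  finally show ?thesis unfolding w_def s_def .
qed

lemma scale_measurable:
  "(\<lambda>(z, a). \<lambda>i\<in>{..<n}. a * z i) \<in> measurable (std_gauss n \<Otimes>\<^sub>M half_line_measure \<beta> l) (PiM {..<n} (\<lambda>_. lborel))"
  unfolding case_prod_beta
proof (rule measurable_restrict)
  fix i assume "i \<in> {..<n}"
  then have "(\<lambda>z. z i) \<in> measurable (std_gauss n) std_normal" by (rule measurable_component_singleton)
  then have "(\<lambda>z. z i) \<in> borel_measurable (std_gauss n)" by simp
  then have [measurable]: "(\<lambda>p. fst p i) \<in> borel_measurable (std_gauss n \<Otimes>\<^sub>M half_line_measure \<beta> l)"
    by (rule measurable_compose[OF measurable_fst])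
  have [measurable]: "snd \<in> borel_measurable (std_gauss n \<Otimes>\<^sub>M half_line_measure \<beta> l)"
    by (rule measurable_compose[OF measurable_snd measurable_half_line])
  show "(\<lambda>p. snd p * fst p i) \<in> measurable (std_gauss n \<Otimes>\<^sub>M half_line_measure \<beta> l) lborel"
    by simp
qed

theorem cauchy_measure_mixture:
  assumes "\<beta> > 0"
  shows "cauchy_measure \<beta> n =
    distr (std_gauss n \<Otimes>\<^sub>M half_line_measure \<beta> 1) (PiM {..<n} (\<lambda>_. lborel)) (\<lambda>(z, a). \<lambda>i\<in>{..<n}. a * z i)"
proof (rule measure_eqI)
  let ?H = "half_line_measure \<beta> 1" and ?L = "PiM {..<n} (\<lambda>_. lborel :: real measure)"
  interpret G: prob_space "std_gauss n" by (rule prob_space_std_gauss)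
  interpret H: prob_space ?H using assms by (intro prob_space_half_line) auto
  interpret P: pair_sigma_finite "std_gauss n" ?H ..
  interpret L: finite_product_sigma_finite "\<lambda>_. lborel :: real measure" "{..<n}" by standard simp
  interpret LL: pair_sigma_finite ?L lborel ..
  show "sets (cauchy_measure \<beta> n) = sets (distr (std_gauss n \<Otimes>\<^sub>M ?H) ?L (\<lambda>(z, a). \<lambda>i\<in>{..<n}. a * z i))"
    by (simp add: cauchy_measure_def)
  fix A assume "A \<in> sets (cauchy_measure \<beta> n)"
  then have A [measurable]: "A \<in> sets ?L" by (simp add: cauchy_measure_def)
  define dens where "dens = (\<lambda>x. Gamma ((real n + \<beta>) / 2) / (pi powr (real n / 2) * Gamma (\<beta> / 2)) *
        (1 / (1 + (L2_set x {..<n})\<^sup>2) powr ((real n + \<beta>) / 2)))"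
  have dens0: "dens x \<ge> 0" for x using assms by (simp add: dens_def add_nonneg_pos Gamma_real_pos less_imp_le)
  have [measurable]: "(\<lambda>x. L2_set x {..<n}) \<in> borel_measurable ?L" unfolding L2_set_def by measurable
  define N where "N = (\<lambda>a x. \<Prod>i<n. normal_density 0 a (x i :: real))"
  have N0: "N a x \<ge> 0" for a x by (simp add: N_def prod_nonneg)
  have [measurable]: "(\<lambda>(x, a). N a x) \<in> borel_measurable (?L \<Otimes>\<^sub>M lborel)"
    unfolding N_def normal_density_def by measurable
  let ?K = "\<lambda>a x. ennreal (half_line_density \<beta> 1 a) * (indicator A x * ennreal (N a x)) * indicator {0..} a"
  have "emeasure (distr (std_gauss n \<Otimes>\<^sub>M ?H) ?L (\<lambda>(z, a). \<lambda>i\<in>{..<n}. a * z i)) A =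
    (\<integral>\<^sup>+ x. indicator A x \<partial>distr (std_gauss n \<Otimes>\<^sub>M ?H) ?L (\<lambda>(z, a). \<lambda>i\<in>{..<n}. a * z i))"
    by simp
  also have "\<dots> = (\<integral>\<^sup>+ p. indicator A (\<lambda>i\<in>{..<n}. snd p * fst p i) \<partial>(std_gauss n \<Otimes>\<^sub>M ?H))"
    by (subst nn_integral_distr[OF scale_measurable]) (auto simp: case_prod_beta)
  also have "\<dots> = (\<integral>\<^sup>+ a. \<integral>\<^sup>+ z. indicator A (\<lambda>i\<in>{..<n}. a * z i) \<partial>std_gauss n \<partial>?H)"
    using measurable_compose[OF scale_measurable borel_measurable_indicator[OF A]]
    by (subst P.nn_integral_snd[symmetric]) (auto simp: case_prod_beta)
  also have "\<dots> = (\<integral>\<^sup>+ a. (\<integral>\<^sup>+ x. indicator A x * ennreal (N a x) \<partial>?L) \<partial>?H)"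
  proof (rule nn_integral_cong_AE)
    \<comment> \<open>At a = 0 the law of a Z is a point mass and has no density (unless n = 0); the
      mixing law gives that scale no mass.\<close>
    have "AE a in ?H. a \<noteq> 0"
    proof -
      have "AE a in lborel. a \<noteq> (0::real)" by (rule AE_lborel_singleton)
      then have "AE a in restrict_space lborel {0..}. a \<noteq> (0::real)"
        by (subst AE_restrict_space_iff) auto
      then show ?thesis
        unfolding half_line_measure_def by (subst AE_density) (auto simp: measurable_restrict_space1)
    qed
    moreover have "AE a in ?H. a \<ge> 0" by (rule AE_I2) (simp add: space_half_line_measure)
    ultimately show "AE a in ?H. (\<integral>\<^sup>+ z. indicator A (\<lambda>i\<in>{..<n}. a * z i) \<partial>std_gauss n) = (\<integral>\<^sup>+ x. indicator A x * ennreal (N a x) \<partial>?L)"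
    proof eventually_elim
      case (elim a)
      then show ?case unfolding N_def by (intro PiM_std_normal_scale) auto
    qed
  qed
  also have "\<dots> = (\<integral>\<^sup>+ a. ennreal (half_line_density \<beta> 1 a) * (\<integral>\<^sup>+ x. indicator A x * ennreal (N a x) \<partial>?L) * indicator {0..} a \<partial>lborel)"
    by (rule nn_integral_half_line) measurable
  also have "\<dots> = (\<integral>\<^sup>+ a. (\<integral>\<^sup>+ x. ?K a x \<partial>?L) \<partial>lborel)"
    by (intro nn_integral_cong) (simp add: nn_integral_cmult nn_integral_multc)
  also have "\<dots> = (\<integral>\<^sup>+ x. (\<integral>\<^sup>+ a. ?K a x \<partial>lborel) \<partial>?L)"
    by (rule LL.Fubini') measurable
  also have "\<dots> = (\<integral>\<^sup>+ x. ennreal (dens x) * indicator A x \<partial>?L)"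
  proof (rule nn_integral_cong)
    fix x
    define l where "l = sqrt (1 + (L2_set x {..<n})\<^sup>2)"
    have l: "l > 0" by (simp add: l_def add_pos_nonneg)
    have "(\<integral>\<^sup>+ a. ?K a x \<partial>lborel) = (\<integral>\<^sup>+ a. (ennreal (dens x) * indicator A x) * (ennreal (half_line_density (real n + \<beta>) l a) * indicator {0..} a) \<partial>lborel)"
    proof (rule nn_integral_cong_AE)
      have "AE a in lborel. a \<noteq> (0::real)" by (rule AE_lborel_singleton)
      then show "AE a in lborel. ?K a x = (ennreal (dens x) * indicator A x) * (ennreal (half_line_density (real n + \<beta>) l a) * indicator {0..} a)"
      proof eventually_elim
        case (elim a)
        show ?case
        proof (cases "a > 0")
          case True
          have "half_line_density \<beta> 1 a * N a x = dens x * half_line_density (real n + \<beta>) l a"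
            unfolding N_def dens_def l_def by (rule half_line_density_mixture[OF assms True])
          then have "ennreal (half_line_density \<beta> 1 a) * ennreal (N a x) = ennreal (dens x) * ennreal (half_line_density (real n + \<beta>) l a)"
            using N0 dens0 by (metis ennreal_mult' ennreal_mult'')
          then show ?thesis by (simp add: mult_ac)
        qed (use elim in auto)
      qed
    qed
    also have "\<dots> = ennreal (dens x) * indicator A x"
      using assms l by (subst nn_integral_cmult) (auto simp: nn_integral_half_line_density add_nonneg_pos)
    finally show "(\<integral>\<^sup>+ a. ?K a x \<partial>lborel) = ennreal (dens x) * indicator A x" .
  qed
  also have "\<dots> = emeasure (cauchy_measure \<beta> n) A"
    unfolding cauchy_measure_def dens_def[symmetric]
    by (subst emeasure_density) (auto simp: dens_def)
  finally show "emeasure (cauchy_measure \<beta> n) A =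
    emeasure (distr (std_gauss n \<Otimes>\<^sub>M ?H) ?L (\<lambda>(z, a). \<lambda>i\<in>{..<n}. a * z i)) A" ..
qed

text \<open>Lets one mixing variable \<open>a\<close> of scale 1 serve every limit \<open>l\<close>:
  the half line point is \<open>l * a\<close>.\<close>

lemma half_line_measure_scale:
  assumes l: "l > 0"
  shows "distr (half_line_measure \<beta> 1) (half_line_measure \<beta> l) (\<lambda>a. l * a) = half_line_measure \<beta> l"
proof (rule measure_eqI)
  have m: "(\<lambda>a. l * a) \<in> measurable (half_line_measure \<beta> 1) (half_line_measure \<beta> l)"
    unfolding measurable_cong_sets[OF sets_half_line_measure sets_half_line_measure]
    using l by (intro measurable_restrict_space3) auto
  fix A assume "A \<in> sets (distr (half_line_measure \<beta> 1) (half_line_measure \<beta> l) (\<lambda>a. l * a))"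
  then have A: "A \<in> sets (half_line_measure \<beta> l)" by simp
  then have Ab [measurable]: "A \<in> sets borel" and A0: "A \<subseteq> {0..}"
    unfolding sets_half_line_measure by (auto simp: sets_restrict_space_iff)
  have "emeasure (half_line_measure \<beta> l) A = (\<integral>\<^sup>+ t. indicator A t \<partial>half_line_measure \<beta> l)"
    using A by simp
  also have "\<dots> = (\<integral>\<^sup>+ t. ennreal (half_line_density \<beta> l t) * indicator A t * indicator {0..} t \<partial>lborel)"
    by (rule nn_integral_half_line) measurable
  also have "\<dots> = ennreal l * (\<integral>\<^sup>+ t. ennreal (half_line_density \<beta> l (l * t)) * indicator A (l * t) * indicator {0..} (l * t) \<partial>lborel)"
    using l by (subst nn_integral_real_affine[where c = l and t = 0]) auto
  also have "\<dots> = (\<integral>\<^sup>+ t. ennreal l * (ennreal (half_line_density \<beta> l (l * t)) * indicator A (l * t) * indicator {0..} (l * t)) \<partial>lborel)"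
    by (rule nn_integral_cmult[symmetric]) measurable
  also have "\<dots> = (\<integral>\<^sup>+ t. ennreal (half_line_density \<beta> 1 t) * indicator A (l * t) * indicator {0..} t \<partial>lborel)"
  proof (rule nn_integral_cong)
    fix t :: real
    show "ennreal l * (ennreal (half_line_density \<beta> l (l * t)) * indicator A (l * t) * indicator {0..} (l * t)) =
      ennreal (half_line_density \<beta> 1 t) * indicator A (l * t) * indicator {0..} t"
    proof (cases "t \<ge> 0")
      case True
      have "l * half_line_density \<beta> l (l * t) = half_line_density \<beta> 1 t"
      proof -
        have "(l * t) powr (\<beta> + 1) = l powr \<beta> * l * t powr (\<beta> + 1)"
          using l True by (simp add: powr_mult powr_add)
        moreover have "l powr \<beta> > 0" using l by simp
        ultimately show ?thesis using l by (simp add: half_line_density_def power_mult_distrib)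
      qed
      then have "ennreal l * ennreal (half_line_density \<beta> l (l * t)) = ennreal (half_line_density \<beta> 1 t)"
        using l by (simp flip: ennreal_mult')
      then show ?thesis using l True by (simp add: zero_le_mult_iff flip: mult.assoc)
    qed (use l in \<open>simp add: zero_le_mult_iff\<close>)
  qed
  also have "\<dots> = (\<integral>\<^sup>+ t. indicator A (l * t) \<partial>half_line_measure \<beta> 1)"
    by (rule nn_integral_half_line[symmetric]) measurable
  also have "\<dots> = emeasure (distr (half_line_measure \<beta> 1) (half_line_measure \<beta> l) (\<lambda>a. l * a)) A"
    using A by (subst nn_integral_distr[OF m, symmetric]) auto
  finally show "emeasure (distr (half_line_measure \<beta> 1) (half_line_measure \<beta> l) (\<lambda>a. l * a)) A = emeasure (half_line_measure \<beta> l) A" ..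
qed simp

section \<open>Deviation estimates\<close>

definition scale_vec :: "nat \<Rightarrow> real \<Rightarrow> (nat \<Rightarrow> real) \<Rightarrow> nat \<Rightarrow> real" where
  "scale_vec n a z = (\<lambda>i\<in>{..<n}. a * z i)"

lemma scale_vec_extensional [simp]: "scale_vec n a z \<in> extensional {..<n}"
  by (simp add: scale_vec_def)

lemma L2_set_scale: "L2_set (\<lambda>i. a * z i) {..<n} = \<bar>a\<bar> * L2_set z {..<n}"
  by (simp add: L2_set_def power_mult_distrib real_sqrt_mult flip: sum_distrib_left)

lemma L2_set_scale_vec: "L2_set (scale_vec n a z) {..<n} = \<bar>a\<bar> * L2_set z {..<n}"
proof -
  have "L2_set (scale_vec n a z) {..<n} = L2_set (\<lambda>i. a * z i) {..<n}"
    by (intro L2_set_cong) (auto simp: scale_vec_def)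
  then show ?thesis by (simp add: L2_set_scale)
qed

lemma L2_set_scale_vec_diff:
  "L2_set (\<lambda>i. scale_vec n a z i - scale_vec n a' z i) {..<n} = \<bar>a - a'\<bar> * L2_set z {..<n}"
  "L2_set (\<lambda>i. scale_vec n a z i - scale_vec n a z' i) {..<n} = \<bar>a\<bar> * L2_set (\<lambda>i. z i - z' i) {..<n}"
proof -
  have "L2_set (\<lambda>i. scale_vec n a z i - scale_vec n a' z i) {..<n} = L2_set (\<lambda>i. (a - a') * z i) {..<n}"
    "L2_set (\<lambda>i. scale_vec n a z i - scale_vec n a z' i) {..<n} = L2_set (\<lambda>i. a * (z i - z' i)) {..<n}"
    by (intro L2_set_cong; simp add: scale_vec_def algebra_simps)+
  then show "L2_set (\<lambda>i. scale_vec n a z i - scale_vec n a' z i) {..<n} = \<bar>a - a'\<bar> * L2_set z {..<n}"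
    "L2_set (\<lambda>i. scale_vec n a z i - scale_vec n a z' i) {..<n} = \<bar>a\<bar> * L2_set (\<lambda>i. z i - z' i) {..<n}"
    by (simp_all add: L2_set_scale)
qed

lemma euclid_lipschitz_scale:
  assumes F: "euclid_lipschitz n L F"
  shows "euclid_lipschitz n (L * \<bar>a\<bar>) (\<lambda>z. F (scale_vec n a z))"
  unfolding euclid_lipschitz_def
proof (intro conjI ballI)
  show "0 \<le> L * \<bar>a\<bar>" using F unfolding euclid_lipschitz_def by simp
  fix x y :: "nat \<Rightarrow> real"
  have "\<bar>F (scale_vec n a x) - F (scale_vec n a y)\<bar> \<le> L * L2_set (\<lambda>i. scale_vec n a x i - scale_vec n a y i) {..<n}"
    by (rule euclid_lipschitzD[OF F]) simp_all
  then show "\<bar>F (scale_vec n a x) - F (scale_vec n a y)\<bar> \<le> L * \<bar>a\<bar> * L2_set (\<lambda>i. x i - y i) {..<n}"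
    unfolding L2_set_scale_vec_diff by simp
qed

definition gauss_mean :: "nat \<Rightarrow> ((nat \<Rightarrow> real) \<Rightarrow> real) \<Rightarrow> real \<Rightarrow> real" where
  "gauss_mean n F b = (\<integral>z. F (scale_vec n b z) \<partial>std_gauss n)"

text \<open>Under the same \<open>z\<close> the two scaled vectors differ by |a - b| |z|, and the
  mean of |z| is at most sqrt n. With L = r this constant makes t ->
  \<open>gauss_mean n F (t / (r * sqrt (real n)))\<close> exactly 1-Lipschitz, with no error term to
  correct later.\<close>

lemma gauss_mean_lipschitz:
  assumes F: "euclid_lipschitz n L F"
  shows "\<bar>gauss_mean n F a - gauss_mean n F b\<bar> \<le> L * \<bar>a - b\<bar> * sqrt (real n)"
proof -
  have L: "L \<ge> 0" using F unfolding euclid_lipschitz_def by simp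
  note int = euclid_lipschitz_square_integrable(2)[OF euclid_lipschitz_scale[OF F]]
  have "\<bar>gauss_mean n F a - gauss_mean n F b\<bar> = \<bar>\<integral>z. F (scale_vec n a z) - F (scale_vec n b z) \<partial>std_gauss n\<bar>"
    unfolding gauss_mean_def using int by simp
  also have "\<dots> \<le> (\<integral>z. L * \<bar>a - b\<bar> * L2_set z {..<n} \<partial>std_gauss n)"
  proof (rule order_trans[OF integral_abs_bound integral_mono])
    show "integrable (std_gauss n) (\<lambda>z. \<bar>F (scale_vec n a z) - F (scale_vec n b z)\<bar>)"
      using int by simp
    show "integrable (std_gauss n) (\<lambda>z. L * \<bar>a - b\<bar> * L2_set z {..<n})"
      using euclid_lipschitz_square_integrable(2)[OF euclid_lipschitz_norm] by simp
    fix z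
    have "\<bar>F (scale_vec n a z) - F (scale_vec n b z)\<bar> \<le> L * L2_set (\<lambda>i. scale_vec n a z i - scale_vec n b z i) {..<n}"
      by (rule euclid_lipschitzD[OF F]) simp_all
    then show "\<bar>F (scale_vec n a z) - F (scale_vec n b z)\<bar> \<le> L * \<bar>a - b\<bar> * L2_set z {..<n}"
      unfolding L2_set_scale_vec_diff by simp
  qed
  also have "\<dots> \<le> L * \<bar>a - b\<bar> * sqrt (real n)"
    using gauss_norm_concentration(1) L by (simp add: mult_left_mono)
  finally show ?thesis .
qed

text \<open>The centre is free because the centres used below are in general not the means of the
  variables.\<close>

lemma (in prob_space) chebyshev_about:
  fixes X :: "'a \<Rightarrow> real"
  assumes X: "X \<in> borel_measurable M" "integrable M (\<lambda>x. (X x - c)\<^sup>2)" and e: "\<epsilon> > 0"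
    and le: "expectation (\<lambda>x. (X x - c)\<^sup>2) \<le> K"
  shows "emeasure M {x \<in> space M. \<epsilon> < \<bar>X x - c\<bar>} \<le> ennreal (K / \<epsilon>\<^sup>2)"
proof -
  note [measurable] = X(1)
  have "emeasure M {x \<in> space M. \<epsilon> < \<bar>X x - c\<bar>} = (\<integral>\<^sup>+ x. indicator {x \<in> space M. \<epsilon> < \<bar>X x - c\<bar>} x \<partial>M)"
    by simp
  also have "\<dots> \<le> (\<integral>\<^sup>+ x. ennreal ((X x - c)\<^sup>2 / \<epsilon>\<^sup>2) \<partial>M)"
  proof (rule nn_integral_mono)
    fix x
    have "1 \<le> ennreal ((X x - c)\<^sup>2 / \<epsilon>\<^sup>2)" if "\<epsilon> < \<bar>X x - c\<bar>"
    proof -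
      have "\<epsilon>\<^sup>2 \<le> \<bar>X x - c\<bar>\<^sup>2" using that e by (intro power_mono) auto
      then have "1 \<le> (X x - c)\<^sup>2 / \<epsilon>\<^sup>2" using e by simp
      then show ?thesis using ennreal_leI[of 1] by simp
    qed
    then show "indicator {x \<in> space M. \<epsilon> < \<bar>X x - c\<bar>} x \<le> ennreal ((X x - c)\<^sup>2 / \<epsilon>\<^sup>2)"
      by (auto simp: indicator_def)
  qed
  also have "\<dots> = ennreal (expectation (\<lambda>x. (X x - c)\<^sup>2) / \<epsilon>\<^sup>2)"
    using X(2) by (subst nn_integral_eq_integral) auto
  also have "\<dots> \<le> ennreal (K / \<epsilon>\<^sup>2)"
    using le by (intro ennreal_leI divide_right_mono) auto
  finally show ?thesis .
qed

text \<open>Splits r |z| - l into r (|z| - sqrt n) and r sqrt n - l and uses (u + v)^2 \<le> 2 u^2 +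
  2 v^2; 12 is twice the bound 6 of \<open>gauss_norm_concentration\<close>.\<close>

lemma gauss_norm_deviation:
  assumes "\<epsilon> > 0" "\<bar>a\<bar> \<le> R"
  shows "emeasure (std_gauss n) {z \<in> space (std_gauss n). \<epsilon> < \<bar>a * (r * L2_set z {..<n} - l)\<bar>}
    \<le> ennreal (R\<^sup>2 * (12 * r\<^sup>2 + 2 * (r * sqrt (real n) - l)\<^sup>2) / \<epsilon>\<^sup>2)"
proof -
  interpret prob_space "std_gauss n" by (rule prob_space_std_gauss)
  let ?N = "\<lambda>z::nat \<Rightarrow> real. L2_set z {..<n}"
  let ?X = "\<lambda>z. a * (r * ?N z - l)"
  have m [measurable]: "?N \<in> borel_measurable (std_gauss n)"
    by (rule euclid_lipschitz_measurable_gauss[OF euclid_lipschitz_norm])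
  note int = euclid_lipschitz_square_integrable[OF euclid_lipschitz_norm[of n]]
  have i1: "integrable (std_gauss n) (\<lambda>z. (?X z - 0)\<^sup>2)"
    using int by (simp add: power_mult_distrib power2_diff)
  have i2: "integrable (std_gauss n) (\<lambda>z. (?N z - sqrt (real n))\<^sup>2)"
    using int by (simp add: power2_diff)
  have R: "a\<^sup>2 \<le> R\<^sup>2" using assms(2) by (metis abs_le_square_iff abs_of_nonneg abs_ge_zero order_trans)
  have "expectation (\<lambda>z. (?X z - 0)\<^sup>2) \<le>
    expectation (\<lambda>z. R\<^sup>2 * (2 * r\<^sup>2 * (?N z - sqrt (real n))\<^sup>2 + 2 * (r * sqrt (real n) - l)\<^sup>2))"
  proof (rule integral_mono[OF i1])
    show "integrable (std_gauss n) (\<lambda>z. R\<^sup>2 * (2 * r\<^sup>2 * (?N z - sqrt (real n))\<^sup>2 + 2 * (r * sqrt (real n) - l)\<^sup>2))"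
      using i2 by simp
    fix z
    have "(u + v)\<^sup>2 \<le> 2 * u\<^sup>2 + 2 * v\<^sup>2" for u v :: real
      using zero_le_power2[of "u - v"] by (simp add: power2_sum power2_diff)
    from this[of "r * (?N z - sqrt (real n))" "r * sqrt (real n) - l"]
    have "(r * (?N z - sqrt (real n)) + (r * sqrt (real n) - l))\<^sup>2 \<le>
        2 * r\<^sup>2 * (?N z - sqrt (real n))\<^sup>2 + 2 * (r * sqrt (real n) - l)\<^sup>2"
      unfolding power_mult_distrib by (simp only: mult.assoc)
    moreover have "r * (?N z - sqrt (real n)) + (r * sqrt (real n) - l) = r * ?N z - l"
      by (simp add: right_diff_distrib)
    ultimately have "(r * ?N z - l)\<^sup>2 \<le> 2 * r\<^sup>2 * (?N z - sqrt (real n))\<^sup>2 + 2 * (r * sqrt (real n) - l)\<^sup>2"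
      by (simp only:)
    then show "(?X z - 0)\<^sup>2 \<le> R\<^sup>2 * (2 * r\<^sup>2 * (?N z - sqrt (real n))\<^sup>2 + 2 * (r * sqrt (real n) - l)\<^sup>2)"
      unfolding diff_0_right power_mult_distrib using R by (intro mult_mono) auto
  qed
  also have "\<dots> = R\<^sup>2 * (2 * r\<^sup>2 * expectation (\<lambda>z. (?N z - sqrt (real n))\<^sup>2) + 2 * (r * sqrt (real n) - l)\<^sup>2)"
    using i2 by (simp add: prob_space)
  also have "\<dots> \<le> R\<^sup>2 * (2 * r\<^sup>2 * 6 + 2 * (r * sqrt (real n) - l)\<^sup>2)"
    using gauss_norm_concentration(2) by (intro mult_left_mono add_right_mono) auto
  finally have "expectation (\<lambda>z. (?X z - 0)\<^sup>2) \<le> R\<^sup>2 * (12 * r\<^sup>2 + 2 * (r * sqrt (real n) - l)\<^sup>2)" by simp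
  from chebyshev_about[OF _ i1 assms(1) this] show ?thesis by simp
qed

text \<open>The centre is the mean at the scale b with b r sqrt n = l a, not at \<open>a\<close>, so
  that it becomes a 1-Lipschitz function of the half line point \<open>l * a\<close>. The variance
  contributes 3 r^2 a^2 and the squared bias at most a^2 (r sqrt n - l)^2. The sum is enlarged to
  the bound of \<open>gauss_norm_deviation\<close>, so that one estimate serves both.\<close>

lemma gauss_lipschitz_deviation:
  assumes F: "euclid_lipschitz n r F" and "\<epsilon> > 0" "\<bar>a\<bar> \<le> R" "r > 0" "n > 0"
  shows "emeasure (std_gauss n) {z \<in> space (std_gauss n). \<epsilon> < \<bar>F (scale_vec n a z) - gauss_mean n F (l * a / (r * sqrt (real n)))\<bar>}
    \<le> ennreal (R\<^sup>2 * (12 * r\<^sup>2 + 2 * (r * sqrt (real n) - l)\<^sup>2) / \<epsilon>\<^sup>2)"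
proof -
  interpret prob_space "std_gauss n" by (rule prob_space_std_gauss)
  let ?X = "\<lambda>z. F (scale_vec n a z)"
  define b where "b = l * a / (r * sqrt (real n))"
  define c where "c = gauss_mean n F b"
  note FX = euclid_lipschitz_scale[OF F, of a]
  note int = euclid_lipschitz_square_integrable[OF FX]
  have i1: "integrable (std_gauss n) (\<lambda>z. (?X z - c)\<^sup>2)"
    using int by (simp add: power2_diff)
  have R: "a\<^sup>2 \<le> R\<^sup>2" using assms(3) by (metis abs_le_square_iff abs_of_nonneg abs_ge_zero order_trans)
  have m: "expectation ?X = gauss_mean n F a" by (simp add: gauss_mean_def)
  have "expectation (\<lambda>z. (?X z - c)\<^sup>2) = expectation (\<lambda>z. (?X z)\<^sup>2) - 2 * c * gauss_mean n F a + c\<^sup>2"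
    using int by (simp add: power2_diff prob_space mult_ac gauss_mean_def)
  also have "\<dots> = variance ?X + (gauss_mean n F a - c)\<^sup>2"
  proof -
    have "variance ?X = expectation (\<lambda>z. (?X z)\<^sup>2) - (gauss_mean n F a)\<^sup>2"
      by (rule trans[OF variance_eq[OF int(2,1)]]) (simp only: m)
    then show ?thesis by (simp only: power2_diff) (simp add: mult_ac)
  qed
  also have "\<dots> \<le> 3 * (r * \<bar>a\<bar>)\<^sup>2 + (r * \<bar>a - b\<bar> * sqrt (real n))\<^sup>2"
  proof (rule add_mono)
    show "variance ?X \<le> 3 * (r * \<bar>a\<bar>)\<^sup>2" by (rule gauss_poincare_lipschitz[OF FX])
    have "\<bar>gauss_mean n F a - c\<bar>\<^sup>2 \<le> (r * \<bar>a - b\<bar> * sqrt (real n))\<^sup>2"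
      unfolding c_def by (intro power_mono gauss_mean_lipschitz F) simp
    then show "(gauss_mean n F a - c)\<^sup>2 \<le> (r * \<bar>a - b\<bar> * sqrt (real n))\<^sup>2" by simp
  qed
  also have "r * \<bar>a - b\<bar> * sqrt (real n) = \<bar>a\<bar> * \<bar>r * sqrt (real n) - l\<bar>"
  proof -
    have p: "r * sqrt (real n) > 0" using assms by simp
    have "r * \<bar>a - b\<bar> * sqrt (real n) = \<bar>(a - b) * (r * sqrt (real n))\<bar>"
      using p assms(4) by (simp add: abs_mult)
    also have "(a - b) * (r * sqrt (real n)) = a * (r * sqrt (real n) - l)"
    proof -
      have "b * (r * sqrt (real n)) = l * a"
        using p by (metis b_def less_irrefl nonzero_eq_divide_eq)
      then show ?thesis by (simp only: left_diff_distrib right_diff_distrib mult.commute)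
    qed
    finally show ?thesis by (simp add: abs_mult)
  qed
  also have "3 * (r * \<bar>a\<bar>)\<^sup>2 + (\<bar>a\<bar> * \<bar>r * sqrt (real n) - l\<bar>)\<^sup>2 = a\<^sup>2 * (3 * r\<^sup>2 + (r * sqrt (real n) - l)\<^sup>2)"
    by (simp only: power_mult_distrib power2_abs) (simp add: algebra_simps)
  also have "\<dots> \<le> R\<^sup>2 * (12 * r\<^sup>2 + 2 * (r * sqrt (real n) - l)\<^sup>2)"
    using R by (intro mult_mono add_mono) auto
  finally have "expectation (\<lambda>z. (?X z - c)\<^sup>2) \<le> R\<^sup>2 * (12 * r\<^sup>2 + 2 * (r * sqrt (real n) - l)\<^sup>2)" .
  from chebyshev_about[OF euclid_lipschitz_measurable_gauss[OF FX] i1 assms(2) this]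
  show ?thesis unfolding c_def b_def .
qed

section \<open>Deviations under the joint law of Z and a\<close>

abbreviation mixing :: "real \<Rightarrow> nat \<Rightarrow> ((nat \<Rightarrow> real) \<times> real) measure" where
  "mixing \<beta> n \<equiv> std_gauss n \<Otimes>\<^sub>M half_line_measure \<beta> 1"

text \<open>Integrates over the fibres of constant \<open>a\<close>: the Gaussian bound
  \<open>c\<close> where a \<le> R, the trivial bound 1 where a > R. No moment of \<open>a\<close>
  enters.\<close>

lemma measure_mixing_le:
  assumes "\<beta> > 0" and Q [measurable]: "Q \<in> sets (mixing \<beta> n)" and c: "c \<ge> 0"
    and le: "\<And>a. 0 \<le> a \<Longrightarrow> a \<le> R \<Longrightarrow> emeasure (std_gauss n) {z \<in> space (std_gauss n). (z, a) \<in> Q} \<le> ennreal c"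
  shows "measure (mixing \<beta> n) Q \<le> c + measure (half_line_measure \<beta> 1) {a \<in> space (half_line_measure \<beta> 1). R < a}"
proof -
  let ?H = "half_line_measure \<beta> 1"
  interpret G: prob_space "std_gauss n" by (rule prob_space_std_gauss)
  interpret H: prob_space ?H using assms by (intro prob_space_half_line) auto
  interpret P: pair_prob_space "std_gauss n" ?H ..
  note [measurable] = measurable_half_line
  have "emeasure (mixing \<beta> n) Q = (\<integral>\<^sup>+ a. emeasure (std_gauss n) ((\<lambda>z. (z, a)) -` Q) \<partial>?H)"
    by (rule P.emeasure_pair_measure_alt2[OF Q])
  also have "\<dots> \<le> (\<integral>\<^sup>+ a. ennreal c + indicator {a \<in> space ?H. R < a} a \<partial>?H)"
  proof (rule nn_integral_mono)
    fix a assume a: "a \<in> space ?H"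
    have eq: "(\<lambda>z. (z, a)) -` Q = {z \<in> space (std_gauss n). (z, a) \<in> Q}"
      using sets.sets_into_space[OF Q] by (auto simp: space_pair_measure)
    show "emeasure (std_gauss n) ((\<lambda>z. (z, a)) -` Q) \<le> ennreal c + indicator {a \<in> space ?H. R < a} a"
    proof (cases "a \<le> R")
      case True
      then show ?thesis unfolding eq using le[of a] a by (auto simp: space_half_line_measure intro: add_increasing2)
    next
      case False
      then have "indicator {a \<in> space ?H. R < a} a = (1 :: ennreal)" using a by simp
      then show ?thesis
        using G.emeasure_le_1[of "(\<lambda>z. (z, a)) -` Q"] by (auto intro: add_increasing)
    qed
  qed
  also have "\<dots> = ennreal c + emeasure ?H {a \<in> space ?H. R < a}"
    by (subst nn_integral_add) (auto simp: H.emeasure_space_1)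
  also have "\<dots> = ennreal (c + measure ?H {a \<in> space ?H. R < a})"
    using c by (simp add: H.emeasure_eq_measure)
  finally have "ennreal (P.prob Q) \<le> ennreal (c + H.prob {a \<in> space ?H. R < a})"
    by (simp only: P.emeasure_eq_measure)
  then show ?thesis using c by (subst (asm) ennreal_le_iff) auto
qed

text \<open>The mixing law moved from the half line to the whole real line, where distribution
  functions are available.\<close>

abbreviation half_line_dist :: "real \<Rightarrow> real measure" where
  "half_line_dist \<beta> \<equiv> distr (half_line_measure \<beta> 1) borel (\<lambda>a. a)"

lemma real_distribution_half_line:
  assumes "\<beta> > 0"
  shows "real_distribution (half_line_dist \<beta>)"
proof -
  interpret H: prob_space "half_line_measure \<beta> 1" using assms by (intro prob_space_half_line) auto
  show ?thesis
    using H.prob_space_distr[OF measurable_half_line]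
    by (auto intro!: real_distribution.intro simp: real_distribution_axioms_def)
qed

lemma measure_half_line_dist:
  assumes "A \<in> sets borel"
  shows "measure (half_line_dist \<beta>) A = measure (half_line_measure \<beta> 1) {a \<in> space (half_line_measure \<beta> 1). a \<in> A}"
  using assms by (subst measure_distr[OF measurable_half_line]) (simp_all add: vimage_def Int_def conj_commute)

lemma half_line_tail:
  assumes "\<beta> > 0" "\<epsilon> > 0"
  obtains R where "R \<ge> 0" "measure (half_line_measure \<beta> 1) {a \<in> space (half_line_measure \<beta> 1). R < a} \<le> \<epsilon>"
proof -
  interpret D: real_distribution "half_line_dist \<beta>" by (rule real_distribution_half_line) fact
  have "\<forall>\<^sub>F x in at_top. cdf (half_line_dist \<beta>) x > 1 - \<epsilon> \<and> x \<ge> 0"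
    using order_tendstoD(1)[OF D.cdf_lim_at_top_prob, of "1 - \<epsilon>"] assms
    by (auto intro: eventually_conj eventually_ge_at_top)
  then obtain R where R: "cdf (half_line_dist \<beta>) R > 1 - \<epsilon>" "R \<ge> 0"
    using eventually_happens'[OF trivial_limit_at_top_linorder] by blast
  have "measure (half_line_dist \<beta>) {R<..} = 1 - cdf (half_line_dist \<beta>) R"
    unfolding cdf_def using D.prob_compl[of "{..R}"] by (simp add: Compl_eq_Diff_UNIV[symmetric] Compl_atMost)
  then have "measure (half_line_dist \<beta>) {R<..} \<le> \<epsilon>" using R by simp
  then have "measure (half_line_measure \<beta> 1) {a \<in> space (half_line_measure \<beta> 1). R < a} \<le> \<epsilon>"
    by (simp add: measure_half_line_dist)
  then show thesis by (rule that[OF R(2)])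
qed

text \<open>Makes the distribution function continuous, so that \<open>separated_intervals\<close>
  can reach every level strictly between 0 and 1.\<close>

lemma half_line_no_atoms: "measure (half_line_dist \<beta>) {x} = 0"
proof -
  have "AE a in lborel. a \<noteq> x" by (rule AE_lborel_singleton)
  then have "AE a in restrict_space lborel {0..}. a \<noteq> x"
    by (subst AE_restrict_space_iff) auto
  then have "AE a in half_line_measure \<beta> 1. a \<noteq> x"
    unfolding half_line_measure_def by (subst AE_density) (auto simp: measurable_restrict_space1)
  moreover have "{a \<in> space (half_line_measure \<beta> 1). \<not> a \<noteq> x} \<in> sets (half_line_measure \<beta> 1)"
    using measurable_half_line[of \<beta> 1] by measurable
  ultimately have "emeasure (half_line_measure \<beta> 1) {a \<in> space (half_line_measure \<beta> 1). \<not> a \<noteq> x} = 0"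
    by (subst (asm) AE_iff_measurable) auto
  then show ?thesis by (subst measure_half_line_dist) (auto simp: measure_def)
qed

lemma gauss_mean_measurable:
  assumes F: "euclid_lipschitz n L F"
  shows "gauss_mean n F \<in> borel_measurable borel"
proof (rule borel_measurable_continuous_onI)
  have L: "L \<ge> 0" using F unfolding euclid_lipschitz_def by simp
  have "(L * sqrt (real n))-lipschitz_on UNIV (gauss_mean n F)"
    using gauss_mean_lipschitz[OF F] L by (intro lipschitz_onI) (auto simp: dist_real_def mult_ac)
  then show "continuous_on UNIV (gauss_mean n F)" by (rule lipschitz_on_continuous_on)
qed

lemma scale_vec_measurable:
  "(\<lambda>p. scale_vec n (snd p) (fst p)) \<in> measurable (mixing \<beta> n) (PiM {..<n} (\<lambda>_. lborel))"
  using scale_measurable[of n \<beta> 1] by (simp add: case_prod_beta' scale_vec_def)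

lemma sets_PiM_lborel: "sets (PiM I (\<lambda>_. lborel)) = sets (PiM I (\<lambda>_. borel))"
  by (intro sets_PiM_cong) auto

lemma snd_mixing_measurable: "snd \<in> borel_measurable (mixing \<beta> n)"
  by (rule measurable_compose[OF measurable_snd measurable_half_line])

lemma norm_mixing_measurable: "(\<lambda>p. L2_set (fst p) {..<n}) \<in> borel_measurable (mixing \<beta> n)"
  by (rule measurable_compose[OF measurable_fst euclid_lipschitz_measurable_gauss[OF euclid_lipschitz_norm]])

lemma norm_deviation_sets:
  "{p \<in> space (mixing \<beta> n). \<epsilon> < \<bar>snd p * (r * L2_set (fst p) {..<n} - l)\<bar>} \<in> sets (mixing \<beta> n)"
proof -
  note [measurable] = snd_mixing_measurable norm_mixing_measurable
  show ?thesis by measurable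
qed

lemma lipschitz_deviation_sets:
  assumes F: "euclid_lipschitz n L F"
  shows "{p \<in> space (mixing \<beta> n). \<epsilon> < \<bar>F (scale_vec n (snd p) (fst p)) - gauss_mean n F (l * snd p / c)\<bar>}
    \<in> sets (mixing \<beta> n)"
proof -
  note [measurable] = snd_mixing_measurable gauss_mean_measurable[OF F]
  have "F \<in> borel_measurable (PiM {..<n} (\<lambda>_. lborel))"
    using euclid_lipschitz_measurable[OF F] unfolding measurable_cong_sets[OF sets_PiM_lborel refl] .
  from measurable_compose[OF scale_vec_measurable this]
  have [measurable]: "(\<lambda>p. F (scale_vec n (snd p) (fst p))) \<in> borel_measurable (mixing \<beta> n)" .
  show ?thesis by measurable
qed

text \<open>The threshold for \<open>n\<close> must not depend on F, since the Hausdorff distance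
  takes a supremum over all Lipschitz functions. The bound \<open>\<delta> n\<close> involves only
  \<open>R\<close>, \<open>r n\<close>, \<open>l\<close> and \<epsilon>.\<close>

lemma mixing_deviation:
  assumes \<beta>: "\<beta> > 0" and r: "\<And>n. n \<ge> 1 \<Longrightarrow> r n > 0"
    and lim: "(\<lambda>n. r n * sqrt (real n)) \<longlonglongrightarrow> l" and \<epsilon>: "\<epsilon> > 0"
  shows "\<forall>\<^sub>F n in sequentially.
    measure (mixing \<beta> n) {p \<in> space (mixing \<beta> n). \<epsilon> < \<bar>snd p * (r n * L2_set (fst p) {..<n} - l)\<bar>} \<le> \<epsilon> \<and>
    (\<forall>F. euclid_lipschitz n (r n) F \<longrightarrow>
      measure (mixing \<beta> n) {p \<in> space (mixing \<beta> n).
        \<epsilon> < \<bar>F (scale_vec n (snd p) (fst p)) - gauss_mean n F (l * snd p / (r n * sqrt (real n)))\<bar>} \<le> \<epsilon>)"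
proof -
  \<comment> \<open>Half of \<epsilon> pays for the tail; with \<open>R\<close> fixed, the
    conditional bound \<open>\<delta> n\<close> gets the other half.\<close>
  obtain R where R: "R \<ge> 0" "measure (half_line_measure \<beta> 1) {a \<in> space (half_line_measure \<beta> 1). R < a} \<le> \<epsilon> / 2"
    using half_line_tail[OF \<beta>, of "\<epsilon> / 2"] \<epsilon> by auto
  define \<delta> where "\<delta> = (\<lambda>n. R\<^sup>2 * (12 * (r n)\<^sup>2 + 2 * (r n * sqrt (real n) - l)\<^sup>2) / \<epsilon>\<^sup>2)"
  \<comment> \<open>\<open>r n\<close> tends to 0, being a convergent sequence divided by sqrt n;
    cancelling sqrt n requires n \<ge> 1.\<close>
  have "(\<lambda>n. 1 / sqrt (real n)) \<longlonglongrightarrow> 0" by real_asymp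
  from tendsto_mult[OF lim this] have "(\<lambda>n. r n * sqrt (real n) * (1 / sqrt (real n))) \<longlonglongrightarrow> 0" by simp
  moreover have "\<forall>\<^sub>F n in sequentially. r n * sqrt (real n) * (1 / sqrt (real n)) = r n"
    using eventually_ge_at_top[of 1] by eventually_elim simp
  ultimately have r0: "r \<longlonglongrightarrow> 0" by (rule Lim_transform_eventually)
  have "\<delta> \<longlonglongrightarrow> R\<^sup>2 * (12 * 0\<^sup>2 + 2 * (l - l)\<^sup>2) / \<epsilon>\<^sup>2"
    unfolding \<delta>_def using \<epsilon> by (intro tendsto_intros r0 lim) simp
  then have "\<forall>\<^sub>F n in sequentially. \<delta> n < \<epsilon> / 2"
    using \<epsilon> by (intro order_tendstoD(2)) auto
  then show ?thesis
    using eventually_ge_at_top[of 1]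
  proof eventually_elim
    case (elim n)
    have le: "ennreal (\<delta> n) \<le> ennreal (\<epsilon> / 2)" using elim by (intro ennreal_leI) simp
    have "measure (mixing \<beta> n) {p \<in> space (mixing \<beta> n). \<epsilon> < \<bar>snd p * (r n * L2_set (fst p) {..<n} - l)\<bar>}
      \<le> \<epsilon> / 2 + measure (half_line_measure \<beta> 1) {a \<in> space (half_line_measure \<beta> 1). R < a}"
    proof (rule measure_mixing_le[OF \<beta> norm_deviation_sets])
      fix a :: real assume a: "0 \<le> a" "a \<le> R"
      have "{z \<in> space (std_gauss n). (z, a) \<in> {p \<in> space (mixing \<beta> n). \<epsilon> < \<bar>snd p * (r n * L2_set (fst p) {..<n} - l)\<bar>}}
        = {z \<in> space (std_gauss n). \<epsilon> < \<bar>a * (r n * L2_set z {..<n} - l)\<bar>}"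
        using a by (auto simp: space_pair_measure space_half_line_measure)
      also have "emeasure (std_gauss n) \<dots> \<le> ennreal (\<delta> n)"
        unfolding \<delta>_def using a by (intro gauss_norm_deviation \<epsilon>) simp
      also note le
      finally show "emeasure (std_gauss n) {z \<in> space (std_gauss n).
          (z, a) \<in> {p \<in> space (mixing \<beta> n). \<epsilon> < \<bar>snd p * (r n * L2_set (fst p) {..<n} - l)\<bar>}} \<le> ennreal (\<epsilon> / 2)" .
    qed (use \<epsilon> in simp)
    moreover have "measure (mixing \<beta> n) {p \<in> space (mixing \<beta> n).
        \<epsilon> < \<bar>F (scale_vec n (snd p) (fst p)) - gauss_mean n F (l * snd p / (r n * sqrt (real n)))\<bar>}
      \<le> \<epsilon> / 2 + measure (half_line_measure \<beta> 1) {a \<in> space (half_line_measure \<beta> 1). R < a}"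
      if F: "euclid_lipschitz n (r n) F" for F
    proof (rule measure_mixing_le[OF \<beta> lipschitz_deviation_sets[OF F]])
      fix a :: real assume a: "0 \<le> a" "a \<le> R"
      have "{z \<in> space (std_gauss n). (z, a) \<in> {p \<in> space (mixing \<beta> n).
          \<epsilon> < \<bar>F (scale_vec n (snd p) (fst p)) - gauss_mean n F (l * snd p / (r n * sqrt (real n)))\<bar>}}
        = {z \<in> space (std_gauss n). \<epsilon> < \<bar>F (scale_vec n a z) - gauss_mean n F (l * a / (r n * sqrt (real n)))\<bar>}"
        using a by (auto simp: space_pair_measure space_half_line_measure)
      also have "emeasure (std_gauss n) \<dots> \<le> ennreal (\<delta> n)"
        unfolding \<delta>_def using a elim r by (intro gauss_lipschitz_deviation F \<epsilon>) auto
      also note le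
      finally show "emeasure (std_gauss n) {z \<in> space (std_gauss n). (z, a) \<in> {p \<in> space (mixing \<beta> n).
          \<epsilon> < \<bar>F (scale_vec n (snd p) (fst p)) - gauss_mean n F (l * snd p / (r n * sqrt (real n)))\<bar>}} \<le> ennreal (\<epsilon> / 2)" .
    qed (use \<epsilon> in simp)
    ultimately show ?case using R(2) by force
  qed
qed

section \<open>Coupled parameters of the Cauchy space and the half line\<close>

lemma mm_scale_cauchy_simps:
  "mm_meas (mm_scale r (cauchy_space \<beta> n)) = cauchy_measure \<beta> n"
  "mm_dist (mm_scale r (cauchy_space \<beta> n)) = (\<lambda>x y. r * L2_set (\<lambda>i. x i - y i) {..<n})"
  by (simp_all add: mm_scale_def cauchy_space_def)

lemma space_cauchy_measure: "space (cauchy_measure \<beta> n) = extensional {..<n}"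
  by (simp add: cauchy_measure_def space_PiM PiE_def)

lemma lip1_scale_cauchy:
  assumes "r \<ge> 0"
  shows "F \<in> lip1 (mm_scale r (cauchy_space \<beta> n)) \<longleftrightarrow> euclid_lipschitz n r F"
  using assms by (simp add: lip1_def euclid_lipschitz_def mm_scale_cauchy_simps space_cauchy_measure)

lemma cauchy_parameter:
  assumes \<beta>: "\<beta> > 0" and \<theta>: "\<theta> \<in> measurable unit_leb (mixing \<beta> n)" "distr unit_leb (mixing \<beta> n) \<theta> = mixing \<beta> n"
  shows "(\<lambda>s. scale_vec n (snd (\<theta> s)) (fst (\<theta> s))) \<in> parameters (mm_scale r (cauchy_space \<beta> n))"
proof -
  let ?S = "\<lambda>p. scale_vec n (snd p) (fst p)" and ?L = "PiM {..<n} (\<lambda>_. lborel :: real measure)"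
  have s: "sets (cauchy_measure \<beta> n) = sets ?L" by (simp add: cauchy_measure_def)
  have m: "(\<lambda>s. ?S (\<theta> s)) \<in> measurable unit_leb ?L"
    by (rule measurable_compose[OF \<theta>(1) scale_vec_measurable])
  have "distr unit_leb (cauchy_measure \<beta> n) (\<lambda>s. ?S (\<theta> s)) = distr unit_leb ?L (\<lambda>s. ?S (\<theta> s))"
    by (intro distr_cong s refl)
  also have "\<dots> = distr (distr unit_leb (mixing \<beta> n) \<theta>) ?L ?S"
    using \<theta>(1) scale_vec_measurable by (subst distr_distr) (auto simp: comp_def)
  also have "\<dots> = cauchy_measure \<beta> n"
    unfolding \<theta>(2) cauchy_measure_mixture[OF \<beta>] by (simp add: case_prod_beta' scale_vec_def)
  finally show ?thesis
    using m by (simp add: parameters_def mm_scale_cauchy_simps measurable_cong_sets[OF refl s])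
qed

text \<open>With the same \<open>\<theta>\<close> as in \<open>cauchy_parameter\<close>, both
  parameters share the component a at every point of the unit interval. This is the whole
  coupling.\<close>

lemma half_line_parameter:
  assumes \<beta>: "\<beta> > 0" "l > 0" and \<theta>: "\<theta> \<in> measurable unit_leb (mixing \<beta> n)" "distr unit_leb (mixing \<beta> n) \<theta> = mixing \<beta> n"
  shows "(\<lambda>s. l * snd (\<theta> s)) \<in> parameters (half_line_space \<beta> l)"
proof -
  let ?H = "half_line_measure \<beta> 1"
  interpret G: prob_space "std_gauss n" by (rule prob_space_std_gauss)
  interpret H: prob_space ?H using \<beta> by (intro prob_space_half_line) auto
  interpret P: pair_prob_space "std_gauss n" ?H ..
  have m: "(\<lambda>a. l * a) \<in> measurable ?H (half_line_measure \<beta> l)"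
    unfolding measurable_cong_sets[OF sets_half_line_measure sets_half_line_measure]
    using \<beta> by (intro measurable_restrict_space3) auto
  have sm: "(\<lambda>s. snd (\<theta> s)) \<in> measurable unit_leb ?H"
    by (rule measurable_compose[OF \<theta>(1) measurable_snd])
  have "distr unit_leb (half_line_measure \<beta> l) (\<lambda>s. l * snd (\<theta> s)) = distr (distr (distr unit_leb (mixing \<beta> n) \<theta>) ?H snd) (half_line_measure \<beta> l) (\<lambda>a. l * a)"
    using \<theta>(1) m sm by (simp add: distr_distr comp_def)
  also have "distr (distr unit_leb (mixing \<beta> n) \<theta>) ?H snd = ?H"
    unfolding \<theta>(2)
  proof (rule measure_eqI)
    fix A assume "A \<in> sets (distr (mixing \<beta> n) ?H snd)"
    then have A: "A \<in> sets ?H" by simp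
    then have "snd -` A \<inter> space (mixing \<beta> n) = space (std_gauss n) \<times> A"
      using sets.sets_into_space[OF A] by (auto simp: space_pair_measure)
    then show "emeasure (distr (mixing \<beta> n) ?H snd) A = emeasure ?H A"
      using A by (simp add: emeasure_distr H.emeasure_pair_measure_Times G.emeasure_space_1)
  qed simp
  also have "distr ?H (half_line_measure \<beta> l) (\<lambda>a. l * a) = half_line_measure \<beta> l"
    by (rule half_line_measure_scale) fact
  finally show ?thesis
    using measurable_compose[OF sm m] by (simp add: parameters_def half_line_space_def)
qed

lemma space_unit_leb: "space unit_leb = {0..1}"
  by (simp add: unit_leb_def space_restrict_space)

lemma prob_space_unit_leb: "prob_space unit_leb"
  by (rule prob_spaceI) (simp add: unit_leb_def space_restrict_space emeasure_restrict_space)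

lemma measure_unit_leb_parameter:
  assumes "\<theta> \<in> measurable unit_leb M" "distr unit_leb M \<theta> = M" "Q \<in> sets M"
  shows "measure unit_leb {s \<in> {0..1}. \<theta> s \<in> Q} = measure M Q" "{s \<in> {0..1}. \<theta> s \<in> Q} \<in> sets unit_leb"
proof -
  have eq: "{s \<in> {0..1}. \<theta> s \<in> Q} = \<theta> -` Q \<inter> space unit_leb"
    by (auto simp: space_unit_leb)
  show "{s \<in> {0..1}. \<theta> s \<in> Q} \<in> sets unit_leb" unfolding eq by (rule measurable_sets) fact+
  have "measure (distr unit_leb M \<theta>) Q = measure unit_leb (\<theta> -` Q \<inter> space unit_leb)"
    using assms by (intro measure_distr)
  then show "measure unit_leb {s \<in> {0..1}. \<theta> s \<in> Q} = measure M Q" unfolding eq assms(2) by simp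
qed

section \<open>Convergence, concentration and dissipation\<close>

lemma measurable_space_mixing:
  assumes "\<theta> \<in> measurable unit_leb (mixing \<beta> n)" "s \<in> {0..1}"
  shows "\<theta> s \<in> space (mixing \<beta> n)" "0 \<le> snd (\<theta> s)"
proof -
  show *: "\<theta> s \<in> space (mixing \<beta> n)"
    using measurable_space[OF assms(1), of s] assms(2) by (simp add: space_unit_leb)
  then show "0 \<le> snd (\<theta> s)" by (auto simp: space_pair_measure space_half_line_measure)
qed

section \<open>Box distance to a point\<close>

lemma box_dist_one_point_le:
  assumes \<beta>: "\<beta> > 0" and r: "r > 0" and \<epsilon>: "\<epsilon> > 0"
    and dev: "measure (mixing \<beta> n) {p \<in> space (mixing \<beta> n). \<epsilon> < \<bar>snd p * (r * L2_set (fst p) {..<n} - 0)\<bar>} \<le> \<epsilon>"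
  shows "box_dist (mm_scale r (cauchy_space \<beta> n)) (one_point_space p) \<le> ennreal (2 * \<epsilon>)"
proof -
  obtain \<theta> where \<theta>: "\<theta> \<in> measurable unit_leb (mixing \<beta> n)" "distr unit_leb (mixing \<beta> n) \<theta> = mixing \<beta> n"
    by (rule gauss_half_line_parameter[OF \<beta> zero_less_one])
  interpret U: prob_space unit_leb by (rule prob_space_unit_leb)
  let ?Q = "{p \<in> space (mixing \<beta> n). \<epsilon> < \<bar>snd p * (r * L2_set (fst p) {..<n} - 0)\<bar>}"
  define \<phi> where "\<phi> = (\<lambda>s. scale_vec n (snd (\<theta> s)) (fst (\<theta> s)))"
  define B where "B = {s \<in> {0..1}. \<theta> s \<in> ?Q}"
  note B = measure_unit_leb_parameter[OF \<theta> norm_deviation_sets[where \<beta> = \<beta> and n = n and \<epsilon> = \<epsilon> and r = r and l = 0], folded B_def]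
  define J where "J = space unit_leb - B"
  \<comment> \<open>Outside the exceptional set all points lie within \<epsilon> of the origin,
    hence within 2 \<epsilon> of each other; the exceptional set itself costs only
    \<epsilon>.\<close>
  have "2 * \<epsilon> \<in> {\<epsilon>. 0 \<le> \<epsilon> \<and> (\<exists>\<phi>\<in>parameters (mm_scale r (cauchy_space \<beta> n)). \<exists>\<psi>\<in>parameters (one_point_space p).
      \<exists>J\<in>sets unit_leb. 1 - \<epsilon> \<le> measure unit_leb J \<and>
      (\<forall>s\<in>J. \<forall>t\<in>J. \<bar>mm_dist (mm_scale r (cauchy_space \<beta> n)) (\<phi> s) (\<phi> t) - mm_dist (one_point_space p) (\<psi> s) (\<psi> t)\<bar> \<le> \<epsilon>))}"
  proof (intro CollectI conjI bexI[of _ \<phi>] bexI[of _ "\<lambda>_. p"] bexI[of _ J] ballI)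
    show "\<phi> \<in> parameters (mm_scale r (cauchy_space \<beta> n))"
      unfolding \<phi>_def by (rule cauchy_parameter[OF \<beta> \<theta>])
    show "(\<lambda>_. p) \<in> parameters (one_point_space p)"
      unfolding parameters_def one_point_space_def
      using U.distr_const[of p "return (count_space {p}) p"] by (auto intro: return_cong)
    show "J \<in> sets unit_leb" unfolding J_def using B(2) by simp
    have "measure unit_leb J = 1 - measure unit_leb B"
      unfolding J_def using B(2) by (rule U.prob_compl)
    then show "1 - 2 * \<epsilon> \<le> measure unit_leb J" using B(1) dev \<epsilon> by simp
    show "0 \<le> 2 * \<epsilon>" using \<epsilon> by simp
    fix s t assume st: "s \<in> J" "t \<in> J"
    have nb: "r * L2_set (\<phi> s) {..<n} \<le> \<epsilon>" if "s \<in> J" for s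
    proof -
      have s: "s \<in> {0..1}" "\<theta> s \<notin> ?Q" using that by (auto simp: J_def B_def space_unit_leb)
      then have "\<bar>snd (\<theta> s) * (r * L2_set (fst (\<theta> s)) {..<n})\<bar> \<le> \<epsilon>"
        using measurable_space_mixing[OF \<theta>(1) s(1)] by (simp add: not_less)
      then show ?thesis using r unfolding \<phi>_def L2_set_scale_vec by (simp add: abs_mult mult_ac)
    qed
    have "L2_set (\<lambda>i. \<phi> s i - \<phi> t i) {..<n} = L2_set (\<lambda>i. \<phi> s i + - \<phi> t i) {..<n}" by simp
    also have "\<dots> \<le> L2_set (\<phi> s) {..<n} + L2_set (\<lambda>i. - \<phi> t i) {..<n}"
      by (rule L2_set_triangle_ineq)
    also have "L2_set (\<lambda>i. - \<phi> t i) {..<n} = L2_set (\<phi> t) {..<n}" by (simp add: L2_set_def)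
    finally have "r * L2_set (\<lambda>i. \<phi> s i - \<phi> t i) {..<n} \<le> r * (L2_set (\<phi> s) {..<n} + L2_set (\<phi> t) {..<n})"
      using r by (intro mult_left_mono) auto
    also have "\<dots> \<le> 2 * \<epsilon>" using nb[OF st(1)] nb[OF st(2)] by (simp add: distrib_left)
    finally show "\<bar>mm_dist (mm_scale r (cauchy_space \<beta> n)) (\<phi> s) (\<phi> t) - mm_dist (one_point_space p) p p\<bar> \<le> 2 * \<epsilon>"
      using r by (simp add: mm_scale_cauchy_simps one_point_space_def)
  qed
  then show ?thesis unfolding box_dist_def by (rule INF_lower)
qed

lemma cauchy_box_converges:
  assumes \<beta>: "\<beta> > 0" and r: "\<And>n. n \<ge> 1 \<Longrightarrow> r n > 0" and lim: "(\<lambda>n. r n * sqrt (real n)) \<longlonglongrightarrow> 0"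
  shows "box_converges (\<lambda>n. mm_scale (r n) (cauchy_space \<beta> n)) (one_point_space p)"
  unfolding box_converges_def
proof (rule tendsto_zero_ennreal)
  fix e :: real assume e: "0 < e"
  \<comment> \<open>A quarter, because the box estimate doubles it and the final inequality has to
    be strict.\<close>
  have "e / 4 > 0" using e by simp
  from mixing_deviation[OF \<beta> _ lim this] r
  have dev: "\<forall>\<^sub>F n in sequentially.
    measure (mixing \<beta> n) {p \<in> space (mixing \<beta> n). e / 4 < \<bar>snd p * (r n * L2_set (fst p) {..<n} - 0)\<bar>} \<le> e / 4 \<and>
    (\<forall>F. euclid_lipschitz n (r n) F \<longrightarrow>
      measure (mixing \<beta> n) {p \<in> space (mixing \<beta> n).
        e / 4 < \<bar>F (scale_vec n (snd p) (fst p)) - gauss_mean n F (0 * snd p / (r n * sqrt (real n)))\<bar>} \<le> e / 4)"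
    by blast
  show "\<forall>\<^sub>F n in sequentially. box_dist (mm_scale (r n) (cauchy_space \<beta> n)) (one_point_space p) < ennreal e"
    using dev eventually_ge_at_top[of 1]
  proof eventually_elim
    case (elim n)
    then have "box_dist (mm_scale (r n) (cauchy_space \<beta> n)) (one_point_space p) \<le> ennreal (2 * (e / 4))"
      using e r by (intro box_dist_one_point_le[OF \<beta>]) auto
    also have "\<dots> < ennreal e" using e by (intro ennreal_lessI) auto
    finally show ?case .
  qed
qed

section \<open>Observable distance to the half line\<close>

lemma ky_fan_le:
  assumes "0 \<le> \<epsilon>" "A \<in> sets unit_leb" "measure unit_leb A \<le> \<epsilon>"
    and "\<And>s. s \<in> {0..1} \<Longrightarrow> \<epsilon> < \<bar>g s - h s\<bar> \<Longrightarrow> s \<in> A"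
  shows "ky_fan g h \<le> ennreal \<epsilon>"
proof -
  interpret U: prob_space unit_leb by (rule prob_space_unit_leb)
  \<comment> \<open>Monotonicity asks for measurability of the covering set \<open>A\<close> alone,
    so \<open>g\<close> and \<open>h\<close> may be arbitrary functions.\<close>
  have "measure unit_leb {s \<in> {0..1}. \<bar>g s - h s\<bar> > \<epsilon>} \<le> measure unit_leb A"
    using assms by (intro U.finite_measure_mono) auto
  then have "\<epsilon> \<in> {\<epsilon>. 0 \<le> \<epsilon> \<and> measure unit_leb {s \<in> {0..1}. \<bar>g s - h s\<bar> > \<epsilon>} \<le> \<epsilon>}"
    using assms by simp
  then show ?thesis unfolding ky_fan_def by (rule INF_lower)
qed

lemma conc_dist_half_line_le:
  assumes \<beta>: "\<beta> > 0" and r: "r > 0" and n: "n > 0" and l: "l > 0" and \<epsilon>: "\<epsilon> > 0"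
    and dev: "measure (mixing \<beta> n) {p \<in> space (mixing \<beta> n). \<epsilon> < \<bar>snd p * (r * L2_set (fst p) {..<n} - l)\<bar>} \<le> \<epsilon>"
    and devF: "\<And>F. euclid_lipschitz n r F \<Longrightarrow> measure (mixing \<beta> n) {p \<in> space (mixing \<beta> n).
        \<epsilon> < \<bar>F (scale_vec n (snd p) (fst p)) - gauss_mean n F (l * snd p / (r * sqrt (real n)))\<bar>} \<le> \<epsilon>"
  shows "conc_dist (mm_scale r (cauchy_space \<beta> n)) (half_line_space \<beta> l) \<le> ennreal \<epsilon>"
proof -
  obtain \<theta> where \<theta>: "\<theta> \<in> measurable unit_leb (mixing \<beta> n)" "distr unit_leb (mixing \<beta> n) \<theta> = mixing \<beta> n"
    by (rule gauss_half_line_parameter[OF \<beta> zero_less_one])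
  let ?X = "mm_scale r (cauchy_space \<beta> n)" and ?Y = "half_line_space \<beta> l"
  define \<phi> where "\<phi> = (\<lambda>s. scale_vec n (snd (\<theta> s)) (fst (\<theta> s)))"
  define \<psi> where "\<psi> = (\<lambda>s. l * snd (\<theta> s))"
  have par: "\<phi> \<in> parameters ?X" "\<psi> \<in> parameters ?Y"
    unfolding \<phi>_def \<psi>_def by (rule cauchy_parameter[OF \<beta> \<theta>], rule half_line_parameter[OF \<beta> l \<theta>])
  have Y: "space (mm_meas ?Y) = {0..}" "mm_dist ?Y = (\<lambda>s t. \<bar>s - t\<bar>)"
    by (simp_all add: half_line_space_def space_half_line_measure)
  have lipX: "F \<in> lip1 ?X \<longleftrightarrow> euclid_lipschitz n r F" for F
    using r by (intro lip1_scale_cauchy) simp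
  have 1: "(INF b\<in>lip1_pullback \<psi> ?Y. ky_fan a b) \<le> ennreal \<epsilon>" if aX: "a \<in> lip1_pullback \<phi> ?X" for a
  proof -
    obtain F where F: "euclid_lipschitz n r F" "a = F \<circ> \<phi>" using aX by (auto simp: lip1_pullback_def lipX)
    \<comment> \<open>Averaging F over the Gaussian vector at the scale matching \<open>t\<close>
      removes the direction and leaves a function on the half line.\<close>
    define f where "f = (\<lambda>t. gauss_mean n F (t / (r * sqrt (real n))))"
    have p: "r * sqrt (real n) > 0" using r n by simp
    have "f \<in> lip1 ?Y"
      unfolding lip1_def Y
    proof (intro CollectI ballI)
      fix x y :: real
      have "\<bar>f x - f y\<bar> \<le> r * \<bar>x / (r * sqrt (real n)) - y / (r * sqrt (real n))\<bar> * sqrt (real n)"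
        unfolding f_def by (rule gauss_mean_lipschitz[OF F(1)])
      also have "\<dots> = \<bar>x - y\<bar>"
        using p r n by (simp add: diff_divide_distrib[symmetric] abs_mult)
      finally show "\<bar>f x - f y\<bar> \<le> \<bar>x - y\<bar>" .
    qed
    then have "f \<circ> \<psi> \<in> lip1_pullback \<psi> ?Y" by (auto simp: lip1_pullback_def)
    moreover have "ky_fan a (f \<circ> \<psi>) \<le> ennreal \<epsilon>"
    proof -
      let ?Q = "{p \<in> space (mixing \<beta> n).
        \<epsilon> < \<bar>F (scale_vec n (snd p) (fst p)) - gauss_mean n F (l * snd p / (r * sqrt (real n)))\<bar>}"
      note Q = measure_unit_leb_parameter[OF \<theta> lipschitz_deviation_sets[OF F(1), where \<beta> = \<beta> and \<epsilon> = \<epsilon> and l = l and c = "r * sqrt (real n)"]]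
      show ?thesis
      proof (rule ky_fan_le[OF _ Q(2)])
        show "measure unit_leb {s \<in> {0..1}. \<theta> s \<in> ?Q} \<le> \<epsilon>" unfolding Q(1) by (rule devF[OF F(1)])
        fix s :: real assume "s \<in> {0..1}" "\<epsilon> < \<bar>a s - (f \<circ> \<psi>) s\<bar>"
        then show "s \<in> {s \<in> {0..1}. \<theta> s \<in> ?Q}"
          using measurable_space_mixing[OF \<theta>(1)] by (simp add: F(2) f_def \<phi>_def \<psi>_def)
      qed (use \<epsilon> in simp)
    qed
    ultimately show ?thesis by (rule INF_lower2[where f = "ky_fan a"])
  qed
  have 2: "(INF a\<in>lip1_pullback \<phi> ?X. ky_fan a b) \<le> ennreal \<epsilon>" if bY: "b \<in> lip1_pullback \<psi> ?Y" for b
  proof -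
    obtain f where f: "f \<in> lip1 ?Y" "b = f \<circ> \<psi>" using bY by (auto simp: lip1_pullback_def)
    then have lip: "\<bar>f x - f y\<bar> \<le> \<bar>x - y\<bar>" if "x \<ge> 0" "y \<ge> 0" for x y
      using that unfolding lip1_def Y by auto
    \<comment> \<open>In the other direction \<open>f\<close> is made radial. Its argument is
      nonnegative, which is where membership in \<open>lip1\<close> controls it.\<close>
    define F where "F = (\<lambda>x. f (r * L2_set x {..<n}))"
    have "euclid_lipschitz n r F"
      unfolding euclid_lipschitz_def
    proof (intro conjI ballI)
      fix x y :: "nat \<Rightarrow> real" assume xy: "x \<in> extensional {..<n}" "y \<in> extensional {..<n}"
      have "\<bar>F x - F y\<bar> \<le> \<bar>r * L2_set x {..<n} - r * L2_set y {..<n}\<bar>"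
        unfolding F_def using r by (intro lip) auto
      also have "\<dots> = r * \<bar>L2_set x {..<n} - L2_set y {..<n}\<bar>"
        using r by (simp add: abs_mult flip: right_diff_distrib)
      also have "\<dots> \<le> r * (1 * L2_set (\<lambda>i. x i - y i) {..<n})"
        using r by (intro mult_left_mono euclid_lipschitzD[OF euclid_lipschitz_norm xy]) auto
      finally show "\<bar>F x - F y\<bar> \<le> r * L2_set (\<lambda>i. x i - y i) {..<n}" by simp
    qed (use r in simp)
    then have "F \<circ> \<phi> \<in> lip1_pullback \<phi> ?X" by (auto simp: lip1_pullback_def lipX)
    moreover have "ky_fan (F \<circ> \<phi>) b \<le> ennreal \<epsilon>"
    proof -
      let ?Q = "{p \<in> space (mixing \<beta> n). \<epsilon> < \<bar>snd p * (r * L2_set (fst p) {..<n} - l)\<bar>}"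
      note Q = measure_unit_leb_parameter[OF \<theta> norm_deviation_sets[where \<beta> = \<beta> and n = n and \<epsilon> = \<epsilon> and r = r and l = l]]
      show ?thesis
      proof (rule ky_fan_le[OF _ Q(2)])
        show "measure unit_leb {s \<in> {0..1}. \<theta> s \<in> ?Q} \<le> \<epsilon>" unfolding Q(1) by (rule dev)
        fix s :: real assume s: "s \<in> {0..1}" "\<epsilon> < \<bar>(F \<circ> \<phi>) s - b s\<bar>"
        have a: "0 \<le> snd (\<theta> s)" by (rule measurable_space_mixing(2)[OF \<theta>(1) s(1)])
        have "\<bar>(F \<circ> \<phi>) s - b s\<bar> \<le> \<bar>r * L2_set (\<phi> s) {..<n} - \<psi> s\<bar>"
          unfolding F_def f(2) comp_def using r l a by (intro lip) (auto simp: \<psi>_def)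
        also have "r * L2_set (\<phi> s) {..<n} - \<psi> s = snd (\<theta> s) * (r * L2_set (fst (\<theta> s)) {..<n} - l)"
          unfolding \<phi>_def \<psi>_def L2_set_scale_vec using a by (simp add: algebra_simps)
        finally show "s \<in> {s \<in> {0..1}. \<theta> s \<in> ?Q}"
          using s measurable_space_mixing(1)[OF \<theta>(1) s(1)] by simp
      qed (use \<epsilon> in simp)
    qed
    ultimately show ?thesis by (rule INF_lower2[where f = "\<lambda>a. ky_fan a b"])
  qed
  have "hausdorff_dist ky_fan (lip1_pullback \<phi> ?X) (lip1_pullback \<psi> ?Y) \<le> ennreal \<epsilon>"
    unfolding hausdorff_dist_def using 1 2 by (intro max.boundedI SUP_least) auto
  then have "(INF \<psi>\<in>parameters ?Y. hausdorff_dist ky_fan (lip1_pullback \<phi> ?X) (lip1_pullback \<psi> ?Y)) \<le> ennreal \<epsilon>"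
    by (rule INF_lower2[OF par(2)])
  then show ?thesis unfolding conc_dist_def by (rule INF_lower2[OF par(1)])
qed

lemma cauchy_concentrates:
  assumes \<beta>: "\<beta> > 0" and r: "\<And>n. n \<ge> 1 \<Longrightarrow> r n > 0" and l: "l > 0"
    and lim: "(\<lambda>n. r n * sqrt (real n)) \<longlonglongrightarrow> l"
  shows "concentrates (\<lambda>n. mm_scale (r n) (cauchy_space \<beta> n)) (half_line_space \<beta> l)"
  unfolding concentrates_def
proof (rule tendsto_zero_ennreal)
  fix e :: real assume e: "0 < e"
  have "e / 2 > 0" using e by simp
  from mixing_deviation[OF \<beta> _ lim this] r
  have dev: "\<forall>\<^sub>F n in sequentially.
    measure (mixing \<beta> n) {p \<in> space (mixing \<beta> n). e / 2 < \<bar>snd p * (r n * L2_set (fst p) {..<n} - l)\<bar>} \<le> e / 2 \<and>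
    (\<forall>F. euclid_lipschitz n (r n) F \<longrightarrow>
      measure (mixing \<beta> n) {p \<in> space (mixing \<beta> n).
        e / 2 < \<bar>F (scale_vec n (snd p) (fst p)) - gauss_mean n F (l * snd p / (r n * sqrt (real n)))\<bar>} \<le> e / 2)"
    by blast
  show "\<forall>\<^sub>F n in sequentially. conc_dist (mm_scale (r n) (cauchy_space \<beta> n)) (half_line_space \<beta> l) < ennreal e"
    using dev eventually_ge_at_top[of 1]
  proof eventually_elim
    case (elim n)
    then have "conc_dist (mm_scale (r n) (cauchy_space \<beta> n)) (half_line_space \<beta> l) \<le> ennreal (e / 2)"
      using e r by (intro conc_dist_half_line_le[OF \<beta> _ _ l]) auto
    also have "\<dots> < ennreal e" using e by (intro ennreal_lessI) auto
    finally show ?case .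
  qed
qed

section \<open>Separation of spherical shells\<close>

lemma (in real_distribution) separated_intervals:
  fixes \<kappa> :: "nat \<Rightarrow> real"
  assumes atoms: "\<And>x. measure M {x} = 0" and N: "N \<ge> 1" and \<kappa>: "\<And>i. i \<le> N \<Longrightarrow> \<kappa> i > 0" "(\<Sum>i\<le>N. \<kappa> i) < 1"
  shows "\<exists>c d \<delta> g. \<delta> > 0 \<and> g > 0 \<and> (\<forall>i\<le>N. \<kappa> i + \<delta> \<le> measure M {c i<..d i}) \<and>
    (\<forall>i j. i < j \<longrightarrow> j \<le> N \<longrightarrow> d i + g \<le> c j)"
proof -
  have cont: "isCont (cdf M) x" for x using atoms by (simp add: isCont_cdf)
  have ivt: "\<exists>x. cdf M x = p" if "0 < p" "p < 1" for p
  proof -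
    have "\<forall>\<^sub>F x in at_bot. cdf M x < p" using order_tendstoD(2)[OF cdf_lim_at_bot that(1)] .
    then obtain x where x: "cdf M x < p" using eventually_happens'[OF trivial_limit_at_bot_linorder] by blast
    have "\<forall>\<^sub>F x in at_top. p < cdf M x" using order_tendstoD(1)[OF cdf_lim_at_top_prob that(2)] .
    then obtain y where y: "p < cdf M y" using eventually_happens'[OF trivial_limit_at_top_linorder] by blast
    have "x \<le> y" using x y cdf_nondecreasing[of y x] by force
    then show ?thesis using IVT[of "cdf M" x p y] x y cont by (auto intro: less_imp_le)
  qed
  \<comment> \<open>The spare mass \<open>1 - (\<Sum>i\<le>N. \<kappa> i)\<close> is divided into 2
    N + 3 equal parts: one extra for each of the N + 1 intervals, one for each of the N gaps between
    them, and one at either end. The parts at the ends keep all levels strictly between 0 and 1,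
    where \<open>ivt\<close> applies; those added to the intervals absorb the deviation probability
    later.\<close>
  define \<delta> where "\<delta> = (1 - (\<Sum>i\<le>N. \<kappa> i)) / (2 * real N + 3)"
  have \<delta>: "\<delta> > 0" using \<kappa>(2) by (simp add: \<delta>_def)
  have \<delta>N: "(\<Sum>i\<le>N. \<kappa> i) + (2 * real N + 3) * \<delta> = 1" by (simp add: \<delta>_def)
  \<comment> \<open>\<open>p i\<close> and \<open>q i\<close> are the levels of the distribution
    function at the left and right end of interval \<open>i\<close>.\<close>
  define p where "p = (\<lambda>i. (\<Sum>j<i. \<kappa> j) + (2 * real i + 1) * \<delta>)"
  define q where "q = (\<lambda>i. (\<Sum>j\<le>i. \<kappa> j) + (2 * real i + 2) * \<delta>)"
  have pq: "q i - p i = \<kappa> i + \<delta>" for i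
    by (simp add: p_def q_def lessThan_Suc_atMost[symmetric] algebra_simps)
  have qp: "q i < p j" if "i < j" "j \<le> N" for i j
  proof -
    have "(\<Sum>k\<le>i. \<kappa> k) \<le> (\<Sum>k<j. \<kappa> k)"
      using that \<kappa>(1) by (intro sum_mono2) (auto intro: less_imp_le)
    moreover have "2 * real i + 2 < 2 * real j + 1" using that by simp
    then have "(2 * real i + 2) * \<delta> < (2 * real j + 1) * \<delta>" using \<delta> by (rule mult_strict_right_mono)
    ultimately show ?thesis by (simp add: p_def q_def)
  qed
  have range: "0 < p i" "p i < 1" "0 < q i" "q i < 1" if "i \<le> N" for i
  proof -
    have "0 \<le> (\<Sum>j<i. \<kappa> j)" using that \<kappa>(1) by (intro sum_nonneg) (auto intro: less_imp_le)
    moreover have "0 < (2 * real i + 1) * \<delta>" using \<delta> by simp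
    ultimately show p0: "0 < p i" by (simp add: p_def)
    have "(\<Sum>k\<le>i. \<kappa> k) \<le> (\<Sum>k\<le>N. \<kappa> k)"
      using that \<kappa>(1) by (intro sum_mono2) (auto intro: less_imp_le)
    moreover have "(2 * real i + 2) * \<delta> < (2 * real N + 3) * \<delta>"
      using that \<delta> by (intro mult_strict_right_mono) auto
    ultimately show q1: "q i < 1" using \<delta>N by (simp add: q_def)
    have "p i < q i" using pq[of i] \<kappa>(1)[OF that] \<delta> by simp
    then show "p i < 1" "0 < q i" using p0 q1 by simp_all
  qed
  have "\<forall>i\<in>{..N}. \<exists>x. cdf M x = p i" "\<forall>i\<in>{..N}. \<exists>x. cdf M x = q i"
    using range ivt by auto
  then obtain c d where c: "\<And>i. i \<le> N \<Longrightarrow> cdf M (c i) = p i" and d: "\<And>i. i \<le> N \<Longrightarrow> cdf M (d i) = q i"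
    by (metis atMost_iff)
  have mass: "\<kappa> i + \<delta> \<le> measure M {c i<..d i}" if "i \<le> N" for i
  proof -
    have lt: "cdf M (c i) < cdf M (d i)" using pq[of i] c[OF that] d[OF that] \<kappa>(1)[OF that] \<delta> by simp
    then have "c i < d i" using cdf_nondecreasing[of "d i" "c i"] by (meson leD leI)
    then show ?thesis using cdf_diff_eq[of "c i" "d i"] pq[of i] c[OF that] d[OF that] by simp
  qed
  have gap: "d i < c j" if "i < j" "j \<le> N" for i j
  proof -
    have "cdf M (d i) < cdf M (c j)" using qp[OF that] c[of j] d[of i] that by simp
    then show ?thesis using cdf_nondecreasing[of "c j" "d i"] by (meson leD leI)
  qed
  define P where "P = {(i, j). i < j \<and> j \<le> N}"
  \<comment> \<open>N \<ge> 1 makes \<open>P\<close> nonempty, so this is a genuine minimum.\<close>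
  define g where "g = Min ((\<lambda>(i, j). c j - d i) ` P)"
  have fin: "finite P" by (rule finite_subset[of _ "{..N} \<times> {..N}"]) (auto simp: P_def)
  have ne: "P \<noteq> {}" using N by (auto simp: P_def)
  have "g > 0" unfolding g_def using fin ne gap by (subst Min_gr_iff) (auto simp: P_def)
  moreover have "d i + g \<le> c j" if "i < j" "j \<le> N" for i j
  proof -
    have "g \<le> c j - d i" unfolding g_def using fin that by (intro Min_le) (auto simp: P_def image_iff)
    then show ?thesis by simp
  qed
  ultimately show ?thesis using \<delta> mass by (intro exI[of _ c] exI[of _ d] exI[of _ \<delta>] exI[of _ g]) simp
qed

text \<open>If a lies in (c, d] and (z, a) avoids the deviation event, then r |a z| is within \<eta>
  of a and a z lies in the widened shell. The widening and the loss of mass, both \<eta>, are the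
  two halves of the deviation hypothesis.\<close>

lemma cauchy_measure_shell:
  fixes c d :: real
  assumes \<beta>: "\<beta> > 0" and dev: "measure (mixing \<beta> n) {p \<in> space (mixing \<beta> n). \<eta> < \<bar>snd p * (r * L2_set (fst p) {..<n} - 1)\<bar>} \<le> \<eta>"
    and r: "r > 0"
  defines "A \<equiv> {x \<in> extensional {..<n}. c - \<eta> \<le> r * L2_set x {..<n} \<and> r * L2_set x {..<n} \<le> d + \<eta>}"
  shows "A \<in> sets (cauchy_measure \<beta> n)" "measure (half_line_dist \<beta>) {c<..d} - \<eta> \<le> measure (cauchy_measure \<beta> n) A"
proof -
  let ?S = "\<lambda>p. scale_vec n (snd p) (fst p)" and ?L = "PiM {..<n} (\<lambda>_. lborel :: real measure)"
  let ?H = "half_line_measure \<beta> 1"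
  interpret G: prob_space "std_gauss n" by (rule prob_space_std_gauss)
  interpret H: prob_space ?H using \<beta> by (intro prob_space_half_line) auto
  interpret P: pair_prob_space "std_gauss n" ?H ..
  have [measurable]: "(\<lambda>x. L2_set x {..<n}) \<in> borel_measurable ?L" unfolding L2_set_def by measurable
  have "A = {x \<in> space ?L. c - \<eta> \<le> r * L2_set x {..<n} \<and> r * L2_set x {..<n} \<le> d + \<eta>}"
    by (simp add: A_def space_PiM PiE_def)
  then have AL: "A \<in> sets ?L" by simp
  then show "A \<in> sets (cauchy_measure \<beta> n)" by (simp add: cauchy_measure_def)
  let ?Q = "{p \<in> space (mixing \<beta> n). \<eta> < \<bar>snd p * (r * L2_set (fst p) {..<n} - 1)\<bar>}"
  let ?I = "{p \<in> space (mixing \<beta> n). snd p \<in> {c<..d}}" and ?B = "?S -` A \<inter> space (mixing \<beta> n)"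
  have B: "?B \<in> sets (mixing \<beta> n)" by (rule measurable_sets[OF scale_vec_measurable AL])
  note [measurable] = snd_mixing_measurable measurable_half_line
  have "{a \<in> space ?H. a \<in> {c<..d}} \<in> sets ?H" by measurable
  then have "measure (mixing \<beta> n) (space (std_gauss n) \<times> {a \<in> space ?H. a \<in> {c<..d}}) = measure ?H {a \<in> space ?H. a \<in> {c<..d}}"
    by (simp add: measure_def H.emeasure_pair_measure_Times G.emeasure_space_1)
  moreover have "?I = space (std_gauss n) \<times> {a \<in> space ?H. a \<in> {c<..d}}"
    by (auto simp: space_pair_measure)
  ultimately have I: "measure (mixing \<beta> n) ?I = measure (half_line_dist \<beta>) {c<..d}"
    by (simp add: measure_half_line_dist)
  have "?I \<subseteq> ?B \<union> ?Q"
  proof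
    fix p assume p: "p \<in> ?I"
    show "p \<in> ?B \<union> ?Q"
    proof (cases "p \<in> ?Q")
      case False
      then have *: "\<bar>snd p * (r * L2_set (fst p) {..<n} - 1)\<bar> \<le> \<eta>" using p by (simp add: not_less)
      have "0 \<le> snd p" using p by (auto simp: space_pair_measure space_half_line_measure)
      then have "r * L2_set (?S p) {..<n} - snd p = snd p * (r * L2_set (fst p) {..<n} - 1)"
        unfolding L2_set_scale_vec by (simp add: algebra_simps)
      then have "\<bar>r * L2_set (?S p) {..<n} - snd p\<bar> \<le> \<eta>" using * by simp
      then have "?S p \<in> A" using p unfolding A_def by auto
      then show ?thesis using p by simp
    qed simp
  qed
  then have "measure (mixing \<beta> n) ?I \<le> measure (mixing \<beta> n) (?B \<union> ?Q)"
    using B norm_deviation_sets by (intro P.finite_measure_mono) auto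
  also have "\<dots> \<le> measure (mixing \<beta> n) ?B + measure (mixing \<beta> n) ?Q"
    using B norm_deviation_sets by (intro measure_Un_le) auto
  also have "measure (mixing \<beta> n) ?B = measure (cauchy_measure \<beta> n) A"
  proof -
    have "cauchy_measure \<beta> n = distr (mixing \<beta> n) ?L ?S"
      unfolding cauchy_measure_mixture[OF \<beta>] by (simp add: case_prod_beta' scale_vec_def)
    then show ?thesis by (simp add: measure_distr[OF scale_vec_measurable AL])
  qed
  finally show "measure (half_line_dist \<beta>) {c<..d} - \<eta> \<le> measure (cauchy_measure \<beta> n) A"
    unfolding I using dev by linarith
qed

lemma cauchy_infinitely_dissipates:
  assumes \<beta>: "\<beta> > 0" and r: "\<And>n. n \<ge> 1 \<Longrightarrow> r n > 0" 
    and lim: "filterlim (\<lambda>n. r n * sqrt (real n)) at_top sequentially"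
  shows "infinitely_dissipates (\<lambda>n. mm_scale (r n) (cauchy_space \<beta> n))"
  unfolding infinitely_dissipates_def
proof (intro allI impI)
  fix N :: nat and \<kappa> :: "nat \<Rightarrow> real"
  assume N: "1 \<le> N" and \<kappa>: "(\<forall>i\<le>N. 0 < \<kappa> i) \<and> (\<Sum>i\<le>N. \<kappa> i) < 1"
  interpret D: real_distribution "half_line_dist \<beta>" by (rule real_distribution_half_line) fact
  have "\<exists>c d \<delta> g. \<delta> > 0 \<and> g > 0 \<and> (\<forall>i\<le>N. \<kappa> i + \<delta> \<le> measure (half_line_dist \<beta>) {c i<..d i}) \<and>
    (\<forall>i j. i < j \<longrightarrow> j \<le> N \<longrightarrow> d i + g \<le> c j)"
    by (rule D.separated_intervals[OF half_line_no_atoms N]) (simp_all add: \<kappa>)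
  then obtain c d \<delta> g where \<delta>: "\<delta> > 0" and g: "g > 0"
    and mass: "\<forall>i\<le>N. \<kappa> i + \<delta> \<le> measure (half_line_dist \<beta>) {c i<..d i}"
    and gap: "\<forall>i j. i < j \<longrightarrow> j \<le> N \<longrightarrow> d i + g \<le> c j"
    by (elim exE conjE)
  \<comment> \<open>The spare \<delta> covers the mass lost to deviations. Widening every shell by
    \<eta> takes 2 \<eta> from a gap of at least 4 \<eta> and leaves 2 \<eta>.\<close>
  define \<eta> where "\<eta> = min \<delta> (g / 4)"
  have \<eta>: "\<eta> > 0" "\<eta> \<le> \<delta>" "4 * \<eta> \<le> g" using \<delta> g by (auto simp: \<eta>_def)
  \<comment> \<open>The shells are built at the scale 1 / sqrt n, for which
    \<open>mixing_deviation\<close> has the finite limit 1, while r n sqrt n diverges.\<close>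
  have lim1: "(\<lambda>n. 1 / sqrt (real n) * sqrt (real n)) \<longlonglongrightarrow> 1"
  proof (rule Lim_transform_eventually[OF tendsto_const])
    show "\<forall>\<^sub>F n in sequentially. 1 = 1 / sqrt (real n) * sqrt (real n)"
      using eventually_ge_at_top[of 1] by eventually_elim simp
  qed
  have dev: "\<forall>\<^sub>F n in sequentially. measure (mixing \<beta> n)
      {p \<in> space (mixing \<beta> n). \<eta> < \<bar>snd p * (1 / sqrt (real n) * L2_set (fst p) {..<n} - 1)\<bar>} \<le> \<eta>"
    by (rule eventually_mono[OF mixing_deviation[OF \<beta> _ lim1 \<eta>(1)]]) (simp, rule conjunct1)
  have lower: "\<forall>\<^sub>F n in sequentially. ennreal (2 * \<eta> * (r n * sqrt (real n))) \<le> separation (mm_scale (r n) (cauchy_space \<beta> n)) N \<kappa>"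
    using dev eventually_ge_at_top[of 1]
  proof eventually_elim
    case (elim n)
    let ?X = "mm_scale (r n) (cauchy_space \<beta> n)"
    define u where "u = 1 / sqrt (real n)"
    have u: "u > 0" using elim(2) by (simp add: u_def)
    define A where "A = (\<lambda>i. {x \<in> extensional {..<n}. c i - \<eta> \<le> u * L2_set x {..<n} \<and> u * L2_set x {..<n} \<le> d i + \<eta>})"
    have adm: "A \<in> {A. \<forall>i\<le>N. A i \<in> sets (mm_meas ?X) \<and> measure (mm_meas ?X) (A i) \<ge> \<kappa> i}"
      unfolding mm_scale_cauchy_simps
    proof (intro CollectI allI impI conjI)
      fix i assume i: "i \<le> N"
      show "A i \<in> sets (cauchy_measure \<beta> n)" unfolding A_def by (rule cauchy_measure_shell(1)[OF \<beta> elim(1)[folded u_def] u])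
      have "measure (half_line_dist \<beta>) {c i<..d i} - \<eta> \<le> measure (cauchy_measure \<beta> n) (A i)"
        unfolding A_def by (rule cauchy_measure_shell(2)[OF \<beta> elim(1)[folded u_def] u])
      then show "\<kappa> i \<le> measure (cauchy_measure \<beta> n) (A i)" using mass[rule_format, OF i] \<eta> by linarith
    qed
    have far: "2 * \<eta> * (r n * sqrt (real n)) \<le> r n * L2_set (\<lambda>k. x k - y k) {..<n}"
      if ij: "i < j" "j \<le> N" and x: "x \<in> A i" and y: "y \<in> A j" for i j x y
    proof -
      have "2 * \<eta> \<le> u * L2_set y {..<n} - u * L2_set x {..<n}"
        using x y gap[rule_format, OF ij] \<eta> by (simp add: A_def)
      also have "\<dots> = u * (L2_set y {..<n} - L2_set x {..<n})" by (simp add: right_diff_distrib)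
      also have "\<dots> \<le> u * L2_set (\<lambda>k. x k - y k) {..<n}"
      proof (rule mult_left_mono)
        have "\<bar>L2_set x {..<n} - L2_set y {..<n}\<bar> \<le> 1 * L2_set (\<lambda>k. x k - y k) {..<n}"
          using x y by (intro euclid_lipschitzD[OF euclid_lipschitz_norm]) (auto simp: A_def)
        then show "L2_set y {..<n} - L2_set x {..<n} \<le> L2_set (\<lambda>k. x k - y k) {..<n}" by simp
      qed (use u in simp)
      \<comment> \<open>Since \<open>u * sqrt (real n)\<close> is 1, the factor r n sqrt n converts
        distances at the scale \<open>u\<close> into distances of the scaled Cauchy space.\<close>
      finally have "2 * \<eta> * (r n * sqrt (real n)) \<le> u * L2_set (\<lambda>k. x k - y k) {..<n} * (r n * sqrt (real n))"
        using r[of n] elim(2) by (intro mult_right_mono) auto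
      also have "\<dots> = r n * L2_set (\<lambda>k. x k - y k) {..<n}" using elim(2) by (simp add: u_def)
      finally show ?thesis .
    qed
    have "ennreal (2 * \<eta> * (r n * sqrt (real n))) \<le> (INF (i, j) \<in> {(i, j). i \<le> N \<and> j \<le> N \<and> i \<noteq> j}. set_dist ?X (A i) (A j))"
    proof (rule INF_greatest)
      fix ij assume "ij \<in> {(i, j). i \<le> N \<and> j \<le> N \<and> i \<noteq> j}"
      then obtain i j where eq: "ij = (i, j)" and ij: "i \<le> N" "j \<le> N" "i \<noteq> j" by blast
      have "ennreal (2 * \<eta> * (r n * sqrt (real n))) \<le> set_dist ?X (A i) (A j)"
        unfolding set_dist_def mm_scale_cauchy_simps
      proof (intro INF_greatest ennreal_leI)
        fix x y assume xy: "x \<in> A i" "y \<in> A j"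
        show "2 * \<eta> * (r n * sqrt (real n)) \<le> r n * L2_set (\<lambda>i. x i - y i) {..<n}"
        proof (cases "i < j")
          case True then show ?thesis by (rule far[OF _ ij(2) xy])
        next
          case False
          then have "j < i" using ij(3) by simp
          then have "2 * \<eta> * (r n * sqrt (real n)) \<le> r n * L2_set (\<lambda>k. y k - x k) {..<n}"
            by (rule far[OF _ ij(1) xy(2,1)])
          also have "L2_set (\<lambda>k. y k - x k) {..<n} = L2_set (\<lambda>k. x k - y k) {..<n}" by (simp add: L2_set_def power2_commute)
          finally show ?thesis .
        qed
      qed
      then show "ennreal (2 * \<eta> * (r n * sqrt (real n))) \<le> (case ij of (i, j) \<Rightarrow> set_dist ?X (A i) (A j))"
        by (simp only: eq prod.case)
    qed
    also have "\<dots> \<le> separation ?X N \<kappa>"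
      unfolding separation_def
      by (rule SUP_upper[OF adm, where f = "\<lambda>A. INF (i, j) \<in> {(i, j). i \<le> N \<and> j \<le> N \<and> i \<noteq> j}. set_dist ?X (A i) (A j)"])
    finally show ?case .
  qed
  have "filterlim (\<lambda>n. 2 * \<eta> * (r n * sqrt (real n))) at_top sequentially"
    using \<eta>(1) by (intro filterlim_tendsto_pos_mult_at_top[OF tendsto_const _ lim]) simp
  then have lim_lower: "(\<lambda>n. ennreal (2 * \<eta> * (r n * sqrt (real n)))) \<longlonglongrightarrow> \<infinity>"
    by (simp add: ennreal_tendsto_top_eq_at_top)
  show "(\<lambda>n. separation (mm_scale (r n) (cauchy_space \<beta> n)) N \<kappa>) \<longlonglongrightarrow> \<infinity>"
    by (rule tendsto_sandwich[OF lower _ lim_lower tendsto_const]) simp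
qed

theorem theorem1p5:
  fixes \<beta> :: real and r :: "nat \<Rightarrow> real" and p :: 'p
  assumes "\<beta> > 0" and "\<And>n. n \<ge> 1 \<Longrightarrow> r n > 0"
  shows "((\<lambda>n. r n * sqrt (real n)) \<longlonglongrightarrow> 0 \<longrightarrow>
            box_converges (\<lambda>n. mm_scale (r n) (cauchy_space \<beta> n)) (one_point_space p)) \<and>
         (\<forall>l>0. (\<lambda>n. r n * sqrt (real n)) \<longlonglongrightarrow> l \<longrightarrow>
            concentrates (\<lambda>n. mm_scale (r n) (cauchy_space \<beta> n)) (half_line_space \<beta> l)) \<and>
         (filterlim (\<lambda>n. r n * sqrt (real n)) at_top sequentially \<longrightarrow>
            infinitely_dissipates (\<lambda>n. mm_scale (r n) (cauchy_space \<beta> n)))"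
proof (intro conjI allI impI)
  assume lim: "(\<lambda>n. r n * sqrt (real n)) \<longlonglongrightarrow> 0"
  show "box_converges (\<lambda>n. mm_scale (r n) (cauchy_space \<beta> n)) (one_point_space p)"
    by (rule cauchy_box_converges[where r = r, OF assms(1) _ lim]) (rule assms(2))
next
  fix l :: real assume l: "l > 0" and lim: "(\<lambda>n. r n * sqrt (real n)) \<longlonglongrightarrow> l"
  show "concentrates (\<lambda>n. mm_scale (r n) (cauchy_space \<beta> n)) (half_line_space \<beta> l)"
    by (rule cauchy_concentrates[where r = r, OF assms(1) _ l lim]) (rule assms(2))
next
  assume lim: "filterlim (\<lambda>n. r n * sqrt (real n)) at_top sequentially"
  show "infinitely_dissipates (\<lambda>n. mm_scale (r n) (cauchy_space \<beta> n))"
    by (rule cauchy_infinitely_dissipates[where r = r, OF assms(1) _ lim]) (rule assms(2))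
qed

end
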